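(* Fix a nonzero integer $a$ and $\varepsilon>0$. Let $\xi$ be an increasing function with $\xi(x)\to\infty$ as $x\to\infty$ and $\xi(x)\le\log x$ for all $x$. Then, as $x\to\infty$, all but $o(x/\log x)$ primes $p\in(|a|+1,x]$ satisfy \[ \inf_{\xi(x)<t\le x}\Lambda(p+a,t)\in[-1-\varepsilon,-1+\varepsilon]\quad\text{and}\quad \sup_{\xi(x)<t\le x}\Lambda(p+a,t)\in[1-\varepsilon,1+\varepsilon]. \]
   Context: $\log_k$ denotes the $k$-th iterate of the natural logarithm. For real $t$ with $\log_4 t\ge1$ and a positive integer $n$, \[ \Lambda(n,t)=\frac{\omega(n,[2,t])-\log_2 t}{\sqrt{2\log_2 t\cdot\log_4 t}}, \] where $\omega(n,[2,t])$ is the number of distinct primes $q\le t$ dividing $n$. (For large $x$, every $t>\xi(x)$ satisfies $\log_4 t\ge 1$.) *)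

theory Defs
  imports
    Complex_Main
    "HOL-Computational_Algebra.Primes"
    "HOL-Library.Landau_Symbols"
begin

definition iter_ln :: "nat \<Rightarrow> real \<Rightarrow> real" where
  "iter_ln k t = (ln ^^ k) t"

definition omega_on :: "nat \<Rightarrow> real set \<Rightarrow> nat" where
  "omega_on n S = card {q \<in> prime_factors n. real q \<in> S}"

(* Meaningful for iter_ln 4 t >= 1 and n > 0; other arguments give an arbitrary value.
   If xi tends to infinity, then for large x every t > xi x satisfies iter_ln 4 t >= 1. *)
definition Lambda :: "nat \<Rightarrow> real \<Rightarrow> real" where
  "Lambda n t =
     (real (omega_on n {2..t}) - iter_ln 2 t) / sqrt (2 * iter_ln 2 t * iter_ln 4 t)"

end

theory Submission
  imports Defs "HOL-Number_Theory.Cong" "HOL-Library.Disjoint_Sets" "HOL-Real_Asymp.Real_Asymp"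
begin

text \<open>
  Let \<open>T = x powr (1 / (ln (ln x))\<^sup>2)\<close>. For a set \<open>S\<close> of primes up to \<open>T\<close>, a Selberg sieve bounds the number
  of primes \<open>p \<le> x\<close> for which \<open>S\<close> is exactly the set of prime factors of \<open>p + a\<close> up to \<open>T\<close>, by a constant
  times \<open>x / ln x\<close> times the probability of \<open>S\<close> in a model where the primes divide independently.
  An upper bound suffices because only an exceptional set has to be shown to be small, so neither
  the prime number theorem nor the distribution of primes in progressions is needed.
  In the model, the upper half of the law of the iterated logarithm follows from the maximal
  inequality for the exponential supermartingale on geometric blocks in \<open>ln (ln t)\<close>, and the lower
  half from independence of the blocks and exponential tilting. Primes between \<open>T\<close> and \<open>x\<close> are so few
  on average that they are negligible against \<open>sqrt (ln (ln x))\<close>.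
\<close>

section \<open>Mertens' theorem\<close>

text \<open>The size of \<open>T\<close> balances two demands. The sieve reaches only sets of primes
  whose product is at most \<open>sqrt x\<close>; with the chosen exponent this allows about a
  quarter of \<open>(ln (ln x))\<^sup>2\<close> primes, far more than the typical
  \<open>ln (ln x)\<close>. On the other hand \<open>ln (ln T)\<close> falls short of
  \<open>ln (ln x)\<close> by only \<open>2 * ln (ln (ln x))\<close>, so every \<open>t\<close>
  beyond \<open>T\<close> can be compared with \<open>T\<close> itself. The hypothesis that
  \<open>\<xi> x\<close> is at most \<open>ln x\<close> keeps \<open>ln (ln (\<xi> x))\<close> below
  \<open>ln (ln (ln x))\<close>, so at least half of the geometric blocks up to \<open>T\<close> lie
  beyond \<open>\<xi> x\<close>. Below \<open>T\<close> the sieve has dimension 2, since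
  \<open>q\<close> may divide neither \<open>p\<close> nor the cofactor of \<open>p + a\<close>;
  above \<open>T\<close> it has dimension 1. This yields the factor
  \<open>1 / (ln x * ln T)\<close>. Summing the local factors over all \<open>S\<close> gives at
  most a constant times \<open>ln T\<close>, so that only a constant is lost against the
  model.\<close>

abbreviation primes_upto :: "real \<Rightarrow> nat set" where
  "primes_upto t \<equiv> {p. prime p \<and> real p \<le> t}"

lemma finite_primes_upto [simp]: "finite (primes_upto t)"
proof (rule finite_subset)
  show "primes_upto t \<subseteq> {..nat \<lfloor>t\<rfloor>}"
    by (auto simp: le_nat_floor)
qed auto

lemma prod_primes_dvd:
  assumes "finite A" "\<And>p. p \<in> A \<Longrightarrow> prime p" "\<And>p. p \<in> A \<Longrightarrow> p dvd n"
  shows "\<Prod>A dvd (n::nat)"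
  using assms
proof (induction A rule: finite_induct)
  case (insert p A)
  have "coprime p (\<Prod>A)"
    using insert by (intro prod_coprime_right) (metis insert_iff primes_coprime)
  then show ?case using insert by (simp add: divides_mult)
qed auto

section \<open>Chebyshev's upper bound for the product of primes\<close>

lemma binomial_odd_le: "(2 * m + 1) choose m \<le> 4 ^ m"
proof -
  have "2 * ((2 * m + 1) choose m) = ((2*m+1) choose m) + ((2*m+1) choose (m+1))"
    using binomial_symmetric[of m "2*m+1"] by simp
  also have "\<dots> = (\<Sum>k\<in>{m,m+1}. (2*m+1) choose k)" by simp
  also have "\<dots> \<le> (\<Sum>k\<le>2*m+1. (2*m+1) choose k)"
    by (intro sum_mono2) auto
  also have "\<dots> = 2 ^ (2*m+1)" by (rule choose_row_sum)
  finally show ?thesis by (simp add: power_mult)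
qed

text \<open>Erdos's induction. For odd \<open>n = 2 * m + 1\<close> every prime in
  \<open>(m + 1, n]\<close> divides \<open>n choose m\<close>, because it divides
  \<open>fact n\<close> but neither \<open>fact m\<close> nor \<open>fact (n - m)\<close>; the
  primes up to \<open>m + 1\<close> are left to the induction hypothesis. An even
  \<open>n > 2\<close> contributes no prime.\<close>

lemma prod_primes_le: "\<Prod>{p. prime p \<and> p \<le> n} \<le> (4::nat) ^ n"
proof (induction n rule: less_induct)
  case (less n)
  have "n \<le> 1 \<or> n = 2 \<or> n > 2 \<and> even n \<or> n > 2 \<and> odd n" by presburger
  then consider "n \<le> 1" | "n = 2" | "n > 2" "even n" | "n > 2" "odd n" by blast
  then show ?case
  proof cases
    case 1
    then have "{p::nat. prime p \<and> p \<le> n} = {}" by (auto dest: prime_ge_2_nat)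
    then show ?thesis by (simp only: prod.empty) simp
  next
    case 2
    then have "{p::nat. prime p \<and> p \<le> n} = {2}" by (auto dest: prime_ge_2_nat)
    then show ?thesis using 2 by (simp only: prod.insert_if) simp
  next
    case 3
    have "{p::nat. prime p \<and> p \<le> n} = {p. prime p \<and> p \<le> n - 1}"
      using 3 by (auto simp: le_less dest: primes_dvd_imp_eq prime_odd_nat)
    then have "\<Prod>{p. prime p \<and> p \<le> n} \<le> (4::nat) ^ (n - 1)"
      using less.IH[of "n - 1"] 3 by simp
    also have "\<dots> \<le> 4 ^ n" by (intro power_increasing) auto
    finally show ?thesis .
  next
    case 4
    from \<open>odd n\<close> obtain m where "n = 2 * m + 1" by (rule oddE)
    with \<open>n > 2\<close> have 4: "n = 2 * m + 1" "m \<ge> 1" by auto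
    let ?A = "{p::nat. prime p \<and> p \<le> m + 1}" and ?B = "{p. prime p \<and> m + 1 < p \<and> p \<le> n}"
    have "{p::nat. prime p \<and> p \<le> n} = ?A \<union> ?B" using 4 by auto
    moreover have "\<Prod>(?A \<union> ?B) = \<Prod>?A * \<Prod>?B"
      by (intro prod.union_disjoint) auto
    moreover have "\<Prod>?A \<le> 4 ^ (m + 1)" using less.IH[of "m + 1"] 4 by simp
    moreover have "\<Prod>?B \<le> 4 ^ m"
    proof -
      have "\<Prod>?B dvd (n choose m)"
      proof (rule prod_primes_dvd)
        fix p assume p: "p \<in> ?B"
        then have "p dvd fact n" by (auto simp: prime_dvd_fact_iff)
        also have "fact n = fact m * fact (n - m) * (n choose m)"
          using binomial_fact_lemma[of m n] 4 by simp
        finally show "p dvd (n choose m)"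
          using p 4 by (auto simp: prime_dvd_mult_iff prime_dvd_fact_iff simp del: fact_Suc)
      qed auto
      then have "\<Prod>?B \<le> (n choose m)" using 4 by (intro dvd_imp_le) auto
      also have "\<dots> \<le> 4 ^ m" using binomial_odd_le 4 by simp
      finally show ?thesis .
    qed
    ultimately have "\<Prod>{p. prime p \<and> p \<le> n} \<le> (4::nat) ^ (m+1) * 4 ^ m"
      by (simp add: mult_mono del: power_Suc)
    also have "\<dots> = 4 ^ n" using 4 by (simp add: mult_2 power_add)
    finally show ?thesis .
  qed
qed

lemma theta_le: "(\<Sum>p | prime p \<and> p \<le> n. ln (real p)) \<le> real n * ln 4"
proof -
  have le: "real (\<Prod>{p. prime p \<and> p \<le> n}) \<le> real (4 ^ n)"
    using prod_primes_le by (simp only: of_nat_le_iff)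
  have "(\<Sum>p | prime p \<and> p \<le> n. ln (real p)) = ln (real (\<Prod>{p. prime p \<and> p \<le> n}))"
    unfolding of_nat_prod by (subst ln_prod) (auto simp: prime_gt_0_nat)
  also have "\<dots> \<le> ln (real (4 ^ n))"
    using le by (subst ln_le_cancel_iff) (auto simp: prime_gt_0_nat simp del: of_nat_power intro!: prod_pos)
  also have "\<dots> = real n * ln 4" by (simp add: ln_realpow)
  finally show ?thesis .
qed

section \<open>Legendre's formula for the factorial\<close>

lemma card_multiples: 
  assumes "d > 0"
  shows "card {k\<in>{1..n}. d dvd k} = n div (d::nat)"
proof -
  have "{k\<in>{1..n}. d dvd k} = (\<lambda>i. d * i) ` {1..n div d}"
    using assms by (auto simp: dvd_def less_eq_div_iff_mult_less_eq mult.commute image_iff)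
  moreover have "inj_on (\<lambda>i. d * i) {1..n div d}" using assms by (auto simp: inj_on_def)
  ultimately show ?thesis by (simp add: card_image)
qed

text \<open>A multiplicity as a count of exponents, so that summing over \<open>k\<close> and
  swapping the sums gives Legendre's formula. The range \<open>{1..n}\<close> loses no exponent
  because \<open>multiplicity p k < p ^ multiplicity p k \<le> k \<le> n\<close>.\<close>

lemma multiplicity_eq_card:
  assumes "prime (p::nat)" "k \<in> {1..n}"
  shows "multiplicity p k = card {j\<in>{1..n}. p ^ j dvd k}"
proof -
  have "multiplicity p k \<le> n"
  proof -
    have "p ^ multiplicity p k \<le> k" using assms by (intro dvd_imp_le multiplicity_dvd) auto
    moreover have "multiplicity p k < p ^ multiplicity p k"
      using prime_gt_1_nat[OF assms(1)] by (intro power_gt_expt) simp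
    ultimately show ?thesis using assms by auto
  qed
  have "p ^ j dvd k \<longleftrightarrow> j \<le> multiplicity p k" for j
    using assms by (intro power_dvd_iff_le_multiplicity) (auto simp: not_prime_unit)
  then have "{j\<in>{1..n}. p ^ j dvd k} = {j\<in>{1..n}. j \<le> multiplicity p k}" by (simp only:)
  moreover have "\<dots> = {1..multiplicity p k}" using \<open>multiplicity p k \<le> n\<close> by auto
  ultimately have "{j\<in>{1..n}. p ^ j dvd k} = {1..multiplicity p k}" by (simp only:)
  then show ?thesis by simp
qed

text \<open>Only the exponent 1 is kept. The loss of 1 per prime is harmless, since weighted by
  \<open>ln p\<close> it adds up to the sum bounded in \<open>theta_le\<close>.\<close>

lemma sum_multiplicity_ge:
  assumes "prime (p::nat)"
  shows "real n / real p - 1 \<le> real (\<Sum>k=1..n. multiplicity p k)"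
proof -
  have "real n / real p - 1 \<le> real (n div p)"
  proof -
    have "n \<le> p * (n div p) + p"
      using mult_div_mod_eq[of p n] mod_less_divisor[OF prime_gt_0_nat[OF assms], of n] by linarith
    then have "real n \<le> real p * real (n div p) + real p" by (metis of_nat_add of_nat_le_iff of_nat_mult)
    then show ?thesis using prime_gt_0_nat[OF assms] by (simp add: field_simps)
  qed
  also have "n div p = (\<Sum>k\<in>{1..n}. if p dvd k then 1 else 0)"
    using card_multiples[of p n] assms by (simp add: prime_gt_0_nat sum.If_cases Int_def conj_commute)
  also have "\<dots> \<le> (\<Sum>k=1..n. multiplicity p k)"
    using assms by (intro sum_mono) (auto simp: Suc_le_eq prime_multiplicity_gt_zero_iff)
  finally show ?thesis by simp
qed

lemma sum_inverse_powers_le: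
  fixes q :: real
  assumes "q \<ge> 2"
  shows "(\<Sum>j=1..n. (1 / q) ^ j) \<le> 1 / (q - 1)"
proof -
  have "(\<Sum>j=1..n. (1 / q) ^ j) = (\<Sum>j<n. (1/q) * (1 / q) ^ j)"
    by (rule sum.reindex_bij_witness[of _ Suc "\<lambda>j. j - 1"]) (auto simp flip: power_Suc)
  also have "\<dots> = (1/q) * ((1 - (1 / q) ^ n) / (1 - 1/q))"
    using assms by (subst sum_distrib_left[symmetric]) (simp add: sum_gp_strict)
  also have "\<dots> \<le> (1/q) * (1 / (1 - 1/q))"
    using assms by (intro mult_left_mono divide_right_mono) auto
  also have "\<dots> = 1 / (q - 1)" using assms by (simp add: field_simps)
  finally show ?thesis .
qed

lemma sum_multiplicity_le:
  assumes "prime (p::nat)"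
  shows "real (\<Sum>k=1..n. multiplicity p k) \<le> real n / (real p - 1)"
proof -
  have p: "real p \<ge> 2" using prime_ge_2_nat[OF assms] by simp
  have "(\<Sum>k=1..n. multiplicity p k) = (\<Sum>k=1..n. \<Sum>j=1..n. if p ^ j dvd k then 1 else 0)"
    using multiplicity_eq_card[OF assms] 
    by (intro sum.cong) (auto simp: sum.If_cases Int_def conj_commute)
  also have "\<dots> = (\<Sum>j=1..n. \<Sum>k=1..n. if p ^ j dvd k then 1 else 0)" by (rule sum.swap)
  also have "\<dots> = (\<Sum>j=1..n. n div p ^ j)"
    using card_multiples[of _ n] assms
    by (intro sum.cong) (auto simp: prime_gt_0_nat sum.If_cases Int_def conj_commute)
  finally have "real (\<Sum>k=1..n. multiplicity p k) = (\<Sum>j=1..n. real (n div p ^ j))" by simp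
  also have "\<dots> \<le> (\<Sum>j=1..n. real n * (1 / real p) ^ j)"
  proof (intro sum_mono)
    fix j
    have "real (n div p ^ j) \<le> real n / real (p ^ j)" by (rule of_nat_div_le_of_nat)
    then show "real (n div p ^ j) \<le> real n * (1 / real p) ^ j" by (simp add: power_one_over)
  qed
  also have "\<dots> = real n * (\<Sum>j=1..n. (1 / real p) ^ j)" by (simp add: sum_distrib_left)
  also have "\<dots> \<le> real n * (1 / (real p - 1))"
    using p by (intro mult_left_mono sum_inverse_powers_le) auto
  finally show ?thesis by simp
qed

lemma ln_eq_sum_multiplicity:
  assumes "k \<in> {1..n}"
  shows "ln (real k) = (\<Sum>p | prime p \<and> p \<le> n. real (multiplicity p k) * ln (real p))"
proof -
  have "real k = real (\<Prod>p\<in>prime_factors k. p ^ multiplicity p k)"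
    using prime_factorization_nat[of k] assms by simp
  then have "ln (real k) = (\<Sum>p\<in>prime_factors k. real (multiplicity p k) * ln (real p))"
    unfolding of_nat_prod
    by (simp only:, subst ln_prod) (auto simp: prime_gt_0_nat in_prime_factors_iff ln_realpow)
  also have "\<dots> = (\<Sum>p | prime p \<and> p \<le> n. real (multiplicity p k) * ln (real p))"
    using assms by (intro sum.mono_neutral_left)
      (auto simp: in_prime_factors_iff not_dvd_imp_multiplicity_0 intro: order_trans[OF dvd_imp_le])
  finally show ?thesis .
qed

lemma ln_fact_eq_sum:
  "ln (fact n) = (\<Sum>p | prime p \<and> p \<le> n. ln (real p) * real (\<Sum>k=1..n. multiplicity p k))"
proof -
  have "ln (fact n) = (\<Sum>k=1..n. ln (real k))"
    unfolding fact_prod of_nat_prod by (subst ln_prod) auto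
  also have "\<dots> = (\<Sum>k=1..n. \<Sum>p | prime p \<and> p \<le> n. real (multiplicity p k) * ln (real p))"
    by (intro sum.cong ln_eq_sum_multiplicity) auto
  also have "\<dots> = (\<Sum>p | prime p \<and> p \<le> n. \<Sum>k=1..n. real (multiplicity p k) * ln (real p))"
    by (rule sum.swap)
  finally show ?thesis by (simp add: sum_distrib_left mult.commute)
qed

section \<open>Mertens' first theorem\<close>

lemma ln_fact_le: "ln (fact n) \<le> real n * ln (real n)"
proof (cases "n = 0")
  case False
  have "(fact n :: real) \<le> real n ^ n" by (metis fact_le_power of_nat_fact of_nat_le_iff of_nat_power order_refl of_nat_id)
  then have "ln (fact n) \<le> ln (real n ^ n)" using False by (subst ln_le_cancel_iff) auto
  then show ?thesis using False by (simp add: ln_realpow)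
qed auto

text \<open>A single term \<open>n ^ n / fact n\<close> of the exponential series is at most
  \<open>exp n\<close>. This crude form of Stirling's formula is enough, because an error of order
  \<open>n\<close> becomes bounded after division by \<open>n\<close>.\<close>

lemma ln_fact_ge: "real n * ln (real n) - real n \<le> ln (fact n)"
proof (cases "n = 0")
  case False
  have "real n ^ n / fact n \<le> exp (real n)"
    using sum_le_suminf[OF summable_exp_generic[of "real n"], of "{n}"]
    by (simp add: exp_def scaleR_conv_of_real field_simps)
  then have "ln (real n ^ n / fact n) \<le> real n"
    using False by (metis ln_exp ln_le_cancel_iff exp_gt_zero divide_pos_pos fact_gt_zero of_nat_0_less_iff zero_less_power not_gr_zero)
  then show ?thesis using False by (simp add: ln_div ln_realpow)
qed auto

text \<open>Legendre's formula compares \<open>n\<close> times the sum with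
  \<open>ln (fact n)\<close>; the rounding error is at most the sum in \<open>theta_le\<close>,
  hence of order \<open>n\<close>.\<close>

lemma sum_ln_primes_le:
  assumes "n \<ge> 1"
  shows "(\<Sum>p | prime p \<and> p \<le> n. ln (real p) / real p) \<le> ln (real n) + 4"
proof -
  let ?A = "\<Sum>p | prime p \<and> p \<le> n. ln (real p) / real p"
  have "real n * ?A - (\<Sum>p | prime p \<and> p \<le> n. ln (real p)) = (\<Sum>p | prime p \<and> p \<le> n. ln (real p) * (real n / real p - 1))"
    by (simp add: sum_distrib_left sum_subtractf algebra_simps)
  also have "\<dots> \<le> ln (fact n)"
    unfolding ln_fact_eq_sum
    by (intro sum_mono mult_left_mono sum_multiplicity_ge) (auto simp: Suc_leI prime_gt_0_nat)
  also have "\<dots> \<le> real n * ln (real n)" by (rule ln_fact_le)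
  finally have "real n * ?A \<le> real n * (ln (real n) + ln 4)"
    using theta_le[of n] by (simp add: algebra_simps)
  then have "?A \<le> ln (real n) + ln 4" using assms by simp
  also have "ln 4 \<le> (4::real)" using ln_le_minus_one[of 4] by simp
  finally show ?thesis by simp
qed

text \<open>The integral of \<open>ln t / t\<^sup>2\<close> from \<open>n\<close> to infinity is
  \<open>(1 + ln n) / n\<close>. Subtracting this tail, with a slack of \<open>1 / n\<close>, makes
  the bound strong enough for induction.\<close>

lemma sum_ln_over_square_le:
  assumes "n \<ge> 1"
  shows "(\<Sum>k=2..n. ln (real k) / (real k * (real k - 1))) \<le> 3 - (2 + ln (real n)) / real n"
  using assms
proof (induction n rule: nat_induct_at_least)
  case (Suc n)
  have n: "real n \<ge> 1" using Suc by simp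
  have "ln (1 + 1 / real n) \<le> 1 / real n" using n by (intro ln_add_one_self_le_self) auto
  also have "1 / real n \<le> 2 / (real n + 1)" using n by (simp add: field_simps)
  finally have *: "ln (real n + 1) - ln (real n) \<le> 2 / (real n + 1)"
    using n ln_div[of "real n + 1" "real n"] by (simp add: add_divide_distrib)
  have "ln (real n + 1) / ((real n + 1) * real n) - 2 / real n - ln (real n) / real n
        + (2 + ln (real n + 1)) / (real n + 1)
      = (ln (real n + 1) - ln (real n) - 2 / (real n + 1)) / real n"
    using n by (simp add: divide_simps) (simp add: algebra_simps)
  also have "\<dots> \<le> 0" using * n by (simp add: divide_nonpos_pos)
  finally show ?case using Suc n by (simp add: add_divide_distrib add.commute)
qed auto

text \<open>The geometric series in \<open>sum_multiplicity_le\<close> gives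
  \<open>1 / (p - 1)\<close> in place of \<open>1 / p\<close>; the difference
  \<open>1 / (p * (p - 1))\<close> is summed over all integers and contributes 3, Stirling's error
  contributes 1.\<close>

lemma sum_ln_primes_ge:
  assumes "n \<ge> 1"
  shows "(\<Sum>p | prime p \<and> p \<le> n. ln (real p) / real p) \<ge> ln (real n) - 4"
proof -
  let ?A = "\<Sum>p | prime p \<and> p \<le> n. ln (real p) / real p"
  have "real n * ln (real n) - real n \<le> ln (fact n)" by (rule ln_fact_ge)
  also have "\<dots> \<le> (\<Sum>p | prime p \<and> p \<le> n. ln (real p) * (real n / (real p - 1)))"
    unfolding ln_fact_eq_sum
    by (intro sum_mono mult_left_mono sum_multiplicity_le) (auto simp: Suc_leI prime_gt_0_nat)
  also have "\<dots> = (\<Sum>p | prime p \<and> p \<le> n. real n * (ln (real p) / real p + ln (real p) / (real p * (real p - 1))))"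
  proof (intro sum.cong refl)
    fix p assume "p \<in> {p. prime p \<and> p \<le> n}"
    then have "real p \<ge> 2" using prime_ge_2_nat by force
    then show "ln (real p) * (real n / (real p - 1)) = real n * (ln (real p) / real p + ln (real p) / (real p * (real p - 1)))"
      by (simp add: divide_simps) (simp add: algebra_simps)
  qed
  also have "\<dots> = real n * (?A + (\<Sum>p | prime p \<and> p \<le> n. ln (real p) / (real p * (real p - 1))))"
    by (simp add: sum_distrib_left sum.distrib algebra_simps)
  also have "(\<Sum>p | prime p \<and> p \<le> n. ln (real p) / (real p * (real p - 1))) \<le> (\<Sum>k=2..n. ln (real k) / (real k * (real k - 1)))"
    by (intro sum_mono2) (auto simp: prime_ge_2_nat)
  also have "\<dots> \<le> 3 - (2 + ln (real n)) / real n" by (rule sum_ln_over_square_le[OF assms])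
  also have "\<dots> \<le> 3" using assms by simp
  finally have "real n * (ln (real n) - 1) \<le> real n * (?A + 3)"
    by (simp add: right_diff_distrib mult_left_mono)
  then show ?thesis using assms by simp
qed

section \<open>Mertens' second theorem by partial summation\<close>

lemma primes_Suc_le: 
  "{p::nat. prime p \<and> p \<le> Suc n} = (if prime (Suc n) then insert (Suc n) {p. prime p \<and> p \<le> n} else {p. prime p \<and> p \<le> n})"
  by (auto simp: le_Suc_eq)

lemma primes_le_2: "{p::nat. prime p \<and> p \<le> 2} = {2}"
  by (auto dest: prime_ge_2_nat)

lemma ln2_ge_half: "ln (2::real) \<ge> 1 / 2"
proof -
  have "exp (1/2::real) ^ 2 \<le> 2 ^ 2" using exp_le exp_double[of "1/2::real"] by simp
  then have "exp (1/2::real) \<le> 2" by (rule power2_le_imp_le) simp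
  then show ?thesis by (subst ln_ge_iff) auto
qed

text \<open>Abel summation written as an induction, without integrals. With
  \<open>A n = ln n + O(1)\<close> the increment of \<open>P n - A n / ln n\<close> is mainly
  \<open>1 - ln n / ln (n + 1)\<close>, which is compared with the increment of
  \<open>ln (ln n)\<close>; every error term telescopes.\<close>

lemma mertens_nat_aux:
  fixes n :: nat
  defines "P \<equiv> \<lambda>n::nat. (\<Sum>p | prime p \<and> p \<le> n. 1 / real p)"
    and "A \<equiv> \<lambda>n::nat. (\<Sum>p | prime p \<and> p \<le> n. ln (real p) / real p)"
  assumes "n \<ge> 2"
  shows "P n - A n / ln n \<le> ln (ln n) - ln (ln 2) + 4 * (1 / ln 2 - 1 / ln n)"
    and "P n - A n / ln n \<ge> ln (ln n) - ln (ln 2) - 4 * (1 / ln 2 - 1 / ln n) - 2 * (1 - 1 / (real n - 1))"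
proof -
  \<comment> \<open>If \<open>Suc n\<close> is prime, its term cancels between \<open>P\<close> and
    \<open>A / ln\<close>; only the change of the weight \<open>1 / ln\<close> remains.\<close>
  have step: "P (Suc n) - A (Suc n) / ln (real (Suc n)) = P n - A n / ln (real n) + A n * (1 / ln (real n) - 1 / ln (real (Suc n)))"
    if "n \<ge> 2" for n
  proof -
    have "ln (real (Suc n)) > 0" using that by simp
    then show ?thesis
      unfolding P_def A_def primes_Suc_le
      by (cases "prime (Suc n)") (simp_all add: add_divide_distrib right_diff_distrib del: of_nat_Suc)
  qed
  have base: "P 2 - A 2 / ln 2 = 0" by (simp add: P_def A_def primes_le_2)
  have u: "0 < ln (real n)" "ln (real n) < ln (real (Suc n))" "1 / ln (real n) - 1 / ln (real (Suc n)) \<ge> 0" if "n \<ge> 2" for n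
    using that by (auto simp: field_simps)
  show "P n - A n / ln n \<le> ln (ln n) - ln (ln 2) + 4 * (1 / ln 2 - 1 / ln n)"
    using \<open>n \<ge> 2\<close>
  proof (induction n rule: nat_induct_at_least)
    case (Suc n)
    let ?u = "ln (real n)" and ?v = "ln (real (Suc n))"
    note u = u[OF Suc.hyps]
    have "A n * (1 / ?u - 1 / ?v) \<le> (?u + 4) * (1 / ?u - 1 / ?v)"
      using u sum_ln_primes_le[of n] Suc.hyps unfolding A_def by (intro mult_right_mono) auto
    also have "\<dots> = (1 - ?u / ?v) + 4 * (1 / ?u - 1 / ?v)"
      using u(1) by (simp add: add_divide_distrib right_diff_distrib)
    also have "1 - ?u / ?v \<le> ln ?v - ln ?u"
      using ln_le_minus_one[of "?u / ?v"] ln_divide_pos[of ?u ?v] u divide_pos_pos[of ?u ?v] by linarith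
    finally show ?case using Suc.IH step[OF Suc.hyps] by (simp add: algebra_simps)
  qed (simp add: base)
  show "P n - A n / ln n \<ge> ln (ln n) - ln (ln 2) - 4 * (1 / ln 2 - 1 / ln n) - 2 * (1 - 1 / (real n - 1))"
    using \<open>n \<ge> 2\<close>
  proof (induction n rule: nat_induct_at_least)
    case (Suc n)
    let ?u = "ln (real n)" and ?v = "ln (real (Suc n))"
    note u = u[OF Suc.hyps]
    have n: "real n \<ge> 2" using Suc.hyps by simp
    have "ln (real 2) \<le> ?u" using n by (subst ln_le_cancel_iff) auto
    then have "?u \<ge> 1 / 2" using ln2_ge_half by simp
    moreover have "?v \<ge> 1"
    proof -
      have "exp 1 \<le> real (Suc n)" using n exp_le by simp
      then show ?thesis by (simp add: ln_ge_iff)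
    qed
    ultimately have uv: "?u * ?v \<ge> 1 / 2" using mult_mono[of "1/2" ?u 1 ?v] by simp
    have diff: "?v - ?u \<le> 1 / real n"
      using n ln_add_one_self_le_self[of "1 / real n"] ln_divide_pos[of "real n + 1" "real n"]
      by (simp add: add_divide_distrib add.commute)
    have "ln ?v - ln ?u \<le> ?v / ?u - 1"
      using ln_le_minus_one[of "?v / ?u"] ln_divide_pos[of ?v ?u] u divide_pos_pos[of ?v ?u] by linarith
    \<comment> \<open>The two first-order expressions differ by a square, which is at most
      \<open>2 / (n * (n - 1))\<close> and therefore telescopes.\<close>
    also have "\<dots> = (1 - ?u / ?v) + (?v - ?u)\<^sup>2 / (?u * ?v)"
    proof -
      have "v / u - 1 = (1 - u / v) + (v - u)\<^sup>2 / (u * v)" if "u > 0" "v > 0" for u v :: real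
        using that by (simp add: divide_simps power2_eq_square) (simp add: algebra_simps)
      from this[of ?u ?v] show ?thesis using u(1,2) by linarith
    qed
    also have "(?v - ?u)\<^sup>2 / (?u * ?v) \<le> (1 / real n)\<^sup>2 / (1/2)"
      using u diff uv by (intro frac_le power_mono) auto
    also have "\<dots> = 2 / (real n * real n)" by (simp add: power2_eq_square)
    also have "\<dots> \<le> 2 / (real n * (real n - 1))" using n by (intro divide_left_mono) auto
    also have "\<dots> = 2 * (1 / (real n - 1) - 1 / real n)" using n by (simp add: field_simps)
    finally have *: "1 - ?u / ?v \<ge> ln ?v - ln ?u - 2 * (1 / (real n - 1) - 1 / real n)" by linarith
    have "(1 - ?u / ?v) - 4 * (1 / ?u - 1 / ?v) = (?u - 4) * (1 / ?u - 1 / ?v)"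
      using u(1) by (simp add: diff_divide_distrib right_diff_distrib)
    also have "\<dots> \<le> A n * (1 / ?u - 1 / ?v)"
      using u sum_ln_primes_ge[of n] Suc.hyps unfolding A_def by (intro mult_right_mono) auto
    finally show ?case using Suc.IH step[OF Suc.hyps] * by (simp add: algebra_simps)
  qed (simp add: base)
qed

lemma mertens_nat:
  assumes "n \<ge> 2"
  shows "\<bar>(\<Sum>p | prime p \<and> p \<le> n. 1 / real p) - ln (ln (real n))\<bar> \<le> 10"
proof -
  define A where "A = (\<Sum>p | prime p \<and> p \<le> n. ln (real p) / real p)"
  have n: "ln (real n) > 0" using assms by simp
  have A: "A / ln (real n) \<le> 1 + 4 / ln (real n)" "A / ln (real n) \<ge> 1 - 4 / ln (real n)"
    using divide_right_mono[OF sum_ln_primes_le[of n], of "ln n"]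
      divide_right_mono[OF sum_ln_primes_ge[of n], of "ln n"] assms n unfolding A_def[symmetric]
    by (auto simp: add_divide_distrib diff_divide_distrib)
  have l2: "4 / ln 2 \<le> (8::real)" using ln2_ge_half by (simp add: field_simps)
  have "ln (1/2) \<le> ln (ln (2::real))" using ln2_ge_half by (subst ln_le_cancel_iff) auto
  moreover have "ln (1/2::real) \<ge> - 1" using ln_le_minus_one[of "2::real"] by (simp add: ln_div)
  moreover have "ln (ln (2::real)) \<le> 0" using ln_le_minus_one[of "2::real"] by (subst ln_le_zero_iff) auto
  moreover have "1 / (real n - 1) \<ge> 0" using assms by simp
  ultimately show ?thesis
    using mertens_nat_aux[OF assms, folded A_def] A l2 unfolding abs_le_iff right_diff_distrib mult_1_right
    by (simp only: times_divide_eq_right mult_1_right) linarith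
qed

lemma mertens:
  assumes "t \<ge> 2"
  shows "\<bar>(\<Sum>p\<in>primes_upto t. 1 / real p) - ln (ln t)\<bar> \<le> 11"
proof -
  define n where "n = nat \<lfloor>t\<rfloor>"
  have n: "n \<ge> 2" "real n \<le> t" "t \<le> real n + 1"
    using assms unfolding n_def by (auto simp: le_nat_iff le_floor_iff)
  have eq: "primes_upto t = {p. prime p \<and> p \<le> n}"
    using assms by (auto simp: n_def le_nat_floor le_nat_iff le_floor_iff)
  have pos: "ln (real n) > 0" using n by simp
  have "ln (ln (real n)) \<le> ln (ln t)" using n pos assms by simp
  moreover have "ln (ln t) \<le> ln (ln (real n)) + 1"
  proof -
    \<comment> \<open>A crude comparison of \<open>t\<close> with its integer part: it costs only
      \<open>ln 2\<close> after two logarithms, hence 11 in place of 10.\<close>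
    have "t \<le> real n ^ 2"
      using n mult_mono[of 2 "real n" "real n" "real n"] unfolding power2_eq_square by linarith
    then have "ln t \<le> ln (real n ^ 2)" using n assms by (subst ln_le_cancel_iff) auto
    then have "ln t \<le> 2 * ln (real n)" using n by (simp add: ln_realpow)
    then have "ln (ln t) \<le> ln (2 * ln (real n))" using assms pos by (subst ln_le_cancel_iff) auto
    then show ?thesis using pos ln_le_minus_one[of "2::real"] by (simp add: ln_mult)
  qed
  ultimately show ?thesis using mertens_nat[OF n(1)] unfolding eq by linarith
qed

section \<open>Selberg's sieve\<close>

lemma sum_periodic_nat:
  fixes f :: "nat \<Rightarrow> real"
  assumes "\<And>r. f (r + L) = f r"
  shows "(\<Sum>r<k * L + s. f r) = real k * (\<Sum>r<L. f r) + (\<Sum>r<s. f r)"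
proof (induction k)
  case (Suc k)
  have *: "f (r + j * L) = f r" for r j
  proof (induction j)
    case (Suc j)
    have "f (r + Suc j * L) = f (r + j * L + L)" by (simp add: add_ac)
    then show ?case using assms Suc by simp
  qed auto
  have "(\<Sum>r<L + m. f r) = (\<Sum>r<L. f r) + (\<Sum>r<m. f r)" for m
  proof -
    have "(\<Sum>r<L + m. f r) = (\<Sum>r<L. f r) + (\<Sum>r\<in>{L..<L+m}. f r)"
      by (subst sum.union_disjoint[symmetric]) (auto intro!: sum.cong)
    also have "(\<Sum>r\<in>{L..<L+m}. f r) = (\<Sum>r<m. f r)"
      using assms sum.shift_bounds_nat_ivl[of f 0 L m] by (simp add: add.commute atLeast0LessThan)
    finally show ?thesis .
  qed
  from this[of "k * L + s"] Suc show ?case by (simp add: algebra_simps)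
qed auto

text \<open>Complete periods match the mean exactly. What remains is the incomplete last period and
  its share of the mean, each at most \<open>L * B\<close>.\<close>

lemma sum_periodic_approx:
  fixes f :: "nat \<Rightarrow> real"
  assumes per: "\<And>r. f (r + L) = f r" and L: "L > 0" and B: "\<And>r. \<bar>f r\<bar> \<le> B"
  shows "\<bar>(\<Sum>r<N. f r) - real N / real L * (\<Sum>r<L. f r)\<bar> \<le> 2 * real L * B"
proof -
  define k s where "k = N div L" and "s = N mod L"
  have N: "N = k * L + s" and s: "s < L" using L by (auto simp: k_def s_def)
  have bd: "\<bar>\<Sum>r<m. f r\<bar> \<le> real m * B" for m
    using sum_bounded_above[of "{..<m}" "\<lambda>r. \<bar>f r\<bar>" B] B order_trans[OF sum_abs[of f "{..<m}"]] by simp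
  have B0: "B \<ge> 0" using B[of 0] by linarith
  have "(\<Sum>r<N. f r) - real N / real L * (\<Sum>r<L. f r) = (\<Sum>r<s. f r) - real s / real L * (\<Sum>r<L. f r)"
    unfolding N using sum_periodic_nat[of f L k s, OF per] L by (simp add: field_simps)
  also have "\<bar>\<dots>\<bar> \<le> \<bar>\<Sum>r<s. f r\<bar> + real s / real L * \<bar>\<Sum>r<L. f r\<bar>"
    by (rule order_trans[OF abs_triangle_ineq4]) (simp add: abs_mult)
  also have "\<dots> \<le> real s * B + real s / real L * (real L * B)"
    by (intro add_mono mult_left_mono bd) auto
  also have "\<dots> = 2 * real s * B" using L by simp
  also have "\<dots> \<le> 2 * real L * B" using s B0 by (intro mult_right_mono) auto
  finally show ?thesis .
qed

lemma sum_chinese_remainder: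
  fixes f g :: "nat \<Rightarrow> real"
  assumes "coprime M N" "M > 0" "N > 0"
  shows "(\<Sum>r<M * N. f (r mod M) * g (r mod N)) = (\<Sum>a<M. f a) * (\<Sum>b<N. g b)"
proof -
  let ?\<phi> = "\<lambda>r. (r mod M, r mod N)"
  have inj: "inj_on ?\<phi> {..<M * N}"
  proof (rule inj_onI)
    fix x y assume xy: "x \<in> {..<M * N}" "y \<in> {..<M * N}" "?\<phi> x = ?\<phi> y"
    then have "[x = y] (mod M)" "[x = y] (mod N)" by (auto simp: unique_euclidean_semiring_class.cong_def)
    then have "[x = y] (mod M * N)" using assms(1) by (rule coprime_cong_mult_nat)
    then show "x = y" using xy by (simp add: unique_euclidean_semiring_class.cong_def)
  qed
  have sub: "?\<phi> ` {..<M * N} \<subseteq> {..<M} \<times> {..<N}" using assms by auto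
  have "card (?\<phi> ` {..<M * N}) = card ({..<M} \<times> {..<N})"
    using card_image[OF inj] by (simp add: card_cartesian_product)
  then have "?\<phi> ` {..<M * N} = {..<M} \<times> {..<N}" using sub by (intro card_subset_eq) auto
  then have "bij_betw ?\<phi> {..<M * N} ({..<M} \<times> {..<N})" using inj by (auto simp: bij_betw_def)
  from sum.reindex_bij_betw[OF this, of "\<lambda>(a, b). f a * g b"]
  have "(\<Sum>r<M * N. f (r mod M) * g (r mod N)) = (\<Sum>(a, b)\<in>{..<M} \<times> {..<N}. f a * g b)" by simp
  also have "\<dots> = (\<Sum>a<M. f a) * (\<Sum>b<N. g b)"
    by (simp add: sum_product sum.cartesian_product)
  finally show ?thesis .
qed

text \<open>By the Chinese remainder theorem, residues modulo distinct primes are independent over a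
  full period. This is the source of orthogonality in the sieve.\<close>

lemma sum_prod_residues:
  fixes F :: "nat \<Rightarrow> nat \<Rightarrow> real"
  assumes "finite Q" "\<And>q. q \<in> Q \<Longrightarrow> prime q"
  shows "(\<Sum>r<\<Prod>Q. \<Prod>q\<in>Q. F q (r mod q)) = (\<Prod>q\<in>Q. \<Sum>a<q. F q a)"
  using assms
proof (induction Q rule: finite_induct)
  case (insert p Q)
  have cop: "coprime p (\<Prod>Q)"
    using insert by (intro prod_coprime_right) (metis insert_iff primes_coprime)
  have pos: "p > 0" "\<Prod>Q > 0" using insert.prems by (auto simp: prime_gt_0_nat intro!: prod_pos)
  have "(\<Prod>q\<in>insert p Q. F q (r mod q)) = F p (r mod p) * (\<Prod>q\<in>Q. F q ((r mod \<Prod>Q) mod q))" for r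
  proof -
    have "(r mod \<Prod>Q) mod q = r mod q" if "q \<in> Q" for q
      using that insert.hyps by (intro mod_mod_cancel dvd_prodI)
    then show ?thesis using insert.hyps by (simp cong: prod.cong)
  qed
  moreover have "\<Prod>(insert p Q) = p * \<Prod>Q" using insert.hyps by simp
  ultimately have "(\<Sum>r<\<Prod>(insert p Q). \<Prod>q\<in>insert p Q. F q (r mod q))
      = (\<Sum>r<p * \<Prod>Q. F p (r mod p) * (\<Prod>q\<in>Q. F q ((r mod \<Prod>Q) mod q)))"
    by (simp only:)
  also have "\<dots> = (\<Sum>a<p. F p a) * (\<Sum>r<\<Prod>Q. \<Prod>q\<in>Q. F q (r mod q))"
    using sum_chinese_remainder[OF cop pos, of "F p" "\<lambda>b. \<Prod>q\<in>Q. F q (b mod q)"] by simp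
  finally show ?case using insert by simp
qed auto

lemma inj_on_prod_primes: "inj_on \<Prod> {Q. finite Q \<and> (\<forall>q\<in>Q. prime (q::nat))}"
proof (rule inj_on_inverseI)
  fix Q :: "nat set" assume Q: "Q \<in> {Q. finite Q \<and> (\<forall>q\<in>Q. prime q)}"
  then have "\<Prod>Q \<noteq> 0" by (auto dest: prime_gt_0_nat)
  have "p \<in> Q" if "prime p" "p dvd \<Prod>Q" for p
    using that Q prime_dvd_prod_iff[of Q p "\<lambda>x. x"] primes_dvd_imp_eq by blast
  moreover have "p dvd \<Prod>Q" if "p \<in> Q" for p using that Q by (auto intro: dvd_prodI)
  ultimately show "prime_factors (\<Prod>Q) = Q"
    using Q \<open>\<Prod>Q \<noteq> 0\<close> by (auto simp: in_prime_factors_iff)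
qed

text \<open>Finite sets of primes encode square-free numbers, and the product map is injective on
  them by unique factorization, so these sets are no more numerous than the positive integers up to
  \<open>D\<close>.\<close>

lemma card_prod_primes_le:
  fixes P :: "nat set" and D :: real
  assumes "finite P" "\<And>q. q \<in> P \<Longrightarrow> prime q" "D \<ge> 0"
  shows "real (card {Q. Q \<subseteq> P \<and> real (\<Prod>Q) \<le> D}) \<le> D"
proof -
  let ?S = "{Q. Q \<subseteq> P \<and> real (\<Prod>Q) \<le> D}"
  have fin: "finite Q" if "Q \<subseteq> P" for Q using that assms(1) by (rule finite_subset)
  have "inj_on \<Prod> ?S"
    by (rule inj_on_subset[OF inj_on_prod_primes]) (use assms fin in auto)
  then have "card ?S = card (\<Prod> ` ?S)" by (simp add: card_image)
  also have "\<dots> \<le> card {1..nat \<lfloor>D\<rfloor>}"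
  proof (intro card_mono subsetI)
    fix n assume "n \<in> \<Prod> ` ?S"
    then obtain Q where Q: "Q \<subseteq> P" "real (\<Prod>Q) \<le> D" "n = \<Prod>Q" by auto
    then have "\<Prod>Q > 0" using assms(2) by (intro prod_pos prime_gt_0_nat) blast
    then show "n \<in> {1..nat \<lfloor>D\<rfloor>}" using Q by (auto simp: le_nat_floor)
  qed auto
  finally have "real (card ?S) \<le> real (nat \<lfloor>D\<rfloor>)" by simp
  also have "\<dots> \<le> D" using assms(3) by (rule of_nat_floor)
  finally show ?thesis .
qed

text \<open>
  The functions \<open>e q\<close> below have mean zero modulo \<open>q\<close>, so their products are orthogonal;
  \<open>\<Sum>Q. h Q * e Q\<close> is constantly \<open>G\<close> on the sifted set and has mean square \<open>G\<close>.
\<close>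
theorem selberg_sieve:
  fixes P :: "nat set" and \<Omega> :: "nat \<Rightarrow> nat set" and D :: real and N :: nat
  assumes P: "finite P" "\<And>q. q \<in> P \<Longrightarrow> prime q"
    and \<Omega>: "\<And>q. q \<in> P \<Longrightarrow> \<Omega> q \<subseteq> {..<q}" "\<And>q. q \<in> P \<Longrightarrow> \<Omega> q \<noteq> {}" "\<And>q. q \<in> P \<Longrightarrow> 2 * card (\<Omega> q) \<le> q"
    and D: "D \<ge> 1"
  defines "G \<equiv> (\<Sum>Q | Q \<subseteq> P \<and> real (\<Prod>Q) \<le> D. \<Prod>q\<in>Q. real (card (\<Omega> q)) / (real q - real (card (\<Omega> q))))"
  shows "real (card {r. r < N \<and> (\<forall>q\<in>P. r mod q \<notin> \<Omega> q)}) \<le> real N / G + 2 * D ^ 4"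
proof -
  define c where "c = (\<lambda>q. real (card (\<Omega> q)))"
  define h where "h = (\<lambda>q. c q / (real q - c q))"
  \<comment> \<open>The value on \<open>\<Omega> q\<close> is forced by mean zero:
    \<open>c q / h q = q - c q\<close>.\<close>
  define e where "e = (\<lambda>q a. if a \<in> \<Omega> q then - (1 / h q) else (1::real))"
  define \<Q> where "\<Q> = {Q. Q \<subseteq> P \<and> real (\<Prod>Q) \<le> D}"
  define H where "H = (\<lambda>Q. \<Prod>q\<in>Q. h q)"
  define E where "E = (\<lambda>Q r. \<Prod>q\<in>Q. e q (r mod q))"
  define F where "F = (\<lambda>r. \<Sum>Q\<in>\<Q>. H Q * E Q r)"
  define S where "S = {r. r < N \<and> (\<forall>q\<in>P. r mod q \<notin> \<Omega> q)}"
  have fin\<Q>: "finite \<Q>" unfolding \<Q>_def by (rule finite_subset[of _ "Pow P"]) (use P in auto)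
  have fin: "finite Q" if "Q \<in> \<Q>" for Q using that P(1) by (auto simp: \<Q>_def intro: finite_subset)
  have Qp: "prime q" if "Q \<in> \<Q>" "q \<in> Q" for Q q using that P(2) by (auto simp: \<Q>_def)
  have c: "c q \<ge> 1" "2 * c q \<le> real q" if "q \<in> P" for q
  proof -
    have "finite (\<Omega> q)" using \<Omega>(1)[OF that] finite_subset by blast
    then have "card (\<Omega> q) > 0" using \<Omega>(2)[OF that] by (simp add: card_gt_0_iff)
    then show "c q \<ge> 1" by (simp add: c_def)
    have "real (2 * card (\<Omega> q)) \<le> real q" using \<Omega>(3)[OF that] by (simp only: of_nat_le_iff)
    then show "2 * c q \<le> real q" by (simp add: c_def)
  qed
  have h: "h q > 0" "h q \<le> 1" if "q \<in> P" for q
    using c[OF that] by (auto simp: h_def field_simps)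
  \<comment> \<open>The hypothesis \<open>2 * card (\<Omega> q) \<le> q\<close> gives
    \<open>h q \<le> 1\<close>. Thus all products \<open>H Q * E Q r\<close> stay in
    \<open>[-1, 1]\<close>, and the error for a pair of sets depends on its period alone.\<close>
  have hE: "\<bar>h q * e q a\<bar> \<le> 1" if "q \<in> P" for q a
    using h[OF that] by (auto simp: e_def abs_mult)
  have Hpos: "H Q > 0" if "Q \<in> \<Q>" for Q
    using that h by (auto simp: H_def \<Q>_def intro!: prod_pos)
  have card_split: "(\<Sum>a<q. (if a \<in> \<Omega> q then u else v)) = c q * u + (real q - c q) * v" if "q \<in> P" for q and u v :: real
  proof -
    have "{..<q} \<inter> {x. x \<in> \<Omega> q} = \<Omega> q" using \<Omega>(1)[OF that] by auto
    moreover have "{..<q} \<inter> - {x. x \<in> \<Omega> q} = {..<q} - \<Omega> q" by auto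
    moreover have "card ({..<q} - \<Omega> q) = q - card (\<Omega> q)"
      using \<Omega>(1)[OF that] by (subst card_Diff_subset) (auto intro: finite_subset)
    moreover have "card (\<Omega> q) \<le> q" using \<Omega>(3)[OF that] by simp
    ultimately show ?thesis by (simp add: sum.If_cases c_def of_nat_diff)
  qed
  have e1: "(\<Sum>a<q. e q a) = 0" if "q \<in> P" for q
    unfolding e_def using card_split[OF that] c[OF that] by (simp add: h_def)
  have e2: "(\<Sum>a<q. e q a * e q a) = real q / h q" if "q \<in> P" for q
  proof -
    have "(\<Sum>a<q. e q a * e q a) = (\<Sum>a<q. if a \<in> \<Omega> q then (1 / h q)\<^sup>2 else 1)"
      by (intro sum.cong) (auto simp: e_def power2_eq_square)
    also have "\<dots> = c q * (1 / h q)\<^sup>2 + (real q - c q)" using card_split[OF that] by simp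
    also have "1 / h q = (real q - c q) / c q" by (simp add: h_def)
    also have "c q * ((real q - c q) / c q)\<^sup>2 + (real q - c q) = real q * ((real q - c q) / c q)"
      using c[OF that] by (simp add: divide_simps power2_eq_square) (simp add: algebra_simps)
    also have "\<dots> = real q / h q" by (simp add: h_def)
    finally show ?thesis .
  qed
  \<comment> \<open>The main term is the mean over a full period, which vanishes for
    \<open>Q1 \<noteq> Q2\<close>. The period is the product over the union of the two sets, hence
    at most \<open>D * D\<close>.\<close>
  have pair: "H Q1 * H Q2 * (\<Sum>r<N. E Q1 r * E Q2 r) \<le> (if Q1 = Q2 then real N * H Q1 else 0) + 2 * D ^ 2"
    if Q: "Q1 \<in> \<Q>" "Q2 \<in> \<Q>" for Q1 Q2
  proof -
    define U where "U = Q1 \<union> Q2"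
    define f where "f = (\<lambda>q a. (if q \<in> Q1 then e q a else 1) * (if q \<in> Q2 then e q a else 1))"
    define \<Phi> where "\<Phi> = (\<lambda>r. H Q1 * H Q2 * (\<Prod>q\<in>U. f q (r mod q)))"
    have U: "finite U" "\<And>q. q \<in> U \<Longrightarrow> prime q" "U \<subseteq> P"
      using Q fin[OF Q(1)] fin[OF Q(2)] Qp[OF Q(1)] Qp[OF Q(2)] unfolding U_def \<Q>_def by blast+
    have ext1: "(\<Prod>q\<in>Q1. g q) = (\<Prod>q\<in>U. if q \<in> Q1 then g q else 1)" for g :: "nat \<Rightarrow> real"
      using U(1) by (subst prod.inter_filter[symmetric]) (auto simp: U_def intro!: prod.cong)
    have ext2: "(\<Prod>q\<in>Q2. g q) = (\<Prod>q\<in>U. if q \<in> Q2 then g q else 1)" for g :: "nat \<Rightarrow> real"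
      using U(1) by (subst prod.inter_filter[symmetric]) (auto simp: U_def intro!: prod.cong)
    have EE: "E Q1 r * E Q2 r = (\<Prod>q\<in>U. f q (r mod q))" for r
      unfolding E_def f_def ext1 ext2 by (simp add: prod.distrib)
    have HE1: "\<bar>H Q * E Q r\<bar> \<le> 1" if "Q \<in> \<Q>" for Q r
    proof -
      have "\<bar>H Q * E Q r\<bar> = (\<Prod>q\<in>Q. \<bar>h q * e q (r mod q)\<bar>)"
        by (simp add: H_def E_def abs_prod flip: prod.distrib)
      also have "\<dots> \<le> (\<Prod>q\<in>Q. 1)" using that hE by (intro prod_mono) (auto simp: \<Q>_def)
      finally show ?thesis by simp
    qed
    have bd: "\<bar>\<Phi> r\<bar> \<le> 1" for r
    proof -
      have "\<Phi> r = (H Q1 * E Q1 r) * (H Q2 * E Q2 r)" by (simp add: \<Phi>_def EE[symmetric])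
      then have "\<bar>\<Phi> r\<bar> = \<bar>H Q1 * E Q1 r\<bar> * \<bar>H Q2 * E Q2 r\<bar>" by (simp add: abs_mult)
      also have "\<dots> \<le> 1 * 1" by (intro mult_mono HE1 Q) auto
      finally show ?thesis by simp
    qed
    have per: "\<Phi> (r + \<Prod>U) = \<Phi> r" for r
    proof -
      have "(r + \<Prod>U) mod q = r mod q" if "q \<in> U" for q
      proof -
        have "q dvd \<Prod>U" using that U by (auto intro: dvd_prodI)
        then show ?thesis by (metis dvd_def mod_mult_self2)
      qed
      then show ?thesis by (simp add: \<Phi>_def cong: prod.cong)
    qed
    have Upos: "\<Prod>U > 0" using U(2) by (intro prod_pos prime_gt_0_nat) blast
    have UD: "real (\<Prod>U) \<le> D ^ 2"
    proof -
      have "\<Prod>U * \<Prod>(Q1 \<inter> Q2) = \<Prod>Q1 * \<Prod>Q2" unfolding U_def using Q fin by (simp add: prod.union_inter)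
      moreover have "\<Prod>(Q1 \<inter> Q2) > 0" using Qp[OF Q(1)] by (intro prod_pos prime_gt_0_nat) blast
      ultimately have "\<Prod>U \<le> \<Prod>Q1 * \<Prod>Q2" using mult_le_mono2[of 1 "\<Prod>(Q1 \<inter> Q2)" "\<Prod>U"] by simp
      then have "real (\<Prod>U) \<le> real (\<Prod>Q1) * real (\<Prod>Q2)" by (metis of_nat_le_iff of_nat_mult)
      also have "\<dots> \<le> D * D" using Q D by (intro mult_mono) (auto simp: \<Q>_def intro!: prod_nonneg)
      finally show ?thesis by (simp add: power2_eq_square)
    qed
    have mean: "real N / real (\<Prod>U) * (\<Sum>r<\<Prod>U. \<Phi> r) = (if Q1 = Q2 then real N * H Q1 else 0)"
    proof -
      have *: "(\<Sum>r<\<Prod>U. \<Phi> r) = H Q1 * H Q2 * (\<Prod>q\<in>U. \<Sum>a<q. f q a)"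
        unfolding \<Phi>_def using sum_prod_residues[OF U(1,2), of f] by (simp flip: sum_distrib_left)
      show ?thesis
      proof (cases "Q1 = Q2")
        case True
        then have UQ: "U = Q1" by (simp add: U_def)
        have "(\<Prod>q\<in>U. \<Sum>a<q. f q a) = (\<Prod>q\<in>Q1. real q / h q)"
          unfolding UQ using True Q e2 by (intro prod.cong) (auto simp: f_def \<Q>_def)
        also have "\<dots> = real (\<Prod>U) / H Q1" by (simp add: UQ H_def prod_dividef)
        finally have **: "(\<Prod>q\<in>U. \<Sum>a<q. f q a) = real (\<Prod>U) / H Q1" .
        have "real (\<Prod>U) \<noteq> 0" using Upos by (simp only: of_nat_eq_0_iff)
        then show ?thesis unfolding * ** using True Hpos[OF Q(1)] by (simp del: of_nat_prod)
      next
        case False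
        then obtain q where q: "q \<in> U" "\<not> (q \<in> Q1 \<and> q \<in> Q2)" by (auto simp: U_def)
        then have "(\<Sum>a<q. f q a) = 0" using e1[of q] U(3) by (auto simp: f_def U_def)
        then have "(\<Prod>q\<in>U. \<Sum>a<q. f q a) = 0" using q U(1) by (subst prod_zero_iff) auto
        then show ?thesis using * False by simp
      qed
    qed
    have "H Q1 * H Q2 * (\<Sum>r<N. E Q1 r * E Q2 r) = (\<Sum>r<N. \<Phi> r)"
      unfolding \<Phi>_def EE by (simp add: sum_distrib_left)
    also have "\<dots> \<le> (if Q1 = Q2 then real N * H Q1 else 0) + 2 * real (\<Prod>U) * 1"
      using sum_periodic_approx[of \<Phi> "\<Prod>U" 1 N, OF per Upos bd] unfolding mean by linarith
    also have "\<dots> \<le> (if Q1 = Q2 then real N * H Q1 else 0) + 2 * D ^ 2" using UD by simp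
    finally show ?thesis .
  qed
  have G: "G = (\<Sum>Q\<in>\<Q>. H Q)" unfolding G_def \<Q>_def H_def h_def c_def by (rule refl)
  have G1: "G \<ge> 1"
  proof -
    have "{} \<in> \<Q>" using D by (simp add: \<Q>_def)
    then have "H {} \<le> G" unfolding G by (intro member_le_sum fin\<Q>) (auto intro: less_imp_le Hpos)
    then show ?thesis by (simp add: H_def)
  qed
  have "real (card S) * G\<^sup>2 = (\<Sum>r\<in>S. (F r)\<^sup>2)"
  proof -
    have "F r = G" if "r \<in> S" for r
    proof -
      have "E Q r = 1" if "Q \<in> \<Q>" for Q
        unfolding E_def using that \<open>r \<in> S\<close> by (intro prod.neutral) (auto simp: S_def e_def \<Q>_def)
      then show ?thesis by (simp add: F_def G)
    qed
    then show ?thesis by simp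
  qed
  also have "\<dots> \<le> (\<Sum>r<N. (F r)\<^sup>2)" by (intro sum_mono2) (auto simp: S_def)
  also have "\<dots> = (\<Sum>r<N. \<Sum>Q1\<in>\<Q>. \<Sum>Q2\<in>\<Q>. H Q1 * H Q2 * (E Q1 r * E Q2 r))"
    by (simp add: F_def power2_eq_square sum_product mult_ac)
  also have "\<dots> = (\<Sum>Q1\<in>\<Q>. \<Sum>Q2\<in>\<Q>. \<Sum>r<N. H Q1 * H Q2 * (E Q1 r * E Q2 r))"
    by (subst sum.swap, intro sum.cong refl, subst sum.swap) auto
  also have "\<dots> = (\<Sum>Q1\<in>\<Q>. \<Sum>Q2\<in>\<Q>. H Q1 * H Q2 * (\<Sum>r<N. E Q1 r * E Q2 r))"
    by (simp add: sum_distrib_left)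
  also have "\<dots> \<le> (\<Sum>Q1\<in>\<Q>. \<Sum>Q2\<in>\<Q>. (if Q1 = Q2 then real N * H Q1 else 0) + 2 * D ^ 2)"
    by (intro sum_mono pair)
  also have "\<dots> = real N * G + (real (card \<Q>))\<^sup>2 * (2 * D ^ 2)"
    using fin\<Q> by (simp add: sum.distrib G sum_distrib_left power2_eq_square mult_ac)
  \<comment> \<open>At most \<open>D\<close> sets have product up to \<open>D\<close>, so there are
    at most \<open>D ^ 2\<close> pairs, each with error \<open>2 * D ^ 2\<close>.\<close>
  also have "\<dots> \<le> real N * G + D\<^sup>2 * (2 * D ^ 2)"
    using card_prod_primes_le[OF P, of D] D unfolding \<Q>_def
    by (intro add_left_mono mult_right_mono power_mono) auto
  also have "\<dots> = real N * G + 2 * D ^ 4" by (simp add: power_numeral_reduce power2_eq_square)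
  finally have "real (card S) * G\<^sup>2 \<le> real N * G + 2 * D ^ 4" .
  then have "real (card S) \<le> (real N * G + 2 * D ^ 4) / G\<^sup>2" using G1 by (subst pos_le_divide_eq) auto
  also have "\<dots> = real N / G + 2 * D ^ 4 / G\<^sup>2" using G1 by (simp add: add_divide_distrib power2_eq_square)
  also have "2 * D ^ 4 / G\<^sup>2 \<le> 2 * D ^ 4 / 1" using G1 D by (intro divide_left_mono) auto
  finally show ?thesis by (simp add: S_def)
qed

section \<open>Shifted primes with prescribed small prime factors\<close>

definition GS :: "(nat \<Rightarrow> real) \<Rightarrow> nat set \<Rightarrow> real \<Rightarrow> real" where
  "GS h P y = (\<Sum>Q | Q \<subseteq> P \<and> real (\<Prod>Q) \<le> y. \<Prod>q\<in>Q. h q)"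

lemma finite_GS_index: "finite P \<Longrightarrow> finite {Q. Q \<subseteq> P \<and> real (\<Prod>Q) \<le> y}"
  by (rule finite_subset[of _ "Pow P"]) auto

lemma GS_insert:
  assumes "finite P" "q \<notin> P" "q > 0"
  shows "GS h (insert q P) y = GS h P y + h q * GS h P (y / real q)"
proof -
  let ?I = "\<lambda>P y. {Q. Q \<subseteq> P \<and> real (\<Prod>Q) \<le> y}"
  have ins: "\<Prod>(insert q Q) = q * \<Prod>Q" if "Q \<subseteq> P" for Q
    using that assms finite_subset[OF that] by (subst prod.insert) auto
  have eq: "?I (insert q P) y = ?I P y \<union> insert q ` ?I P (y / real q)" (is "?L = ?R")
  proof (intro equalityI subsetI)
    fix Q assume Q: "Q \<in> ?L"
    show "Q \<in> ?R"
    proof (cases "q \<in> Q")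
      case True
      then have 1: "Q = insert q (Q - {q})" "Q - {q} \<subseteq> P" using Q by auto
      then have "real q * real (\<Prod>(Q - {q})) \<le> y" using ins[OF 1(2)] Q by (metis (mono_tags, lifting) mem_Collect_eq of_nat_mult)
      then have "Q - {q} \<in> ?I P (y / real q)" using assms(3) 1(2) by (simp add: pos_le_divide_eq mult.commute del: of_nat_prod)
      then show ?thesis using 1(1) by blast
    next
      case False
      then show ?thesis using Q by auto
    qed
  next
    fix Q assume "Q \<in> ?R"
    then show "Q \<in> ?L"
    proof
      assume "Q \<in> insert q ` ?I P (y / real q)"
      then obtain R where R: "Q = insert q R" "R \<subseteq> P" "real (\<Prod>R) \<le> y / real q" by auto
      then have "real q * real (\<Prod>R) \<le> y" using assms(3) by (simp add: pos_le_divide_eq mult.commute del: of_nat_prod)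
      then have "real (\<Prod>Q) \<le> y" unfolding R(1) ins[OF R(2)] by (simp only: of_nat_mult)
      then show ?thesis using R by auto
    qed auto
  qed
  have "GS h (insert q P) y = (\<Sum>Q\<in>?I P y. \<Prod>q\<in>Q. h q) + (\<Sum>Q\<in>insert q ` ?I P (y / real q). \<Prod>q\<in>Q. h q)"
    unfolding GS_def eq using assms by (intro sum.union_disjoint) (auto simp: finite_GS_index simp del: of_nat_prod)
  also have "(\<Sum>Q\<in>insert q ` ?I P (y / real q). \<Prod>q\<in>Q. h q) = (\<Sum>Q\<in>?I P (y / real q). \<Prod>q\<in>insert q Q. h q)"
    using assms(2) by (subst sum.reindex) (auto simp: inj_on_def simp del: of_nat_prod)
  also have "\<dots> = (\<Sum>Q\<in>?I P (y / real q). h q * (\<Prod>q\<in>Q. h q))"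
  proof (intro sum.cong refl)
    fix Q assume "Q \<in> ?I P (y / real q)"
    then have "q \<notin> Q" "finite Q" using assms by (auto intro: finite_subset)
    then show "(\<Prod>q\<in>insert q Q. h q) = h q * (\<Prod>q\<in>Q. h q)" by simp
  qed
  finally show ?thesis unfolding GS_def by (simp add: sum_distrib_left)
qed

lemma GS_nonneg: "(\<And>q. q \<in> P \<Longrightarrow> 0 \<le> h q) \<Longrightarrow> 0 \<le> GS h P y"
  unfolding GS_def by (intro sum_nonneg prod_nonneg) auto

lemma GS_mono:
  assumes "finite P'" "P \<subseteq> P'" "y \<le> y'" "\<And>q. q \<in> P' \<Longrightarrow> 0 \<le> h q"
  shows "GS h P y \<le> GS h P' y'"
  unfolding GS_def using assms
  by (intro sum_mono2 finite_GS_index prod_nonneg) (auto simp del: of_nat_prod)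

text \<open>Dropping a prime \<open>k\<close> loses at most the factor \<open>1 + h k\<close>,
  because in \<open>GS_insert\<close> the sum at the lower level is at most the sum at level
  \<open>y\<close>. It serves to discard the finitely many primes at which the sieve conditions
  fail.\<close>

lemma GS_remove:
  assumes "finite K" "finite P" "\<And>q. q \<in> P \<Longrightarrow> q > 0" "\<And>q. q \<in> P \<union> K \<Longrightarrow> 0 \<le> h q"
  shows "GS h P y \<le> (\<Prod>q\<in>K. 1 + h q) * GS h (P - K) y"
  using assms
proof (induction K rule: finite_induct)
  case (insert k K)
  have IH: "GS h P y \<le> (\<Prod>q\<in>K. 1 + h q) * GS h (P - K) y" using insert by auto
  have "GS h (P - K) y \<le> (1 + h k) * GS h (P - insert k K) y"
  proof (cases "k \<in> P - K")
    case True
    let ?R = "P - insert k K"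
    have hR: "\<And>q. q \<in> ?R \<Longrightarrow> 0 \<le> h q" and hk: "0 \<le> h k" using insert.prems by auto
    have PK: "P - K = insert k ?R" using True by auto
    have "GS h (P - K) y = GS h ?R y + h k * GS h ?R (y / real k)"
      unfolding PK by (rule GS_insert) (use insert.prems True in auto)
    moreover have "GS h ?R (y / real k) \<le> GS h ?R y"
    proof (cases "y \<ge> 0")
      case True
      then have "y / real k \<le> y" using insert.prems(2)[of k] \<open>k \<in> P - K\<close>
        by (simp add: divide_le_eq mult_left_le mult_le_cancel_left1)
      then show ?thesis using insert.prems hR by (intro GS_mono) auto
    next
      case False
      then have "{Q. Q \<subseteq> ?R \<and> real (\<Prod>Q) \<le> y / real k} = {}"
        using insert.prems(2)[of k] \<open>k \<in> P - K\<close>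
        by (simp add: not_le del: of_nat_prod) (metis (no_types) divide_neg_pos less_le_trans of_nat_0_le_iff of_nat_0_less_iff DiffD1)
      then have "GS h ?R (y / real k) = 0" by (simp only: GS_def sum.empty)
      then show ?thesis using GS_nonneg[of ?R h y, OF hR] by simp
    qed
    ultimately show ?thesis using mult_left_mono[OF _ hk] by (simp add: distrib_right)
  next
    case False
    then have "P - insert k K = P - K" by auto
    moreover have "GS h (P - K) y \<ge> 0" using insert.prems by (intro GS_nonneg) auto
    ultimately show ?thesis using insert.prems by (simp add: algebra_simps)
  qed
  then have "(\<Prod>q\<in>K. 1 + h q) * GS h (P - K) y \<le> (\<Prod>q\<in>K. 1 + h q) * ((1 + h k) * GS h (P - insert k K) y)"
    using insert.prems by (intro mult_left_mono prod_nonneg) (auto simp: add_nonneg_nonneg)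
  then show ?case using IH insert.hyps by (simp add: mult_ac)
qed auto

text \<open>Multiplying out, a pair of sets is recorded by its union, whose product is at most
  \<open>y * z\<close>. A prime of \<open>B\<close> lies in the first set, in the second or in both,
  with total weight \<open>2 * f q + (f q)\<^sup>2\<close>; a prime outside \<open>B\<close> lies
  only in the first. So a sum of dimension 2 on \<open>B\<close> is bounded below by two sums of
  dimension 1, each of logarithmic size.\<close>

lemma GS_two_dimensional:
  assumes "finite P" "\<And>q. q \<in> P \<Longrightarrow> q > 0" "\<And>q. q \<in> P \<Longrightarrow> 0 \<le> f q"
    and "\<And>q. q \<in> P \<Longrightarrow> f q \<le> h q" "\<And>q. q \<in> P \<inter> B \<Longrightarrow> 2 * f q + (f q)\<^sup>2 \<le> h q"
    and "y \<ge> 0" "z \<ge> 0"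
  shows "GS f P y * GS f (P \<inter> B) z \<le> GS h P (y * z)"
  using assms
proof (induction P arbitrary: y z rule: finite_induct)
  case empty
  have "{Q. Q = {} \<and> real (\<Prod>Q) \<le> y} = (if y \<ge> 1 then {{}} else {})" for y by auto
  then have "GS h {} y = (if y \<ge> 1 then 1 else 0)" for h y by (simp add: GS_def)
  moreover have "y * z \<ge> 1" if "y \<ge> 1" "z \<ge> 1" using mult_mono[of 1 y 1 z] that by simp
  ultimately show ?case by auto
next
  case (insert q P)
  have f: "\<And>r. r \<in> P \<Longrightarrow> 0 \<le> f r" "0 \<le> f q" "f q \<le> h q" using insert.prems by auto
  have h: "0 \<le> h q" using f by linarith
  have q: "real q \<ge> 1" using insert.prems(1)[of q] by simp
  have IH: "GS f P y * GS f (P \<inter> B) z \<le> GS h P (y * z)" if "y \<ge> 0" "z \<ge> 0" for y z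
    using that insert.prems by (intro insert.IH) auto
  have G0: "GS f P y \<ge> 0" "GS f (P \<inter> B) y \<ge> 0" for y using f by (auto intro!: GS_nonneg)
  show ?case
  proof (cases "q \<in> B")
    case False
    then have "insert q P \<inter> B = P \<inter> B" by auto
    then have "GS f (insert q P) y * GS f (insert q P \<inter> B) z =
        GS f P y * GS f (P \<inter> B) z + f q * (GS f P (y / real q) * GS f (P \<inter> B) z)"
      using GS_insert[of P q f y] insert by (simp add: algebra_simps)
    also have "\<dots> \<le> GS h P (y * z) + h q * GS h P (y * z / real q)"
      using IH[of y z] IH[of "y / real q" z] insert.prems f h G0 by (intro add_mono mult_mono) auto
    also have "\<dots> = GS h (insert q P) (y * z)" using GS_insert[of P q h] insert by simp
    finally show ?thesis .
  next
    case True
    then have eq: "insert q P \<inter> B = insert q (P \<inter> B)" by auto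
    let ?X = "GS h P (y * z / real q)"
    have 1: "GS f P (y / real q) * GS f (P \<inter> B) z \<le> ?X" using IH[of "y / real q" z] insert.prems by simp
    have 2: "GS f P y * GS f (P \<inter> B) (z / real q) \<le> ?X" using IH[of y "z / real q"] insert.prems by simp
    \<comment> \<open>If \<open>q\<close> occurs in both factors, the levels drop to
      \<open>y / q\<close> and \<open>z / q\<close>. Giving up one of these two gains leaves the
      same level \<open>y * z / q\<close> as in the other cases.\<close>
    have "GS f (P \<inter> B) (z / real q) \<le> GS f (P \<inter> B) z"
      using q insert f by (intro GS_mono) (auto simp: divide_le_eq mult_left_le mult_le_cancel_left1)
    then have "GS f P (y / real q) * GS f (P \<inter> B) (z / real q) \<le> GS f P (y / real q) * GS f (P \<inter> B) z"
      using G0 by (intro mult_left_mono) auto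
    then have 3: "GS f P (y / real q) * GS f (P \<inter> B) (z / real q) \<le> ?X" using 1 by linarith
    have X0: "?X \<ge> 0" using 1 G0 by (meson mult_nonneg_nonneg order_trans)
    have "GS f (insert q P) y * GS f (insert q P \<inter> B) z =
        GS f P y * GS f (P \<inter> B) z + f q * (GS f P (y / real q) * GS f (P \<inter> B) z)
        + f q * (GS f P y * GS f (P \<inter> B) (z / real q)) + (f q)\<^sup>2 * (GS f P (y / real q) * GS f (P \<inter> B) (z / real q))"
      unfolding eq using GS_insert[of P q f y] GS_insert[of "P \<inter> B" q f z] insert
      by (simp add: algebra_simps power2_eq_square)
    also have "\<dots> \<le> GS h P (y * z) + f q * ?X + f q * ?X + (f q)\<^sup>2 * ?X"
      using IH[of y z] 1 2 3 insert.prems f by (intro add_mono mult_left_mono) auto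
    also have "\<dots> = GS h P (y * z) + (2 * f q + (f q)\<^sup>2) * ?X" by (simp add: algebra_simps)
    also have "\<dots> \<le> GS h P (y * z) + h q * ?X"
      using insert.prems True X0 by (intro add_left_mono mult_right_mono) auto
    also have "\<dots> = GS h (insert q P) (y * z)" using GS_insert[of P q h] insert by simp
    finally show ?thesis .
  qed
qed

text \<open>By unique factorization a number whose set of prime factors is \<open>Q\<close> is
  determined by its exponents, all at least 1, so the sum is part of a product of geometric
  series.\<close>

lemma sum_inverse_radical_le:
  assumes "finite Q" "\<And>q. q \<in> Q \<Longrightarrow> prime q"
  shows "(\<Sum>k | k \<in> {1..n} \<and> prime_factors k = Q. 1 / real k) \<le> (\<Prod>q\<in>Q. 1 / (real q - 1))"
proof -
  let ?K = "{k. k \<in> {1..n} \<and> prime_factors k = Q}"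
  let ?g = "\<lambda>k. \<lambda>q\<in>Q. multiplicity q k"
  have fact: "k = (\<Prod>q\<in>Q. q ^ multiplicity q k)" if "k \<in> ?K" for k
    using that prime_factorization_nat[of k] by auto
  have inj: "inj_on ?g ?K"
  proof (rule inj_onI)
    fix k l assume kl: "k \<in> ?K" "l \<in> ?K" "?g k = ?g l"
    have "multiplicity q k = multiplicity q l" if "q \<in> Q" for q
      using fun_cong[OF kl(3), of q] that by simp
    then have "(\<Prod>q\<in>Q. q ^ multiplicity q k) = (\<Prod>q\<in>Q. q ^ multiplicity q l)" by (intro prod.cong) auto
    then show "k = l" using fact[OF kl(1)] fact[OF kl(2)] by simp
  qed
  have sub: "?g ` ?K \<subseteq> PiE Q (\<lambda>_. {1..n})"
  proof (intro image_subsetI PiE_I)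
    fix k q assume k: "k \<in> ?K" and q: "q \<in> Q"
    have "k > 0" "k \<le> n" using k by auto
    have "prime q" "q dvd k" using k q by (auto simp: in_prime_factors_iff)
    then have "multiplicity q k \<ge> 1" using \<open>k > 0\<close> by (simp add: Suc_le_eq prime_multiplicity_gt_zero_iff)
    moreover have "multiplicity q k < q ^ multiplicity q k" using prime_gt_1_nat[OF \<open>prime q\<close>] by (intro power_gt_expt) simp
    moreover have "q ^ multiplicity q k \<le> k" using \<open>k > 0\<close> by (intro dvd_imp_le multiplicity_dvd)
    ultimately show "?g k q \<in> {1..n}" using q \<open>k \<le> n\<close> by simp
  qed auto
  have "(\<Sum>k\<in>?K. 1 / real k) = (\<Sum>k\<in>?K. \<Prod>q\<in>Q. (1 / real q) ^ (?g k q))"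
  proof (intro sum.cong refl)
    fix k assume k: "k \<in> ?K"
    have "1 / real k = 1 / real (\<Prod>q\<in>Q. q ^ multiplicity q k)" using fact[OF k] by simp
    also have "\<dots> = (\<Prod>q\<in>Q. (1 / real q) ^ (?g k q))"
      by (simp add: power_one_over prod_dividef cong: prod.cong)
    finally show "1 / real k = (\<Prod>q\<in>Q. (1 / real q) ^ (?g k q))" .
  qed
  also have "\<dots> = (\<Sum>g\<in>?g ` ?K. \<Prod>q\<in>Q. (1 / real q) ^ (g q))"
    using inj by (subst sum.reindex) auto
  also have "\<dots> \<le> (\<Sum>g\<in>PiE Q (\<lambda>_. {1..n}). \<Prod>q\<in>Q. (1 / real q) ^ (g q))"
    using assms(1) sub by (intro sum_mono2 finite_PiE prod_nonneg) auto
  also have "\<dots> = (\<Prod>q\<in>Q. \<Sum>j=1..n. (1 / real q) ^ j)"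
    using assms(1) by (subst prod_sum_PiE) auto
  also have "\<dots> \<le> (\<Prod>q\<in>Q. 1 / (real q - 1))"
  proof (intro prod_mono conjI sum_nonneg)
    fix q assume "q \<in> Q"
    then have "real q \<ge> 2" using prime_ge_2_nat[OF assms(2)] by simp
    then show "(\<Sum>j=1..n. (1 / real q) ^ j) \<le> 1 / (real q - 1)" by (rule sum_inverse_powers_le)
  qed auto
  finally show ?thesis .
qed

lemma ln_le_harmonic: "ln (real n + 1) \<le> (\<Sum>k=1..n. 1 / real k)"
proof (induction n)
  case (Suc n)
  have "ln (real n + 2) - ln (real n + 1) = ln (1 + 1 / (real n + 1))"
    using ln_divide_pos[of "real n + 2" "real n + 1"] by (simp add: add_divide_distrib[symmetric] field_simps)
  also have "\<dots> \<le> 1 / (real n + 1)" by (intro ln_add_one_self_le_self) auto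
  finally show ?case using Suc by (simp add: add.commute)
qed auto

text \<open>The harmonic sum up to \<open>y\<close> is grouped by sets of prime factors. The radical
  of a number \<open>k \<le> y\<close> is again at most \<open>y\<close>, and each group is bounded
  by \<open>sum_inverse_radical_le\<close>.\<close>

lemma GS_primes_ge_ln:
  assumes "y \<ge> 1"
  shows "ln y \<le> GS (\<lambda>q. 1 / (real q - 1)) (primes_upto y) y"
proof -
  define n where "n = nat \<lfloor>y\<rfloor>"
  let ?I = "{Q. Q \<subseteq> primes_upto y \<and> real (\<Prod>Q) \<le> y}"
  have n: "y \<le> real n + 1" "real n \<le> y" using assms by (auto simp: n_def)
  have img: "prime_factors k \<in> ?I" if k: "k \<in> {1..n}" for k
  proof -
    have "\<Prod>(prime_factors k) dvd k" by (rule prod_primes_dvd) (auto simp: in_prime_factors_iff)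
    then have "\<Prod>(prime_factors k) \<le> k" using k by (intro dvd_imp_le) auto
    then have "\<Prod>(prime_factors k) \<le> n" using k by auto
    then have "real (\<Prod>(prime_factors k)) \<le> real n" by (simp only: of_nat_le_iff)
    moreover have "real q \<le> y" if "q dvd k" for q
    proof -
      have "q \<le> n" using dvd_imp_le[OF that] k by auto
      then have "real q \<le> real n" by simp
      then show ?thesis using n by simp
    qed
    ultimately show ?thesis using n by (auto simp: in_prime_factors_iff simp del: of_nat_prod)
  qed
  have "ln y \<le> ln (real n + 1)" using n assms by simp
  also have "\<dots> \<le> (\<Sum>k=1..n. 1 / real k)" by (rule ln_le_harmonic)
  also have "\<dots> = (\<Sum>Q\<in>?I. \<Sum>k | k \<in> {1..n} \<and> prime_factors k = Q. 1 / real k)"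
  proof (rule sum.group[symmetric])
    show "prime_factors ` {1..n} \<subseteq> ?I" using img by (rule image_subsetI)
    show "finite ?I" by (rule finite_GS_index[OF finite_primes_upto])
  qed auto
  also have "\<dots> \<le> GS (\<lambda>q. 1 / (real q - 1)) (primes_upto y) y"
    unfolding GS_def
  proof (intro sum_mono sum_inverse_radical_le)
    fix Q assume "Q \<in> ?I"
    then show "finite Q" using finite_subset[OF _ finite_primes_upto] by blast
  qed auto
  finally show ?thesis .
qed

section \<open>The sieve bound for shifted primes\<close>

lemma exists_residue:
  fixes a :: int
  assumes "prime q" "\<not> q dvd m"
  shows "\<exists>r<q. int q dvd int m * int r - a"
proof -
  have "coprime (int m) (int q)"
    using prime_imp_coprime[OF assms] by (simp add: coprime_commute)
  then obtain u where "[int m * u = 1] (mod int q)" using cong_solve_coprime_int by blast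
  then have u: "int q dvd int m * u - 1" by (simp add: cong_iff_dvd_diff)
  define r where "r = nat ((u * a) mod int q)"
  have q: "int q > 0" using prime_gt_0_nat[OF assms(1)] by simp
  have r: "int r = (u * a) mod int q" using q by (simp add: r_def)
  have "int r < int q" unfolding r using q by (rule pos_mod_bound)
  then have "r < q" by simp
  moreover have "int q dvd int m * int r - a"
  proof -
    have "int q dvd u * a - int r" unfolding r by (simp add: minus_mod_eq_mult_div)
    then have "int q dvd int m * (u * a - int r)" by (rule dvd_mult)
    moreover have "int q dvd (int m * u - 1) * a" using u by (rule dvd_mult2)
    moreover have "int m * int r - a = (int m * u - 1) * a - int m * (u * a - int r)" by (simp add: algebra_simps)
    ultimately show ?thesis by (metis dvd_diff)
  qed
  ultimately show ?thesis by blast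
qed

text \<open>\<open>T\<close> only limits which primes are forced into \<open>S\<close>; the set
  \<open>S\<close> may itself contain larger primes. So the same notion covers the exact set of
  prime factors up to \<open>T\<close> and, with \<open>T = 2\<close>, divisibility by a given
  product. The condition \<open>\<bar>a\<bar> + 1 < int p\<close> keeps \<open>p + a\<close> at
  least 2, so nothing is lost in \<open>nat\<close>.\<close>

definition sifted :: "int \<Rightarrow> real \<Rightarrow> real \<Rightarrow> nat set \<Rightarrow> nat set" where
  "sifted a x T S = {p. prime p \<and> \<bar>a\<bar> + 1 < int p \<and> real p \<le> x \<and> \<Prod>S dvd nat (int p + a) \<and>
     (\<forall>q. prime q \<and> q dvd nat (int p + a) \<and> real q \<le> T \<longrightarrow> q \<in> S)}"

text \<open>With \<open>m = \<Prod>S\<close> write \<open>p + a = m * r\<close> and sieve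
  \<open>r\<close>. The number \<open>p = m * r - a\<close> has no prime factor other than itself,
  and \<open>r\<close> has none up to \<open>T\<close> outside \<open>S\<close>: dimension 2 up to
  \<open>T\<close>, dimension 1 beyond. \<open>GS_two_dimensional\<close> turns this into the two
  logarithms.\<close>

lemma card_sifted_le_aux:
  fixes a :: int and x T D :: real and S :: "nat set"
  assumes a: "a \<noteq> 0" and T: "2 \<le> T" "T \<le> sqrt D" and D: "D \<ge> 1" and x: "x \<ge> 1"
    and S: "finite S" "\<And>q. q \<in> S \<Longrightarrow> prime q" and m: "real (\<Prod>S) \<le> x" and xa: "real_of_int \<bar>a\<bar> \<le> x"
  defines "K \<equiv> {2,3} \<union> prime_factors (nat \<bar>a\<bar>) \<union> S"
  shows "real (card (sifted a x T S)) \<le> D + 2 * D ^ 4 +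
    3 * x / real (\<Prod>S) * (\<Prod>q\<in>K. 1 + 1 / (real q - 1))\<^sup>2 / (ln (sqrt D) * ln T)"
proof -
  define m where "m = \<Prod>S"
  have m0: "m > 0" unfolding m_def using S by (intro prod_pos prime_gt_0_nat)
  \<comment> \<open>Excluded are 2 and 3, where two classes would violate
    \<open>2 * card (\<Omega> q) \<le> q\<close>; the divisors of \<open>a\<close>, where the two
    classes coincide; and \<open>S\<close>, where \<open>m\<close> is not invertible.\<close>
  define P where "P = primes_upto D - K"
  define B where "B = {q. real q \<le> T}"
  define f where "f = (\<lambda>q::nat. 1 / (real q - 1))"
  define W where "W = (\<Prod>q\<in>K. 1 + f q)"
  have K: "finite K" "\<And>q. q \<in> K \<Longrightarrow> prime q" using S by (auto simp: K_def)
  have P: "finite P" "\<And>q. q \<in> P \<Longrightarrow> prime q" by (auto simp: P_def)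
  have nm: "\<not> q dvd m" and na: "\<not> int q dvd a" and q5: "q \<ge> 5" if "q \<in> P" for q
  proof -
    have q: "prime q" "q \<notin> S" "q \<notin> prime_factors (nat \<bar>a\<bar>)" "q \<noteq> 2" "q \<noteq> 3" using that by (auto simp: P_def K_def)
    show "\<not> q dvd m"
    proof
      assume "q dvd m"
      then obtain s where "s \<in> S" "q dvd s" unfolding m_def using prime_dvd_prod_iff[OF S(1) q(1), of "\<lambda>x. x"] by auto
      then show False using primes_dvd_imp_eq[OF q(1) S(2)] q(2) by auto
    qed
    show "\<not> int q dvd a"
    proof
      assume "int q dvd a"
      then have "q dvd nat \<bar>a\<bar>" by (simp add: nat_abs_dvd_iff int_dvd_int_iff[symmetric])
      then show False using q a by (simp add: in_prime_factors_iff)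
    qed
    have "q > 2" using prime_ge_2_nat[OF q(1)] q(4) by linarith
    then have "odd q" using prime_odd_nat[OF q(1)] by simp
    then have "q \<noteq> 4" by auto
    then show "q \<ge> 5" using \<open>q > 2\<close> q(5) by linarith
  qed
  define r0 where "r0 = (\<lambda>q. SOME r. r < q \<and> int q dvd int m * int r - a)"
  have r0: "r0 q < q" "int q dvd int m * int (r0 q) - a" if "q \<in> P" for q
  proof -
    have "\<exists>r. r < q \<and> int q dvd int m * int r - a" using exists_residue[OF P(2)[OF that] nm[OF that]] by auto
    from someI_ex[OF this] show "r0 q < q" "int q dvd int m * int (r0 q) - a" by (auto simp: r0_def)
  qed
  have r00: "r0 q \<noteq> 0" if "q \<in> P" for q
    using r0(2)[OF that] na[OF that] by (auto intro: ccontr)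
  \<comment> \<open>The class \<open>r0 q\<close> makes \<open>q\<close> divide \<open>p\<close>;
    the class 0 makes \<open>q\<close> divide \<open>p + a\<close>.\<close>
  define \<Omega> where "\<Omega> = (\<lambda>q. if q \<in> B then {0, r0 q} else {r0 q})"
  have card: "card (\<Omega> q) = (if q \<in> B then 2 else 1)" if "q \<in> P" for q
    using r00[OF that] by (auto simp: \<Omega>_def)
  define h where "h = (\<lambda>q. real (card (\<Omega> q)) / (real q - real (card (\<Omega> q))))"
  define N where "N = nat \<lfloor>(x + real_of_int \<bar>a\<bar>) / real m\<rfloor> + 1"
  define R where "R = {r. r < N \<and> (\<forall>q\<in>P. r mod q \<notin> \<Omega> q)}"
  have sieve: "real (card R) \<le> real N / GS h P D + 2 * D ^ 4"
    unfolding R_def GS_def h_def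
  proof (rule selberg_sieve[OF P])
    fix q assume q: "q \<in> P"
    show "\<Omega> q \<subseteq> {..<q}" using r0[OF q] q5[OF q] by (auto simp: \<Omega>_def)
    show "\<Omega> q \<noteq> {}" by (simp add: \<Omega>_def)
    show "2 * card (\<Omega> q) \<le> q" using card[OF q] q5[OF q] by auto
  qed (use D in auto)
  have f0: "f q \<ge> 0" if "prime q" for q using prime_ge_2_nat[OF that] by (simp add: f_def)
  have W1: "W \<ge> 1" unfolding W_def using K f0 by (intro prod_ge_1) auto
  have lnT: "ln T > 0" using T by simp
  have sD: "sqrt D \<ge> 2" using T by linarith
  then have lnD: "ln (sqrt D) > 0" by (intro ln_gt_zero) linarith
  have DsD: "sqrt D \<le> D"
  proof -
    have "1 \<le> sqrt D" "0 \<le> sqrt D" using sD by linarith+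
    then have "sqrt D * 1 \<le> sqrt D * sqrt D" by (rule mult_left_mono)
    then show ?thesis using D by simp
  qed
  have G1: "ln y / W \<le> GS f (Q - K) y" if "y \<ge> 1" "Q = primes_upto y" for y Q
  proof -
    have "ln y \<le> GS f Q y" using GS_primes_ge_ln[OF that(1)] by (simp add: that(2) f_def)
    also have "\<dots> \<le> W * GS f (Q - K) y"
      unfolding W_def using K f0 that by (intro GS_remove) (auto simp: prime_gt_0_nat)
    finally show ?thesis using W1 by (simp add: divide_le_eq mult.commute)
  qed
  \<comment> \<open>The level \<open>D\<close> is split evenly between the two factors; the second
    one uses only the part up to \<open>T \<le> sqrt D\<close> of its share.\<close>
  have "ln (sqrt D) / W * (ln T / W) \<le> GS f P (sqrt D) * GS f (P \<inter> B) (sqrt D)"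
  proof (intro mult_mono)
    have "ln (sqrt D) / W \<le> GS f (primes_upto (sqrt D) - K) (sqrt D)" by (rule G1) (use sD in linarith, rule refl)
    also have "\<dots> \<le> GS f P (sqrt D)"
    proof (rule GS_mono[OF P(1) _ order_refl])
      show "primes_upto (sqrt D) - K \<subseteq> P" unfolding P_def by (auto intro: order_trans[OF _ DsD])
      show "0 \<le> f q" if "q \<in> P" for q using P(2)[OF that] by (rule f0)
    qed
    finally show "ln (sqrt D) / W \<le> GS f P (sqrt D)" .
    have "ln T / W \<le> GS f (primes_upto T - K) T" using T by (intro G1) auto
    also have "\<dots> \<le> GS f (P \<inter> B) (sqrt D)"
    proof (rule GS_mono)
      have "T \<le> D" using T(2) DsD by linarith
      then show "primes_upto T - K \<subseteq> P \<inter> B" unfolding P_def B_def by (auto intro: order_trans)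
      show "0 \<le> f q" if "q \<in> P \<inter> B" for q using that P(2) f0 by blast
    qed (use P(1) T(2) in auto)
    finally show "ln T / W \<le> GS f (P \<inter> B) (sqrt D)" .
    show "0 \<le> GS f P (sqrt D)" using P(2) f0 by (intro GS_nonneg) blast
  qed (use lnT W1 in auto)
  also have "\<dots> \<le> GS h P (sqrt D * sqrt D)"
  proof (rule GS_two_dimensional[OF P(1)])
    fix q assume q: "q \<in> P"
    then show "q > 0" "f q \<ge> 0" using P(2) f0 prime_gt_0_nat by blast+
    have "real q \<ge> 5" using q5[OF q] by simp
    then show "f q \<le> h q" using card[OF q] by (auto simp: f_def h_def field_simps)
  next
    fix q assume q: "q \<in> P \<inter> B"
    then have q5: "real q \<ge> 5" using q5[of q] by simp
    have "h q = 2 / (real q - 2)" using card[of q] q by (simp add: h_def)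
    moreover have "2 * f q + (f q)\<^sup>2 = (2 * real q - 1) / (real q - 1)\<^sup>2"
    proof -
      have "2 * (1 / u) + (1 / u)\<^sup>2 = (2 * u + 1) / u\<^sup>2" if "u > 0" for u :: real
        using that by (simp add: power2_eq_square add_divide_distrib)
      from this[of "real q - 1"] show ?thesis using q5 by (simp add: f_def algebra_simps)
    qed
    moreover have "(2 * real q - 1) / (real q - 1)\<^sup>2 \<le> 2 / (real q - 2)"
      using q5 by (simp add: divide_simps power2_eq_square) (simp add: algebra_simps)
    ultimately show "2 * f q + (f q)\<^sup>2 \<le> h q" by simp
  qed (use D in auto)
  also have "sqrt D * sqrt D = D" using D by simp
  finally have G: "ln (sqrt D) * ln T / W\<^sup>2 \<le> GS h P D" by (simp add: power2_eq_square)
  have Gpos: "ln (sqrt D) * ln T / W\<^sup>2 > 0" using lnT lnD W1 by simp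
  have N: "real N \<le> 3 * x / real m"
  proof -
    have "real N \<le> (x + real_of_int \<bar>a\<bar>) / real m + 1"
      unfolding N_def using x m0 by (simp add: of_nat_floor)
    also have "\<dots> \<le> (x + x) / real m + x / real m"
      using xa m m0 by (intro add_mono divide_right_mono) (auto simp: m_def[symmetric] simp del: of_nat_prod)
    finally show ?thesis by (simp add: add_divide_distrib[symmetric])
  qed
  have "real N / GS h P D \<le> (3 * x / real m) / (ln (sqrt D) * ln T / W\<^sup>2)"
    using N G Gpos by (intro frac_le) auto
  also have "\<dots> = 3 * x / real m * W\<^sup>2 / (ln (sqrt D) * ln T)" by simp
  finally have NG: "real N / GS h P D \<le> 3 * x / real m * W\<^sup>2 / (ln (sqrt D) * ln T)" .
  \<comment> \<open>A prime \<open>p \<le> D\<close> may itself be one of the sifting primes and be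
    removed by its own class. Such \<open>p\<close> are counted trivially, which is the summand
    \<open>D\<close>.\<close>
  have "card (sifted a x T S) \<le> card (primes_upto D \<union> {p\<in>sifted a x T S. D < real p})"
    by (intro card_mono) (auto simp: sifted_def intro: finite_subset[of _ "primes_upto x"])
  also have "\<dots> \<le> card (primes_upto D) + card {p\<in>sifted a x T S. D < real p}" by (rule card_Un_le)
  also have "card {p\<in>sifted a x T S. D < real p} \<le> card R"
  proof (rule card_inj_on_le)
    let ?g = "\<lambda>p. nat (int p + a) div m"
    have g: "int m * int (?g p) = int p + a" if "p \<in> sifted a x T S" for p
    proof -
      have "m dvd nat (int p + a)" "int p + a > 0" using that by (auto simp: sifted_def m_def)
      then have "m * ?g p = nat (int p + a)" by simp
      then have "int (m * ?g p) = int p + a" using \<open>int p + a > 0\<close> by simp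
      then show ?thesis by simp
    qed
    show "inj_on ?g {p\<in>sifted a x T S. D < real p}"
    proof (rule inj_onI)
      fix p p' assume "p \<in> {p\<in>sifted a x T S. D < real p}" "p' \<in> {p\<in>sifted a x T S. D < real p}"
      then have pp: "p \<in> sifted a x T S" "p' \<in> sifted a x T S" by blast+
      assume eq: "?g p = ?g p'"
      have "int p + a = int m * int (?g p)" by (rule g[OF pp(1), symmetric])
      also have "\<dots> = int m * int (?g p')" by (simp only: eq)
      also have "\<dots> = int p' + a" by (rule g[OF pp(2)])
      finally have "int p + a = int p' + a" .
      then show "p = p'" by linarith
    qed
    show "?g ` {p\<in>sifted a x T S. D < real p} \<subseteq> R"
    proof (rule image_subsetI)
      fix p assume p: "p \<in> {p\<in>sifted a x T S. D < real p}"
      then have ps: "p \<in> sifted a x T S" and pp: "prime p" "real p \<le> x" "D < real p" by (auto simp: sifted_def)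
      have "real m * real (?g p) = real_of_int (int p + a)"
        using arg_cong[OF g[OF ps], of real_of_int] by (simp only: of_int_mult of_int_of_nat_eq)
      also have "\<dots> \<le> x + real_of_int \<bar>a\<bar>" using pp by simp
      finally have "real (?g p) \<le> (x + real_of_int \<bar>a\<bar>) / real m" using m0 by (simp add: field_simps)
      then have "?g p < N" unfolding N_def by (simp add: le_nat_floor less_Suc_eq_le)
      moreover have "?g p mod q \<notin> \<Omega> q" if q: "q \<in> P" for q
      proof
        assume "?g p mod q \<in> \<Omega> q"
        then consider "?g p mod q = r0 q" | "real q \<le> T" "?g p mod q = 0" by (auto simp: \<Omega>_def B_def split: if_splits)
        then show False
        proof cases
          case 1
          have "int q dvd int (?g p) - int (r0 q)"
            using 1 by (metis mod_eq_dvd_iff of_nat_mod mod_mod_trivial)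
          then have "int q dvd int m * (int (?g p) - int (r0 q)) + (int m * int (r0 q) - a)"
            using r0(2)[OF q] by (intro dvd_add dvd_mult)
          also have "int m * (int (?g p) - int (r0 q)) + (int m * int (r0 q) - a) = int p"
            using g[OF ps] by (simp add: algebra_simps)
          finally have "q dvd p" by simp
          then have "q = p" using P(2)[OF q] pp(1) primes_dvd_imp_eq by blast
          then show False using q pp(3) by (auto simp: P_def)
        next
          case 2
          then have "int q dvd int m * int (?g p)" by (simp add: mod_eq_0_iff_dvd)
          then have "int q dvd int p + a" using g[OF ps] by simp
          moreover have "int p + a > 0" using ps by (auto simp: sifted_def)
          ultimately have "int q dvd int (nat (int p + a))" by simp
          then have "q dvd nat (int p + a)" by (simp only: int_dvd_int_iff)
          then have "q \<in> S" using ps 2(1) P(2)[OF q] by (auto simp: sifted_def)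
          then show False using q by (auto simp: P_def K_def)
        qed
      qed
      ultimately show "?g p \<in> R" by (simp add: R_def)
    qed
    show "finite R" by (rule finite_subset[of _ "{..<N}"]) (auto simp: R_def)
  qed
  finally have "real (card (sifted a x T S)) \<le> real (card (primes_upto D)) + real (card R)" by simp
  moreover have "real (card (primes_upto D)) \<le> D"
  proof -
    have "card (primes_upto D) \<le> card {1..nat \<lfloor>D\<rfloor>}"
      by (intro card_mono) (auto simp: le_nat_floor Suc_le_eq prime_gt_0_nat)
    then have "real (card (primes_upto D)) \<le> real (nat \<lfloor>D\<rfloor>)" by simp
    also have "\<dots> \<le> D" using D by (intro of_nat_floor) linarith
    finally show ?thesis .
  qed
  ultimately show ?thesis using sieve NG unfolding W_def f_def m_def by linarith
qed


text \<open>The choice \<open>D = x powr (1/20)\<close> makes \<open>D ^ 4\<close> a small power of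
  \<open>x\<close>, and \<open>sqrt D\<close> is then the ceiling for \<open>T\<close>. The squared
  correction for the primes of \<open>S\<close>, divided by \<open>\<Prod>S\<close>, has the factor
  \<open>q / (q - 1)\<^sup>2\<close> at \<open>q\<close>, which later becomes the odds of the
  model.\<close>

lemma card_sifted_le:
  fixes a :: int
  assumes a: "a \<noteq> 0"
  shows "\<exists>C>0. \<exists>X0. \<forall>x\<ge>X0. \<forall>T S. 2 \<le> T \<longrightarrow> T \<le> x powr (1/40) \<longrightarrow> finite S \<longrightarrow> (\<forall>q\<in>S. prime q) \<longrightarrow>
    real (\<Prod>S) \<le> sqrt x \<longrightarrow>
    real (card (sifted a x T S)) \<le> C * (x / (ln x * ln T)) * (\<Prod>q\<in>S. real q / (real q - 1)\<^sup>2)"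
proof -
  define g where "g = (\<lambda>q::nat. 1 + 1 / (real q - 1))"
  define K0 where "K0 = {2,3} \<union> prime_factors (nat \<bar>a\<bar>)"
  define W0 where "W0 = (\<Prod>q\<in>K0. g q)"
  have K0: "finite K0" "\<And>q. q \<in> K0 \<Longrightarrow> prime q" by (auto simp: K0_def)
  have g1: "g q \<ge> 1" if "prime q" for q using prime_ge_2_nat[OF that] by (simp add: g_def)
  have W0: "W0 \<ge> 1" unfolding W0_def using K0 g1 by (intro prod_ge_1) auto
  have "eventually (\<lambda>x::real. 3 * x powr (1/5) * (ln x)\<^sup>2 \<le> sqrt x) at_top"
    by real_asymp
  then have "eventually (\<lambda>x::real. 3 * x powr (1/5) * (ln x)\<^sup>2 \<le> sqrt x \<and> x \<ge> 3 \<and> x \<ge> real_of_int \<bar>a\<bar>) at_top"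
    using eventually_ge_at_top[of 3] eventually_ge_at_top[of "real_of_int \<bar>a\<bar>"]
    by eventually_elim auto
  then obtain X0 where X0: "\<And>x. x \<ge> X0 \<Longrightarrow> 3 * x powr (1/5) * (ln x)\<^sup>2 \<le> sqrt x \<and> x \<ge> 3 \<and> x \<ge> real_of_int \<bar>a\<bar>"
    unfolding eventually_at_top_linorder by blast
  \<comment> \<open>120 is 3 times the 40 coming from \<open>ln (sqrt D) = ln x / 40\<close>; the 1
    pays for the error \<open>D + 2 * D ^ 4\<close>.\<close>
  define C where "C = 120 * W0\<^sup>2 + 1"
  have Cpos: "C > 0" by (simp add: C_def add_nonneg_pos)
  show ?thesis
  proof (rule exI[of _ C], rule conjI[OF Cpos exI[of _ X0]], intro allI impI)
    fix x T :: real and S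
    assume "X0 \<le> x" and T: "2 \<le> T" "T \<le> x powr (1/40)" and S: "finite S" "\<forall>q\<in>S. prime q" and m: "real (\<Prod>S) \<le> sqrt x"
    note x = X0[OF \<open>X0 \<le> x\<close>]
    define w where "w = (\<Prod>q\<in>S. real q / (real q - 1)\<^sup>2)"
    have q2: "real q \<ge> 2" if "q \<in> S" for q using S that prime_ge_2_nat by force
    have m0: "real (\<Prod>S) > 0" using q2 unfolding of_nat_prod by (intro prod_pos) force
    have lnx: "ln x \<ge> 1" using x exp_le by (subst ln_ge_iff) auto
    have lnT: "ln T > 0" using T by simp
    have lnTx: "ln T \<le> ln x"
    proof -
      have "ln T \<le> ln (x powr (1/40))" using T by (subst ln_le_cancel_iff) auto
      then show ?thesis using lnx x by (simp add: ln_powr)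
    qed
    define D where "D = x powr (1/20)"
    have D1: "D \<ge> 1" using x by (simp add: D_def ge_one_powr_ge_zero)
    have sD: "sqrt D = x powr (1/40)" using x by (simp add: D_def powr_half_sqrt[symmetric] powr_powr)
    have D4: "D ^ 4 = x powr (1/5)" using x by (simp add: D_def powr_power)
    have sqx: "sqrt x \<le> x"
    proof -
      have "sqrt x * 1 \<le> sqrt x * sqrt x" using x by (intro mult_left_mono) auto
      then show ?thesis using x by simp
    qed
    have w1: "w \<ge> 1 / real (\<Prod>S)"
    proof -
      have "(\<Prod>q\<in>S. 1 / real q) \<le> w" unfolding w_def
      proof (intro prod_mono conjI)
        fix q assume "q \<in> S"
        then have "real q \<ge> 2" by (rule q2)
        then show "1 / real q \<le> real q / (real q - 1)\<^sup>2"
          by (simp add: divide_simps power2_eq_square) (simp add: algebra_simps)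
      qed auto
      then show ?thesis by (simp add: prod_dividef)
    qed
    have w0: "w > 0" using w1 m0 by (meson divide_pos_pos less_le_trans zero_less_one)
    have "real (card (sifted a x T S)) \<le> D + 2 * D ^ 4 +
      3 * x / real (\<Prod>S) * (\<Prod>q\<in>{2,3} \<union> prime_factors (nat \<bar>a\<bar>) \<union> S. 1 + 1 / (real q - 1))\<^sup>2 / (ln (sqrt D) * ln T)"
      using a T S x D1 sD m sqx by (intro card_sifted_le_aux) auto
    also have "(\<Prod>q\<in>{2,3} \<union> prime_factors (nat \<bar>a\<bar>) \<union> S. 1 + 1 / (real q - 1)) = (\<Prod>q\<in>K0 \<union> S. g q)"
      by (simp add: K0_def g_def)
    also have "ln (sqrt D) = ln x / 40" using x by (simp add: sD ln_powr)
    finally have 1: "real (card (sifted a x T S)) \<le> D + 2 * D ^ 4 + 3 * x / real (\<Prod>S) * (\<Prod>q\<in>K0 \<union> S. g q)\<^sup>2 / (ln x / 40 * ln T)" .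
    have "(\<Prod>q\<in>K0 \<union> S. g q) \<le> W0 * (\<Prod>q\<in>S. g q)"
    proof -
      have "(\<Prod>q\<in>K0 \<union> S. g q) * 1 \<le> (\<Prod>q\<in>K0 \<union> S. g q) * (\<Prod>q\<in>K0 \<inter> S. g q)"
        using K0 S g1 by (intro mult_left_mono prod_ge_1 prod_nonneg) (auto intro: order_trans[OF zero_le_one])
      also have "\<dots> = W0 * (\<Prod>q\<in>S. g q)" unfolding W0_def using K0 S by (simp add: prod.union_inter)
      finally show ?thesis by simp
    qed
    then have "(\<Prod>q\<in>K0 \<union> S. g q)\<^sup>2 \<le> (W0 * (\<Prod>q\<in>S. g q))\<^sup>2"
      using K0 S g1 by (intro power_mono prod_nonneg) (auto intro: order_trans[OF zero_le_one])
    then have "(\<Prod>q\<in>K0 \<union> S. g q)\<^sup>2 / real (\<Prod>S) \<le> (W0 * (\<Prod>q\<in>S. g q))\<^sup>2 / real (\<Prod>S)"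
      using m0 by (intro divide_right_mono) auto
    also have "\<dots> = W0\<^sup>2 * ((\<Prod>q\<in>S. g q)\<^sup>2 / real (\<Prod>S))" by (simp add: power_mult_distrib del: of_nat_prod)
    also have "(\<Prod>q\<in>S. g q)\<^sup>2 / real (\<Prod>S) = (\<Prod>q\<in>S. (g q)\<^sup>2 / real q)" by (simp add: prod_dividef prod_power_distrib)
    also have "\<dots> = w" unfolding w_def
    proof (intro prod.cong refl)
      fix q assume "q \<in> S"
      then have q: "real q \<ge> 2" by (rule q2)
      then have "g q = real q / (real q - 1)" by (simp add: g_def field_simps)
      then show "(g q)\<^sup>2 / real q = real q / (real q - 1)\<^sup>2" using q by (simp add: power_divide power2_eq_square)
    qed
    finally have 2: "(\<Prod>q\<in>K0 \<union> S. g q)\<^sup>2 / real (\<Prod>S) \<le> W0\<^sup>2 * w" .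
    have "3 * x / real (\<Prod>S) * (\<Prod>q\<in>K0 \<union> S. g q)\<^sup>2 / (ln x / 40 * ln T) = 120 * (x / (ln x * ln T)) * ((\<Prod>q\<in>K0 \<union> S. g q)\<^sup>2 / real (\<Prod>S))"
      by (simp add: mult_ac del: of_nat_prod)
    also have "\<dots> \<le> 120 * (x / (ln x * ln T)) * (W0\<^sup>2 * w)"
      using 2 x lnx lnT by (intro mult_left_mono) auto
    finally have 3: "3 * x / real (\<Prod>S) * (\<Prod>q\<in>K0 \<union> S. g q)\<^sup>2 / (ln x / 40 * ln T) \<le> 120 * (x / (ln x * ln T)) * (W0\<^sup>2 * w)" .
    \<comment> \<open>The additive sieve error is absorbed into the main term:
      \<open>\<Prod>S \<le> sqrt x\<close> keeps the weight \<open>w\<close> above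
      \<open>1 / sqrt x\<close>.\<close>
    have "D \<le> D ^ 4" using D1 power_increasing[of 1 4 D] by simp
    then have "D + 2 * D ^ 4 \<le> 3 * x powr (1/5)" unfolding D4 by simp
    also have "\<dots> \<le> sqrt x / (ln x)\<^sup>2" using x lnx by (simp add: pos_le_divide_eq)
    also have "\<dots> = x / (ln x)\<^sup>2 * (1 / sqrt x)" using x by (simp add: real_div_sqrt field_simps)
    also have "\<dots> \<le> x / (ln x * ln T) * w"
    proof (intro mult_mono divide_left_mono)
      show "ln x * ln T \<le> (ln x)\<^sup>2" unfolding power2_eq_square using lnTx lnx by (intro mult_left_mono) auto
      have "1 / sqrt x \<le> 1 / real (\<Prod>S)" using m m0 x by (intro divide_left_mono mult_pos_pos) auto
      then show "1 / sqrt x \<le> w" using w1 by linarith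
    qed (use x lnx lnT w0 in auto)
    finally have "real (card (sifted a x T S)) \<le> x / (ln x * ln T) * w + 120 * (x / (ln x * ln T)) * (W0\<^sup>2 * w)"
      using 1 3 by linarith
    also have "\<dots> = C * (x / (ln x * ln T)) * w" by (simp add: C_def algebra_simps)
    finally show "real (card (sifted a x T S)) \<le> C * (x / (ln x * ln T)) * (\<Prod>q\<in>S. real q / (real q - 1)\<^sup>2)"
      by (simp add: w_def)
  qed
qed

section \<open>Independent Bernoulli variables\<close>

text \<open>Expectation under the product measure in which each \<open>q\<close> enters the random
  set independently with probability \<open>p q\<close>. As a finite sum over subsets it satisfies
  its algebraic identities for arbitrary real \<open>p\<close>.\<close>

definition bexp :: "('a \<Rightarrow> real) \<Rightarrow> 'a set \<Rightarrow> ('a set \<Rightarrow> real) \<Rightarrow> real" where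
  "bexp p A f = (\<Sum>S\<in>Pow A. (\<Prod>q\<in>S. p q) * (\<Prod>q\<in>A - S. 1 - p q) * f S)"

definition bprob :: "('a \<Rightarrow> real) \<Rightarrow> 'a set \<Rightarrow> ('a set \<Rightarrow> bool) \<Rightarrow> real" where
  "bprob p A X = bexp p A (\<lambda>S. of_bool (X S))"

lemma bexp_empty [simp]: "bexp p {} f = f {}"
  by (simp add: bexp_def)

lemma bexp_cong: "(\<And>S. S \<subseteq> A \<Longrightarrow> f S = g S) \<Longrightarrow> bexp p A f = bexp p A g"
  unfolding bexp_def by (intro sum.cong) auto

text \<open>Conditioning on whether \<open>a\<close> is drawn. The inductions for moments, tilting
  and the maximal inequality all run through this recursion.\<close>

lemma bexp_insert:
  assumes "finite A" "a \<notin> A"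
  shows "bexp p (insert a A) f = p a * bexp p A (\<lambda>S. f (insert a S)) + (1 - p a) * bexp p A f"
proof -
  let ?w = "\<lambda>B S. (\<Prod>q\<in>S. p q) * (\<Prod>q\<in>B - S. 1 - p q)"
  have 1: "?w (insert a A) (insert a S) = p a * ?w A S" if "S \<subseteq> A" for S
  proof -
    have "insert a A - insert a S = A - S" using assms by auto
    moreover have "a \<notin> S" "finite S" using that assms by (auto intro: finite_subset)
    ultimately show ?thesis by simp
  qed
  have 2: "?w (insert a A) S = (1 - p a) * ?w A S" if "S \<subseteq> A" for S
  proof -
    have "insert a A - S = insert a (A - S)" using assms that by auto
    then show ?thesis using assms by simp
  qed
  have "bexp p (insert a A) f = (\<Sum>S\<in>Pow A. ?w (insert a A) S * f S) + (\<Sum>S\<in>insert a ` Pow A. ?w (insert a A) S * f S)"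
    unfolding bexp_def Pow_insert using assms by (intro sum.union_disjoint) auto
  also have "(\<Sum>S\<in>insert a ` Pow A. ?w (insert a A) S * f S) = (\<Sum>S\<in>Pow A. ?w (insert a A) (insert a S) * f (insert a S))"
    using assms by (subst sum.reindex) (auto simp: inj_on_def)
  also have "\<dots> = p a * bexp p A (\<lambda>S. f (insert a S))"
    unfolding bexp_def sum_distrib_left using 1 by (intro sum.cong) auto
  also have "(\<Sum>S\<in>Pow A. ?w (insert a A) S * f S) = (1 - p a) * bexp p A f"
    unfolding bexp_def sum_distrib_left using 2 by (intro sum.cong) auto
  finally show ?thesis by simp
qed

lemma bexp_add: "bexp p A (\<lambda>S. f S + g S) = bexp p A f + bexp p A g"
  by (simp add: bexp_def distrib_left sum.distrib)

lemma bexp_multc: "bexp p A (\<lambda>S. f S * c) = bexp p A f * c"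
  by (simp add: bexp_def sum_distrib_right mult.assoc)

lemma bexp_cmult: "bexp p A (\<lambda>S. c * f S) = c * bexp p A f"
  using bexp_multc[of p A f c] by (simp only: mult.commute)

lemma bexp_const:
  assumes "finite A"
  shows "bexp p A (\<lambda>_. c) = c"
proof -
  have "bexp p A (\<lambda>_. c) = (\<Prod>q\<in>A. p q + (1 - p q)) * c"
    using assms by (simp only: prod_add bexp_def sum_distrib_right)
  then show ?thesis by simp
qed

lemma bexp_mono:
  assumes "\<And>q. q \<in> A \<Longrightarrow> 0 \<le> p q \<and> p q \<le> 1" "\<And>S. S \<subseteq> A \<Longrightarrow> f S \<le> g S"
  shows "bexp p A f \<le> bexp p A g"
  unfolding bexp_def using assms
  by (intro sum_mono mult_left_mono mult_nonneg_nonneg prod_nonneg) auto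

lemma bexp_union:
  assumes "finite A" "finite B" "A \<inter> B = {}"
  shows "bexp p (A \<union> B) f = bexp p A (\<lambda>S. bexp p B (\<lambda>R. f (S \<union> R)))"
  using assms
proof (induction A arbitrary: f rule: finite_induct)
  case (insert a A)
  have "bexp p (insert a A \<union> B) f = p a * bexp p (A \<union> B) (\<lambda>S. f (insert a S)) + (1 - p a) * bexp p (A \<union> B) f"
    using insert by (subst bexp_insert[symmetric]) auto
  then show ?case using insert by (simp add: bexp_insert)
qed auto

lemma bprob_nonneg: "(\<And>q. q \<in> A \<Longrightarrow> 0 \<le> p q \<and> p q \<le> 1) \<Longrightarrow> 0 \<le> bprob p A X"
  unfolding bprob_def bexp_def
  by (intro sum_nonneg mult_nonneg_nonneg prod_nonneg) auto

lemma bprob_mono: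
  assumes "\<And>q. q \<in> A \<Longrightarrow> 0 \<le> p q \<and> p q \<le> 1" "\<And>S. S \<subseteq> A \<Longrightarrow> X S \<Longrightarrow> Y S"
  shows "bprob p A X \<le> bprob p A Y"
  unfolding bprob_def using assms by (intro bexp_mono) auto

lemma bprob_le_1:
  assumes "finite A" "\<And>q. q \<in> A \<Longrightarrow> 0 \<le> p q \<and> p q \<le> 1"
  shows "bprob p A X \<le> 1"
proof -
  have "bprob p A X \<le> bexp p A (\<lambda>_. 1)" unfolding bprob_def using assms by (intro bexp_mono) auto
  then show ?thesis using assms by (simp add: bexp_const)
qed

lemma bprob_not:
  assumes "finite A"
  shows "bprob p A (\<lambda>S. \<not> X S) = 1 - bprob p A X"
proof -
  have "bprob p A (\<lambda>S. \<not> X S) + bprob p A X = bexp p A (\<lambda>S. 1)"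
    unfolding bprob_def bexp_add[symmetric] by (intro bexp_cong) auto
  then show ?thesis using assms by (simp add: bexp_const)
qed

lemma bprob_disj:
  assumes "\<And>q. q \<in> A \<Longrightarrow> 0 \<le> p q \<and> p q \<le> 1"
  shows "bprob p A (\<lambda>S. X S \<or> Y S) \<le> bprob p A X + bprob p A Y"
  unfolding bprob_def bexp_add[symmetric] using assms by (intro bexp_mono) auto

lemma bprob_bex:
  assumes "finite K" "\<And>q. q \<in> A \<Longrightarrow> 0 \<le> p q \<and> p q \<le> 1"
  shows "bprob p A (\<lambda>S. \<exists>k\<in>K. X k S) \<le> (\<Sum>k\<in>K. bprob p A (X k))"
  using assms(1)
proof (induction K rule: finite_induct)
  case empty
  then show ?case by (simp add: bprob_def bexp_def)
next
  case (insert k K)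
  have "bprob p A (\<lambda>S. \<exists>k\<in>insert k K. X k S) \<le> bprob p A (\<lambda>S. X k S \<or> (\<exists>k\<in>K. X k S))"
    using assms(2) by (intro bprob_mono) auto
  also have "\<dots> \<le> bprob p A (X k) + bprob p A (\<lambda>S. \<exists>k\<in>K. X k S)"
    by (rule bprob_disj[OF assms(2)])
  finally show ?case using insert by simp
qed

lemma bprob_indep:
  assumes "finite A" "finite B" "A \<inter> B = {}"
  shows "bprob p (A \<union> B) (\<lambda>S. X (S \<inter> A) \<and> Y (S \<inter> B)) = bprob p A X * bprob p B Y"
proof -
  have "bprob p (A \<union> B) (\<lambda>S. X (S \<inter> A) \<and> Y (S \<inter> B)) =
      bexp p A (\<lambda>S. bexp p B (\<lambda>R. of_bool (X ((S \<union> R) \<inter> A) \<and> Y ((S \<union> R) \<inter> B))))"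
    unfolding bprob_def by (rule bexp_union[OF assms])
  also have "\<dots> = bexp p A (\<lambda>S. bexp p B (\<lambda>R. of_bool (X S) * of_bool (Y R)))"
  proof (intro bexp_cong)
    fix S R assume "S \<subseteq> A" "R \<subseteq> B"
    then have "(S \<union> R) \<inter> A = S" "(S \<union> R) \<inter> B = R" using assms(3) by auto
    then show "of_bool (X ((S \<union> R) \<inter> A) \<and> Y ((S \<union> R) \<inter> B)) = (of_bool (X S) * of_bool (Y R) :: real)" by simp
  qed
  also have "\<dots> = bprob p A X * bprob p B Y"
    by (simp only: bexp_cmult bexp_multc bprob_def)
  finally show ?thesis .
qed

lemma bprob_restrict:
  assumes "finite C" "A \<subseteq> C"
  shows "bprob p C (\<lambda>S. X (S \<inter> A)) = bprob p A X"
proof -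
  have "A \<union> (C - A) = C" using assms by auto
  then show ?thesis
    using bprob_indep[of A "C - A" p X "\<lambda>_. True"] assms finite_subset[OF assms(2,1)]
    by (simp add: bprob_def bexp_const)
qed

lemma bprob_indep_family:
  assumes "finite K" "\<And>k. k \<in> K \<Longrightarrow> finite (B k)" "disjoint_family_on B K"
  shows "bprob p (\<Union>k\<in>K. B k) (\<lambda>S. \<forall>k\<in>K. X k (S \<inter> B k)) = (\<Prod>k\<in>K. bprob p (B k) (X k))"
  using assms
proof (induction K rule: finite_induct)
  case empty
  then show ?case by (simp add: bprob_def)
next
  case (insert k K)
  let ?U = "\<Union>k\<in>K. B k"
  have "B k \<inter> ?U = {}" using insert by (auto simp: disjoint_family_on_def)
  moreover have "(S \<inter> ?U) \<inter> B j = S \<inter> B j" if "j \<in> K" for S j using that by auto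
  ultimately have "bprob p (B k \<union> ?U) (\<lambda>S. X k (S \<inter> B k) \<and> (\<forall>j\<in>K. X j (S \<inter> B j))) =
      bprob p (B k) (X k) * bprob p ?U (\<lambda>S. \<forall>j\<in>K. X j (S \<inter> B j))"
    using bprob_indep[of "B k" ?U p "X k" "\<lambda>S. \<forall>j\<in>K. X j (S \<inter> B j)"] insert by simp
  moreover have "disjoint_family_on B K" using insert by (auto simp: disjoint_family_on_def)
  ultimately show ?case using insert by simp
qed

section \<open>Upper and lower tail estimates\<close>

lemma exp_cubic_approx:
  fixes x :: real
  assumes "\<bar>x\<bar> \<le> 1 / 2"
  shows "\<bar>exp x - 1 - x - x\<^sup>2 / 2\<bar> \<le> \<bar>x\<bar> ^ 3"
proof -
  obtain t where t: "\<bar>t\<bar> \<le> \<bar>x\<bar>" "exp x = (\<Sum>m<3. x ^ m / fact m) + exp t / fact 3 * x ^ 3"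
    using Maclaurin_exp_le[of x 3] by blast
  have "exp x - 1 - x - x\<^sup>2 / 2 = exp t / 6 * x ^ 3"
    using t(2) by (simp add: numeral_eq_Suc)
  moreover have "exp t / 6 \<le> 1"
  proof -
    have "exp t \<le> exp 1" using t assms by simp
    then show ?thesis using exp_le by linarith
  qed
  moreover have "\<bar>exp t / 6 * x ^ 3\<bar> = exp t / 6 * \<bar>x\<bar> ^ 3" by (simp add: abs_mult power_abs)
  ultimately show ?thesis using mult_right_mono[of "exp t / 6" 1 "\<bar>x\<bar> ^ 3"] by simp
qed

definition cnt :: "nat set \<Rightarrow> real \<Rightarrow> real" where
  "cnt S t = real (card {q\<in>S. real q \<le> t})"

definition mass :: "(nat \<Rightarrow> real) \<Rightarrow> nat set \<Rightarrow> real \<Rightarrow> real" where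
  "mass p A t = (\<Sum>q | q \<in> A \<and> real q \<le> t. p q)"

text \<open>
  Ville's inequality for the exponential supermartingale, by induction on the first element:
  conditioning on it shifts the threshold \<open>b\<close>.
\<close>
lemma bernoulli_maximal:
  fixes A :: "nat set" and l b :: real
  assumes "finite A" "\<And>q. q \<in> A \<Longrightarrow> 0 \<le> p q \<and> p q \<le> 1"
  shows "bprob p A (\<lambda>S. \<exists>t. l * cnt S t - (exp l - 1) * mass p A t \<ge> b) \<le> exp (- b)"
  using assms
proof (induction A arbitrary: b rule: finite_linorder_min_induct)
  case empty
  show ?case by (cases "b \<le> 0") (auto simp: bprob_def cnt_def mass_def)
next
  case (insert a A)
  have aA: "a \<notin> A" using insert by auto
  have p: "0 \<le> p q" "p q \<le> 1" if "q \<in> insert a A" for q using that insert.prems by auto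
  show ?case
  proof (cases "b \<le> 0")
    case True
    then show ?thesis
      using bprob_le_1[of "insert a A" p] insert.hyps insert.prems by (smt (verit) finite_insert one_le_exp_iff)
  next
    \<comment> \<open>For \<open>b > 0\<close> no \<open>t\<close> before \<open>a\<close> can reach
      the threshold, since count and mass both vanish there. Hence \<open>a\<close> is already
      accounted for whenever the event occurs.\<close>
    case False
    let ?\<kappa> = "exp l - 1"
    define X where "X = (\<lambda>b S. \<exists>t. l * cnt S t - ?\<kappa> * mass p A t \<ge> b)"
    define Y where "Y = (\<lambda>S. \<exists>t. l * cnt S t - ?\<kappa> * mass p (insert a A) t \<ge> b)"
    have small: "{q\<in>S. real q \<le> t} = {}" if "S \<subseteq> insert a A" "t < real a" for S t
      using that insert.hyps by fastforce
    have c0: "cnt S t = 0" if "S \<subseteq> insert a A" "t < real a" for S t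
      using small[OF that] by (simp only: cnt_def card.empty of_nat_0)
    have m: "mass p (insert a A) t = p a + mass p A t" if "real a \<le> t" for t
    proof -
      have "{q. q \<in> insert a A \<and> real q \<le> t} = insert a {q. q \<in> A \<and> real q \<le> t}" using that by auto
      then show ?thesis using insert.hyps aA by (simp add: mass_def)
    qed
    have m0: "mass p (insert a A) t = 0" if "t < real a" for t
      using small[of "insert a A" t, OF subset_refl that] by (simp only: mass_def sum.empty)
    have Y1: "X (b - l + ?\<kappa> * p a) S" if SA: "S \<subseteq> A" and YS: "Y (insert a S)" for S
    proof -
      obtain t where t: "l * cnt (insert a S) t - ?\<kappa> * mass p (insert a A) t \<ge> b" using YS by (auto simp: Y_def)
      have fS: "finite S" using SA insert.hyps finite_subset by blast
      have at: "real a \<le> t"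
      proof (rule ccontr)
        assume "\<not> real a \<le> t"
        then show False using t c0[OF insert_mono[OF SA], of t] m0[of t] False by (auto simp: not_le)
      qed
      then have "{q \<in> insert a S. real q \<le> t} = insert a {q \<in> S. real q \<le> t}" by auto
      moreover have "a \<notin> S" using aA SA by auto
      ultimately have "cnt (insert a S) t = 1 + cnt S t" using fS by (simp add: cnt_def)
      then show ?thesis using t m[OF at] unfolding X_def
        by (intro exI[of _ t]) (simp add: algebra_simps)
    qed
    have Y0: "X (b + ?\<kappa> * p a) S" if SA: "S \<subseteq> A" and YS: "Y S" for S
    proof -
      obtain t where t: "l * cnt S t - ?\<kappa> * mass p (insert a A) t \<ge> b" using YS by (auto simp: Y_def)
      have at: "real a \<le> t"
      proof (rule ccontr)
        assume "\<not> real a \<le> t"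
        then show False using t c0[OF subset_insertI2[OF SA], of t] m0[of t] False by (auto simp: not_le)
      qed
      then show ?thesis using t m[OF at] unfolding X_def
        by (intro exI[of _ t]) (simp add: algebra_simps)
    qed
    have IH: "bprob p A (X b) \<le> exp (- b)" for b
      unfolding X_def using insert.prems by (intro insert.IH) auto
    have "bprob p (insert a A) Y = p a * bprob p A (\<lambda>S. Y (insert a S)) + (1 - p a) * bprob p A Y"
      unfolding bprob_def using insert.hyps aA by (intro bexp_insert)
    also have "\<dots> \<le> p a * exp (- (b - l + ?\<kappa> * p a)) + (1 - p a) * exp (- (b + ?\<kappa> * p a))"
    proof (intro add_mono mult_left_mono)
      show "bprob p A (\<lambda>S. Y (insert a S)) \<le> exp (- (b - l + ?\<kappa> * p a))"
        using p Y1 by (intro order_trans[OF bprob_mono IH]) auto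
      show "bprob p A Y \<le> exp (- (b + ?\<kappa> * p a))"
        using p Y0 by (intro order_trans[OF bprob_mono IH]) auto
    qed (use p in auto)
    \<comment> \<open>\<open>1 + ?\<kappa> * p a\<close> is the moment generating function of the
      variable at \<open>a\<close>; that it is at most \<open>exp (?\<kappa> * p a)\<close> is the
      supermartingale property.\<close>
    also have "\<dots> = exp (- b) * (exp (- (?\<kappa> * p a)) * (1 + ?\<kappa> * p a))"
      by (simp add: exp_add exp_diff exp_minus field_simps)
    also have "exp (- (?\<kappa> * p a)) * (1 + ?\<kappa> * p a) \<le> exp (- (?\<kappa> * p a)) * exp (?\<kappa> * p a)"
      by (intro mult_left_mono exp_ge_add_one_self) auto
    also have "\<dots> = 1" by (simp flip: exp_add)
    finally show ?thesis by (simp add: Y_def)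
  qed
qed

lemma bexp_card:
  assumes "finite A"
  shows "bexp p A (\<lambda>S. real (card S)) = (\<Sum>q\<in>A. p q)"
  using assms
proof (induction A rule: finite_induct)
  case (insert a A)
  have "bexp p A (\<lambda>S. real (card (insert a S))) = bexp p A (\<lambda>S. real (card S) + 1)"
  proof (rule bexp_cong)
    fix S assume "S \<subseteq> A"
    then have "a \<notin> S" "finite S" using insert.hyps by (auto intro: finite_subset)
    then show "real (card (insert a S)) = real (card S) + 1" by simp
  qed
  then show ?case using insert by (simp add: bexp_insert bexp_add bexp_const algebra_simps)
qed auto

lemma bexp_variance:
  fixes p :: "'a \<Rightarrow> real"
  assumes "finite A"
  shows "bexp p A (\<lambda>S. (real (card S) - (\<Sum>q\<in>A. p q))\<^sup>2) = (\<Sum>q\<in>A. p q * (1 - p q))"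
  using assms
proof (induction A rule: finite_induct)
  case (insert a A)
  define \<mu> where "\<mu> = (\<Sum>q\<in>A. p q)"
  define d where "d = (\<lambda>S :: 'a set. real (card S) - \<mu>)"
  have "bexp p A (\<lambda>S. d S + \<mu>) = \<mu>" using bexp_card[OF insert.hyps(1), of p] by (simp add: d_def \<mu>_def)
  then have d0: "bexp p A d = 0" using bexp_const[OF insert.hyps(1)] by (simp add: bexp_add)
  have shift: "bexp p A (\<lambda>S. (d S + c)\<^sup>2) = bexp p A (\<lambda>S. (d S)\<^sup>2) + c\<^sup>2" for c
  proof -
    have "bexp p A (\<lambda>S. (d S + c)\<^sup>2) = bexp p A (\<lambda>S. (d S)\<^sup>2 + ((2 * c) * d S + c\<^sup>2))"
      by (intro bexp_cong) (simp add: power2_sum)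
    also have "\<dots> = bexp p A (\<lambda>S. (d S)\<^sup>2) + c\<^sup>2"
      by (simp only: bexp_add bexp_cmult bexp_const[OF insert.hyps(1)] d0 mult_zero_right add_0_left)
    finally show ?thesis .
  qed
  have "bexp p A (\<lambda>S. (real (card (insert a S)) - (\<Sum>q\<in>insert a A. p q))\<^sup>2) = bexp p A (\<lambda>S. (d S + (1 - p a))\<^sup>2)"
  proof (rule bexp_cong)
    fix S assume "S \<subseteq> A"
    then have "a \<notin> S" "finite S" using insert.hyps by (auto intro: finite_subset)
    then show "(real (card (insert a S)) - (\<Sum>q\<in>insert a A. p q))\<^sup>2 = (d S + (1 - p a))\<^sup>2"
      using insert.hyps by (simp add: d_def \<mu>_def algebra_simps)
  qed
  moreover have "bexp p A (\<lambda>S. (real (card S) - (\<Sum>q\<in>insert a A. p q))\<^sup>2) = bexp p A (\<lambda>S. (d S + (- p a))\<^sup>2)"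
    using insert.hyps by (intro bexp_cong) (simp add: d_def \<mu>_def algebra_simps)
  moreover have "bexp p A (\<lambda>S. (d S)\<^sup>2) = (\<Sum>q\<in>A. p q * (1 - p q))" using insert.IH by (simp add: d_def \<mu>_def)
  ultimately have "bexp p (insert a A) (\<lambda>S. (real (card S) - (\<Sum>q\<in>insert a A. p q))\<^sup>2)
      = p a * ((\<Sum>q\<in>A. p q * (1 - p q)) + (1 - p a)\<^sup>2) + (1 - p a) * ((\<Sum>q\<in>A. p q * (1 - p q)) + (- p a)\<^sup>2)"
    by (simp only: bexp_insert[OF insert.hyps] shift)
  also have "\<dots> = p a * (1 - p a) + (\<Sum>q\<in>A. p q * (1 - p q))"
    by (simp add: power2_eq_square algebra_simps)
  finally show ?case using insert.hyps by simp
qed auto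

text \<open>The variance is at most the mean, so leaving a window of twice the root of the mean has
  probability at most 1/4.\<close>

lemma bernoulli_chebyshev:
  assumes "finite A" "\<And>q. q \<in> A \<Longrightarrow> 0 \<le> p q \<and> p q \<le> 1" "(\<Sum>q\<in>A. p q) > 0"
  shows "bprob p A (\<lambda>S. \<bar>real (card S) - (\<Sum>q\<in>A. p q)\<bar> \<le> 2 * sqrt (\<Sum>q\<in>A. p q)) \<ge> 3 / 4"
proof -
  define \<mu> where "\<mu> = (\<Sum>q\<in>A. p q)"
  have \<mu>: "\<mu> > 0" using assms by (simp add: \<mu>_def)
  have "bprob p A (\<lambda>S. \<not> \<bar>real (card S) - \<mu>\<bar> \<le> 2 * sqrt \<mu>) \<le> bexp p A (\<lambda>S. (real (card S) - \<mu>)\<^sup>2 * (1 / (4 * \<mu>)))"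
    unfolding bprob_def
  proof (intro bexp_mono assms)
    fix S
    show "of_bool (\<not> \<bar>real (card S) - \<mu>\<bar> \<le> 2 * sqrt \<mu>) \<le> (real (card S) - \<mu>)\<^sup>2 * (1 / (4 * \<mu>))"
    proof (cases "\<bar>real (card S) - \<mu>\<bar> \<le> 2 * sqrt \<mu>")
      case False
      then have "(2 * sqrt \<mu>)\<^sup>2 \<le> \<bar>real (card S) - \<mu>\<bar>\<^sup>2" using \<mu> by (intro power_mono) auto
      then show ?thesis using \<mu> False by (simp add: power_mult_distrib)
    qed (use \<mu> in auto)
  qed
  also have "\<dots> = (\<Sum>q\<in>A. p q * (1 - p q)) * (1 / (4 * \<mu>))"
    unfolding bexp_multc \<mu>_def bexp_variance[OF assms(1)] by simp
  also have "\<dots> \<le> \<mu> * (1 / (4 * \<mu>))"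
  proof (rule mult_right_mono)
    show "(\<Sum>q\<in>A. p q * (1 - p q)) \<le> \<mu>"
      unfolding \<mu>_def using assms(2) by (intro sum_mono) (simp add: mult_left_le)
  qed (use \<mu> in auto)
  also have "\<dots> = 1 / 4" using \<mu> by simp
  finally show ?thesis unfolding bprob_not[OF assms(1)] \<mu>_def by simp
qed

text \<open>Exponential change of measure: the tilted law multiplies the odds of every
  \<open>q\<close> by \<open>exp l\<close>, and the leading product is the moment generating
  function of the count at \<open>l\<close>.\<close>

lemma bexp_tilt:
  assumes "finite A" "\<And>q. q \<in> A \<Longrightarrow> 1 + p q * (exp l - 1) > 0"
  shows "bexp p A f = (\<Prod>q\<in>A. 1 + p q * (exp l - 1)) *
           bexp (\<lambda>q. p q * exp l / (1 + p q * (exp l - 1))) A (\<lambda>S. f S * exp (- l * real (card S)))"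
  using assms
proof (induction A arbitrary: f rule: finite_induct)
  case (insert a A)
  let ?p' = "\<lambda>q. p q * exp l / (1 + p q * (exp l - 1))"
  let ?Z = "\<Prod>q\<in>A. 1 + p q * (exp l - 1)" and ?z = "1 + p a * (exp l - 1)"
  have z: "?z > 0" using insert.prems by auto
  have 1: "bexp ?p' A (\<lambda>S. f (insert a S) * exp (- l * real (card (insert a S)))) =
        bexp ?p' A (\<lambda>S. f (insert a S) * exp (- l * real (card S))) * exp (- l)"
    unfolding bexp_multc[symmetric]
  proof (rule bexp_cong)
    fix S assume "S \<subseteq> A"
    then have "a \<notin> S" "finite S" using insert.hyps by (auto intro: finite_subset)
    then show "f (insert a S) * exp (- l * real (card (insert a S))) = f (insert a S) * exp (- l * real (card S)) * exp (- l)"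
      by (simp add: algebra_simps flip: exp_add)
  qed
  have "?z * ?p' a = p a * exp l" using z by simp
  then have 2: "?z * ?p' a * exp (- l) = p a" "?z * (1 - ?p' a) = 1 - p a"
    by (simp_all add: exp_minus right_diff_distrib)
  have "?z * ?Z * bexp ?p' (insert a A) (\<lambda>S. f S * exp (- l * real (card S))) =
     (?z * ?p' a * exp (- l)) * (?Z * bexp ?p' A (\<lambda>S. f (insert a S) * exp (- l * real (card S))))
     + (?z * (1 - ?p' a)) * (?Z * bexp ?p' A (\<lambda>S. f S * exp (- l * real (card S))))"
    unfolding bexp_insert[OF insert.hyps] 1 by (simp only: distrib_left mult_ac)
  also have "\<dots> = p a * bexp p A (\<lambda>S. f (insert a S)) + (1 - p a) * bexp p A f"
    unfolding 2 using insert.IH[of "\<lambda>S. f (insert a S)"] insert.IH[of f] insert.prems by simp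
  finally show ?case using insert.hyps by (simp add: bexp_insert)
qed auto

lemma ln_one_plus_lower:
  assumes "x \<ge> - (1 / 2)" "x \<le> (1::real)"
  shows "ln (1 + x) \<ge> x - 2 * x\<^sup>2"
proof (cases "x \<ge> 0")
  case True
  then show ?thesis using ln_one_plus_pos_lower_bound[of x] assms by (simp add: order_trans[rotated])
next
  case False
  then show ?thesis using ln_one_minus_pos_lower_bound[of "- x"] assms by simp
qed

text \<open>
  Cramer tilting: under the tilted law the count concentrates at the required deviation, and
  the likelihood ratio is bounded below on the Chebyshev window.
\<close>
lemma bernoulli_lower_tail:
  fixes p :: "nat \<Rightarrow> real" and l V :: real
  assumes A: "finite A" "\<And>q. q \<in> A \<Longrightarrow> 0 \<le> p q \<and> p q \<le> 1"
    and V: "(\<Sum>q\<in>A. (p q)\<^sup>2) \<le> V" and l: "\<bar>l\<bar> \<le> 1 / 2" "l \<noteq> 0"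
  defines "\<mu> \<equiv> (\<Sum>q\<in>A. p q)"
  assumes \<mu>: "\<mu> > 0" "\<mu> \<ge> 4 * V"
  shows "bprob p A (\<lambda>S. sgn l * (real (card S) - \<mu>) \<ge> (\<bar>l\<bar> - l\<^sup>2) * (\<mu> - 4 * V) - 4 * sqrt \<mu>)
       \<ge> 3 / 4 * exp (- \<mu> * (l\<^sup>2 / 2 + 2 * \<bar>l\<bar> ^ 3) - 16 * l\<^sup>2 * V - 4 * \<bar>l\<bar> * sqrt \<mu>)"
proof -
  define \<kappa> where "\<kappa> = exp l - 1"
  define p' where "p' = (\<lambda>q. p q * exp l / (1 + p q * (exp l - 1)))"
  define \<mu>' where "\<mu>' = (\<Sum>q\<in>A. p' q)"
  have V0: "V \<ge> 0" using V by (meson order_trans sum_nonneg zero_le_power2)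
  have cub: "\<bar>\<kappa> - l - l\<^sup>2 / 2\<bar> \<le> \<bar>l\<bar> ^ 3" using exp_cubic_approx[OF l(1)] by (simp add: \<kappa>_def)
  have l3: "\<bar>l\<bar> ^ 3 \<le> l\<^sup>2 / 2" "l\<^sup>2 \<le> \<bar>l\<bar> / 2"
  proof -
    have "\<bar>l\<bar> ^ 3 = \<bar>l\<bar> * l\<^sup>2" by (simp add: power3_eq_cube power2_eq_square)
    also have "\<dots> \<le> 1 / 2 * l\<^sup>2" using l by (intro mult_right_mono) auto
    finally show "\<bar>l\<bar> ^ 3 \<le> l\<^sup>2 / 2" by simp
    have "l\<^sup>2 = \<bar>l\<bar> * \<bar>l\<bar>" by (simp add: power2_eq_square)
    also have "\<dots> \<le> 1 / 2 * \<bar>l\<bar>" using l by (intro mult_right_mono) auto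
    finally show "l\<^sup>2 \<le> \<bar>l\<bar> / 2" by simp
  qed
  have kup: "\<bar>\<kappa>\<bar> \<le> 2 * \<bar>l\<bar>" using cub l3 by linarith
  \<comment> \<open>Multiplication by \<open>sgn l\<close> treats both tails at once.\<close>
  have klow: "sgn l * \<kappa> \<ge> \<bar>l\<bar> - l\<^sup>2" using cub l3 by (cases "l > 0") (use l in \<open>auto simp: sgn_if\<close>)
  have k1: "\<kappa> \<ge> - (1 / 2)" "\<kappa> \<le> 1" using cub l3 l by linarith+
  have kabs: "sgn l * \<kappa> = \<bar>\<kappa>\<bar>"
    using l(2) by (auto simp: sgn_if \<kappa>_def)
  have pk: "p q * \<kappa> \<ge> - (1 / 2)" "p q * \<kappa> \<le> 1" if "q \<in> A" for q
  proof -
    have p: "0 \<le> p q" "p q \<le> 1" using A(2)[OF that] by auto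
    show "p q * \<kappa> \<ge> - (1 / 2)" "p q * \<kappa> \<le> 1"
    proof -
      have "0 \<le> p q * \<kappa> \<and> p q * \<kappa> \<le> 1 * \<kappa>" if "\<kappa> \<ge> 0"
        using that p by (intro conjI mult_right_mono mult_nonneg_nonneg)
      moreover have "1 * \<kappa> \<le> p q * \<kappa> \<and> p q * \<kappa> \<le> 0" if "\<not> \<kappa> \<ge> 0"
        using that p by (intro conjI mult_right_mono_neg mult_nonneg_nonpos) auto
      ultimately show "p q * \<kappa> \<ge> - (1 / 2)" "p q * \<kappa> \<le> 1"
        using k1 by (cases "\<kappa> \<ge> 0"; linarith)+
    qed
  qed
  have pos: "1 + p q * (exp l - 1) > 0" if "q \<in> A" for q using pk[OF that] by (simp add: \<kappa>_def)
  have p'01: "0 \<le> p' q \<and> p' q \<le> 1" if "q \<in> A" for q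
    using A(2)[OF that] pos[OF that] by (auto simp: p'_def field_simps)
  have p'diff: "\<bar>p' q - p q * (1 + \<kappa>)\<bar> \<le> 4 * \<bar>\<kappa>\<bar> * (p q)\<^sup>2" if "q \<in> A" for q
  proof -
    have "p' q - p q * (1 + \<kappa>) = - ((p q)\<^sup>2 * \<kappa> * (1 + \<kappa>)) / (1 + p q * \<kappa>)"
      using pos[OF that] by (simp add: p'_def \<kappa>_def field_simps power2_eq_square)
    also have "\<bar>\<dots>\<bar> = (p q)\<^sup>2 * \<bar>\<kappa>\<bar> * (1 + \<kappa>) / (1 + p q * \<kappa>)"
      using k1 pk[OF that] by (simp add: abs_mult)
    also have "\<dots> \<le> (p q)\<^sup>2 * \<bar>\<kappa>\<bar> * 2 / (1 / 2)"
      using k1 pk[OF that] by (intro frac_le mult_left_mono) auto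
    also have "\<dots> = 4 * \<bar>\<kappa>\<bar> * (p q)\<^sup>2" by simp
    finally show ?thesis .
  qed
  \<comment> \<open>To first order the tilt multiplies the mean by
    \<open>exp l = 1 + \<kappa>\<close>. Normalising each \<open>p' q\<close> perturbs this only by
    multiples of \<open>(p q)\<^sup>2\<close>, which is where \<open>V\<close> enters.\<close>
  have \<mu>'diff: "\<bar>\<mu>' - \<mu> * (1 + \<kappa>)\<bar> \<le> 4 * \<bar>\<kappa>\<bar> * V"
  proof -
    have "\<bar>\<mu>' - \<mu> * (1 + \<kappa>)\<bar> = \<bar>\<Sum>q\<in>A. p' q - p q * (1 + \<kappa>)\<bar>"
      by (simp add: \<mu>'_def \<mu>_def sum_subtractf sum_distrib_right)
    also have "\<dots> \<le> (\<Sum>q\<in>A. \<bar>p' q - p q * (1 + \<kappa>)\<bar>)" by (rule sum_abs)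
    also have "\<dots> \<le> (\<Sum>q\<in>A. 4 * \<bar>\<kappa>\<bar> * (p q)\<^sup>2)" by (intro sum_mono p'diff)
    also have "\<dots> \<le> 4 * \<bar>\<kappa>\<bar> * V" unfolding sum_distrib_left[symmetric] using V by (intro mult_left_mono) auto
    finally show ?thesis .
  qed
  have \<mu>'up: "\<mu>' \<le> 4 * \<mu>"
  proof -
    have "\<mu> * (1 + \<kappa>) \<le> \<mu> * 2" using k1 \<mu> by (intro mult_left_mono) auto
    moreover have "4 * \<bar>\<kappa>\<bar> * V \<le> \<bar>\<kappa>\<bar> * \<mu>" using \<mu> mult_left_mono[of "4 * V" \<mu> "\<bar>\<kappa>\<bar>"] by simp
    moreover have "\<bar>\<kappa>\<bar> * \<mu> \<le> 1 * \<mu>" using kup l \<mu> by (intro mult_right_mono) auto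
    ultimately show ?thesis using \<mu>'diff by linarith
  qed
  have \<mu>'pos: "\<mu>' > 0"
  proof -
    obtain q where q: "q \<in> A" "p q > 0"
      using \<mu>(1) A(2) unfolding \<mu>_def by (metis less_irrefl linorder_not_less order_antisym sum_nonpos)
    have "p' q > 0" using q pos[OF q(1)] by (simp add: p'_def)
    then show ?thesis unfolding \<mu>'_def using q(1) A(1) p'01 by (intro sum_pos2) auto
  qed
  have sq: "sqrt \<mu>' \<le> 2 * sqrt \<mu>"
    using real_sqrt_le_mono[OF \<mu>'up] by (simp add: real_sqrt_mult)
  have shift: "sgn l * (\<mu>' - \<mu>) \<ge> (\<bar>l\<bar> - l\<^sup>2) * (\<mu> - 4 * V)"
  proof -
    have "sgn l * (\<mu>' - \<mu>) = sgn l * \<kappa> * \<mu> + sgn l * (\<mu>' - \<mu> * (1 + \<kappa>))" by (simp add: algebra_simps)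
    also have "\<dots> \<ge> \<bar>\<kappa>\<bar> * \<mu> - 4 * \<bar>\<kappa>\<bar> * V"
    proof -
      have "\<bar>sgn l * (\<mu>' - \<mu> * (1 + \<kappa>))\<bar> = \<bar>\<mu>' - \<mu> * (1 + \<kappa>)\<bar>" using l(2) by (simp add: abs_mult)
      then show ?thesis using \<mu>'diff kabs by (smt (verit))
    qed
    also have "\<bar>\<kappa>\<bar> * \<mu> - 4 * \<bar>\<kappa>\<bar> * V = \<bar>\<kappa>\<bar> * (\<mu> - 4 * V)" by (simp add: algebra_simps)
    also have "\<dots> \<ge> (\<bar>l\<bar> - l\<^sup>2) * (\<mu> - 4 * V)" using klow kabs \<mu> by (intro mult_right_mono) auto
    finally show ?thesis .
  qed
  have Zpos: "(\<Prod>q\<in>A. 1 + p q * (exp l - 1)) > 0" using pos by (intro prod_pos) auto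
  have Z: "(\<Prod>q\<in>A. 1 + p q * (exp l - 1)) \<ge> exp (\<kappa> * \<mu> - 2 * \<kappa>\<^sup>2 * V)"
  proof -
    have "\<kappa> * \<mu> - 2 * \<kappa>\<^sup>2 * V \<le> \<kappa> * \<mu> - 2 * \<kappa>\<^sup>2 * (\<Sum>q\<in>A. (p q)\<^sup>2)"
      using V by (intro diff_left_mono mult_left_mono) auto
    also have "\<dots> = (\<Sum>q\<in>A. p q * \<kappa> - 2 * (p q * \<kappa>)\<^sup>2)"
      by (simp add: \<mu>_def sum_subtractf sum_distrib_left power_mult_distrib mult_ac)
    also have "\<dots> \<le> (\<Sum>q\<in>A. ln (1 + p q * \<kappa>))" by (intro sum_mono ln_one_plus_lower pk)
    also have "\<dots> = ln (\<Prod>q\<in>A. 1 + p q * (exp l - 1))"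
      unfolding \<kappa>_def using pos by (subst ln_prod[OF A(1)]) (force, simp)
    finally show ?thesis using Zpos by (simp add: ln_ge_iff)
  qed
  \<comment> \<open>The left side is a lower bound for the logarithm of the normalising product plus
    the least log likelihood ratio on the Chebyshev window. Its main part
    \<open>\<mu> * (\<kappa> - l * (1 + \<kappa>))\<close> is about
    \<open>- \<mu> * l\<^sup>2 / 2\<close>.\<close>
  have expo: "\<kappa> * \<mu> - 2 * \<kappa>\<^sup>2 * V - l * \<mu>' - 2 * \<bar>l\<bar> * sqrt \<mu>'
       \<ge> - \<mu> * (l\<^sup>2 / 2 + 2 * \<bar>l\<bar> ^ 3) - 16 * l\<^sup>2 * V - 4 * \<bar>l\<bar> * sqrt \<mu>"
  proof -
    have "l * \<mu>' \<le> l * (\<mu> * (1 + \<kappa>)) + \<bar>l\<bar> * (4 * \<bar>\<kappa>\<bar> * V)"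
    proof -
      have "l * \<mu>' = l * (\<mu> * (1 + \<kappa>)) + l * (\<mu>' - \<mu> * (1 + \<kappa>))" by (simp add: algebra_simps)
      also have "l * (\<mu>' - \<mu> * (1 + \<kappa>)) \<le> \<bar>l\<bar> * \<bar>\<mu>' - \<mu> * (1 + \<kappa>)\<bar>" by (metis abs_ge_self abs_mult)
      also have "\<dots> \<le> \<bar>l\<bar> * (4 * \<bar>\<kappa>\<bar> * V)" using \<mu>'diff by (intro mult_left_mono) auto
      finally show ?thesis by simp
    qed
    moreover have "\<bar>l\<bar> * (4 * \<bar>\<kappa>\<bar> * V) \<le> 8 * l\<^sup>2 * V"
    proof -
      have "\<bar>l\<bar> * (4 * \<bar>\<kappa>\<bar> * V) = (4 * \<bar>l\<bar> * V) * \<bar>\<kappa>\<bar>" by simp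
      also have "\<dots> \<le> (4 * \<bar>l\<bar> * V) * (2 * \<bar>l\<bar>)" using kup V0 by (intro mult_left_mono) auto
      also have "\<dots> = 8 * (\<bar>l\<bar> * \<bar>l\<bar>) * V" by simp
      also have "\<dots> = 8 * l\<^sup>2 * V" by (simp add: power2_eq_square)
      finally show ?thesis .
    qed
    moreover have "2 * \<kappa>\<^sup>2 * V \<le> 8 * l\<^sup>2 * V"
    proof -
      have "\<bar>\<kappa>\<bar>\<^sup>2 \<le> (2 * \<bar>l\<bar>)\<^sup>2" using kup by (intro power_mono) auto
      then have "\<kappa>\<^sup>2 \<le> 4 * l\<^sup>2" by (simp add: power_mult_distrib)
      then show ?thesis using V0 by (intro mult_right_mono) auto
    qed
    moreover have "2 * \<bar>l\<bar> * sqrt \<mu>' \<le> 4 * \<bar>l\<bar> * sqrt \<mu>"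
      using sq mult_left_mono[of "sqrt \<mu>'" "2 * sqrt \<mu>" "2 * \<bar>l\<bar>"] by simp
    moreover have "l * (\<mu> * (1 + \<kappa>)) - \<kappa> * \<mu> \<le> \<mu> * (l\<^sup>2 / 2 + 2 * \<bar>l\<bar> ^ 3)"
    proof -
      \<comment> \<open>In this form only the lower cubic bound for \<open>\<kappa>\<close> is
        called for, because \<open>1 - l\<close> is positive.\<close>
      have "l * (1 + \<kappa>) - \<kappa> = 1 - (1 - l) * (1 + \<kappa>)" by (simp add: algebra_simps)
      also have "\<dots> \<le> 1 - (1 - l) * (1 + l + l\<^sup>2 / 2 - \<bar>l\<bar> ^ 3)"
        using cub l by (intro diff_left_mono mult_left_mono) auto
      also have "\<dots> = l\<^sup>2 / 2 + l ^ 3 / 2 + (1 - l) * \<bar>l\<bar> ^ 3"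
      proof -
        have "1 - (1 - l) * (1 + l + l\<^sup>2 / 2 - c) = l\<^sup>2 / 2 + l ^ 3 / 2 + (1 - l) * c" for c
          by (simp add: algebra_simps power2_eq_square power3_eq_cube) (simp add: field_simps)
        then show ?thesis .
      qed
      also have "\<dots> \<le> l\<^sup>2 / 2 + 2 * \<bar>l\<bar> ^ 3"
      proof -
        have "l ^ 3 \<le> \<bar>l\<bar> ^ 3" by (metis abs_ge_self power_abs)
        moreover have "(1 - l) * \<bar>l\<bar> ^ 3 \<le> 3 / 2 * \<bar>l\<bar> ^ 3" using l by (intro mult_right_mono) auto
        ultimately show ?thesis by linarith
      qed
      finally have "\<mu> * (l * (1 + \<kappa>) - \<kappa>) \<le> \<mu> * (l\<^sup>2 / 2 + 2 * \<bar>l\<bar> ^ 3)" using \<mu> by (intro mult_left_mono) auto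
      then show ?thesis by (simp add: algebra_simps)
    qed
    ultimately show ?thesis by linarith
  qed
  define Y where "Y = (\<lambda>S :: nat set. \<bar>real (card S) - \<mu>'\<bar> \<le> 2 * sqrt \<mu>')"
  define X where "X = (\<lambda>S :: nat set. sgn l * (real (card S) - \<mu>) \<ge> (\<bar>l\<bar> - l\<^sup>2) * (\<mu> - 4 * V) - 4 * sqrt \<mu>)"
  have "bprob p' A Y \<ge> 3 / 4"
    unfolding Y_def \<mu>'_def using A(1) p'01 \<mu>'pos by (intro bernoulli_chebyshev) (auto simp: \<mu>'_def)
  then have "3 / 4 * exp (- l * \<mu>' - 2 * \<bar>l\<bar> * sqrt \<mu>') \<le> bprob p' A Y * exp (- l * \<mu>' - 2 * \<bar>l\<bar> * sqrt \<mu>')"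
    by (intro mult_right_mono) auto
  also have "\<dots> \<le> bexp p' A (\<lambda>S. of_bool (X S) * exp (- l * real (card S)))"
    unfolding bprob_def bexp_multc[symmetric]
  proof (intro bexp_mono p'01)
    fix S
    show "of_bool (Y S) * exp (- l * \<mu>' - 2 * \<bar>l\<bar> * sqrt \<mu>') \<le> of_bool (X S) * exp (- l * real (card S))"
    proof (cases "Y S")
      case True
      then have Y: "\<bar>real (card S) - \<mu>'\<bar> \<le> 2 * sqrt \<mu>'" by (simp add: Y_def)
      have "sgn l * (real (card S) - \<mu>) = sgn l * (\<mu>' - \<mu>) + sgn l * (real (card S) - \<mu>')" by (simp add: algebra_simps)
      moreover have "\<bar>sgn l * (real (card S) - \<mu>')\<bar> = \<bar>real (card S) - \<mu>'\<bar>" using l(2) by (simp add: abs_mult)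
      ultimately have "X S" using Y shift sq unfolding X_def by linarith
      moreover have "l * real (card S) \<le> l * \<mu>' + 2 * \<bar>l\<bar> * sqrt \<mu>'"
      proof -
        have "l * (real (card S) - \<mu>') \<le> \<bar>l\<bar> * \<bar>real (card S) - \<mu>'\<bar>" by (metis abs_ge_self abs_mult)
        also have "\<dots> \<le> \<bar>l\<bar> * (2 * sqrt \<mu>')" using Y by (intro mult_left_mono) auto
        finally show ?thesis by (simp add: algebra_simps)
      qed
      ultimately show ?thesis by simp
    qed auto
  qed
  finally have *: "3 / 4 * exp (- l * \<mu>' - 2 * \<bar>l\<bar> * sqrt \<mu>') \<le> bexp p' A (\<lambda>S. of_bool (X S) * exp (- l * real (card S)))" .
  have "3 / 4 * exp (- \<mu> * (l\<^sup>2 / 2 + 2 * \<bar>l\<bar> ^ 3) - 16 * l\<^sup>2 * V - 4 * \<bar>l\<bar> * sqrt \<mu>)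
      \<le> 3 / 4 * exp (\<kappa> * \<mu> - 2 * \<kappa>\<^sup>2 * V - l * \<mu>' - 2 * \<bar>l\<bar> * sqrt \<mu>')"
    using expo by simp
  also have "\<dots> = exp (\<kappa> * \<mu> - 2 * \<kappa>\<^sup>2 * V) * (3 / 4 * exp (- l * \<mu>' - 2 * \<bar>l\<bar> * sqrt \<mu>'))"
    by (simp flip: exp_add)
  also have "\<dots> \<le> (\<Prod>q\<in>A. 1 + p q * (exp l - 1)) * bexp p' A (\<lambda>S. of_bool (X S) * exp (- l * real (card S)))"
    using Z * Zpos by (intro mult_mono) auto
  also have "\<dots> = bprob p A X"
    unfolding bprob_def p'_def by (rule bexp_tilt[OF A(1) pos, symmetric])
  finally show ?thesis unfolding X_def .
qed

section \<open>The law of the iterated logarithm for the model\<close>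

text \<open>
  In the model, \<open>q\<close> divides with odds \<open>q / (q - 1)\<^sup>2\<close>, the factor contributed by \<open>q\<close> to the sieve
  bound for shifted primes.
\<close>
definition mp :: "nat \<Rightarrow> real" where
  "mp q = real q / ((real q)\<^sup>2 - real q + 1)"

lemma mp_bounds:
  assumes "q \<ge> 2"
  shows "1 / real q \<le> mp q" "mp q \<le> 1 / real q + 1 / (real q)\<^sup>2" "0 \<le> mp q \<and> mp q \<le> 1" "(mp q)\<^sup>2 \<le> 3 / (real q)\<^sup>2"
proof -
  have q: "real q \<ge> 2" using assms by simp
  have qq: "2 * real q \<le> (real q)\<^sup>2" using mult_right_mono[OF q, of "real q"] by (simp add: power2_eq_square)
  then have d: "(real q)\<^sup>2 - real q + 1 > 0" using q by linarith
  show 1: "1 / real q \<le> mp q" using q d by (simp add: mp_def divide_simps power2_eq_square)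
  have "mp q - 1 / real q = (real q - 1) / (real q * ((real q)\<^sup>2 - real q + 1))"
    using q d by (simp add: mp_def divide_simps power2_eq_square)
  also have "\<dots> \<le> 1 / (real q)\<^sup>2"
    using q d by (simp add: divide_simps) (simp add: algebra_simps power2_eq_square)
  finally show 2: "mp q \<le> 1 / real q + 1 / (real q)\<^sup>2" by simp
  show 3: "0 \<le> mp q \<and> mp q \<le> 1" using q d qq by (auto simp: mp_def divide_simps)
  have "1 / (real q)\<^sup>2 \<le> 1 / (2 * real q)" using qq q by (intro divide_left_mono) auto
  then have "mp q \<le> (3 / 2) / real q" using 2 by simp
  then have "(mp q)\<^sup>2 \<le> ((3 / 2) / real q)\<^sup>2" using 3 by (intro power_mono) auto
  also have "\<dots> = (9 / 4) / (real q)\<^sup>2" by (simp add: power_divide)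
  also have "\<dots> \<le> 3 / (real q)\<^sup>2" by (rule divide_right_mono) auto
  finally show "(mp q)\<^sup>2 \<le> 3 / (real q)\<^sup>2" .
qed

lemma mp_prime: "prime q \<Longrightarrow> 0 \<le> mp q \<and> mp q \<le> 1"
  using mp_bounds(3) prime_ge_2_nat by blast

lemma sum_inverse_squares_le:
  assumes "finite A" "\<And>q. q \<in> A \<Longrightarrow> q \<ge> 2"
  shows "(\<Sum>q\<in>A. 1 / (real q)\<^sup>2) \<le> 1"
proof -
  have *: "(\<Sum>k=2..n. 1 / (real k)\<^sup>2) \<le> 1 - 1 / real n" if "n \<ge> 1" for n
    using that
  proof (induction n rule: nat_induct_at_least)
    case (Suc n)
    have "1 / (real n + 1)\<^sup>2 \<le> 1 / real n - 1 / (real n + 1)"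
      using Suc.hyps by (simp add: divide_simps power2_eq_square)
    then show ?case using Suc by (simp add: add.commute)
  qed auto
  define n where "n = Max (insert 1 A)"
  have n: "q \<le> n" if "q \<in> insert 1 A" for q unfolding n_def using that assms(1) by (intro Max_ge) auto
  have "(\<Sum>q\<in>A. 1 / (real q)\<^sup>2) \<le> (\<Sum>k=2..n. 1 / (real k)\<^sup>2)"
    using assms n by (intro sum_mono2) auto
  also have "\<dots> \<le> 1 - 1 / real n" using n by (intro *) auto
  also have "\<dots> \<le> 1" by simp
  finally show ?thesis .
qed

text \<open>12 is the 11 of \<open>mertens\<close> plus at most 1 from the sum of
  \<open>1 / q\<^sup>2\<close>, which bounds the excess of \<open>mp q\<close> over
  \<open>1 / q\<close>.\<close>

lemma mass_mp_approx:
  assumes "2 \<le> t" "t \<le> T"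
  shows "\<bar>mass mp (primes_upto T) t - ln (ln t)\<bar> \<le> 12"
proof -
  have eq: "{q. q \<in> primes_upto T \<and> real q \<le> t} = primes_upto t" using assms by auto
  have "mass mp (primes_upto T) t \<le> (\<Sum>p\<in>primes_upto t. 1 / real p + 1 / (real p)\<^sup>2)"
    unfolding mass_def eq by (intro sum_mono mp_bounds) (auto simp: prime_ge_2_nat)
  also have "\<dots> \<le> (\<Sum>p\<in>primes_upto t. 1 / real p) + 1"
    unfolding sum.distrib by (intro add_left_mono sum_inverse_squares_le) (auto simp: prime_ge_2_nat)
  moreover have "(\<Sum>p\<in>primes_upto t. 1 / real p) \<le> mass mp (primes_upto T) t"
    unfolding mass_def eq by (intro sum_mono mp_bounds) (auto simp: prime_ge_2_nat)
  ultimately show ?thesis using mertens[OF assms(1)] by linarith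
qed

text \<open>The normaliser of the law of the iterated logarithm at variance \<open>n\<close>; at
  \<open>n = ln (ln t)\<close> it is the denominator of \<open>Lambda\<close>.\<close>

definition phi :: "real \<Rightarrow> real" where
  "phi n = sqrt (2 * n * ln (ln n))"

lemma phi_mono:
  assumes "ln (ln m) \<ge> 0" "m > 1" "m \<le> n"
  shows "phi m \<le> phi n"
proof -
  have "ln m > 0" using assms by simp
  then have "ln (ln m) \<le> ln (ln n)" using assms by simp
  then show ?thesis unfolding phi_def using assms by (intro real_sqrt_le_mono mult_mono) auto
qed

section \<open>Geometric blocks and the upper half\<close>

lemma exists_power_bracket:
  fixes u b :: real
  assumes "b > 1" "u \<ge> 1"
  shows "\<exists>k. b ^ k \<le> u \<and> u < b ^ (k + 1)"
proof -
  obtain m where m: "u < b ^ m" using real_arch_pow[OF assms(1)] by blast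
  define j where "j = (LEAST m. u < b ^ m)"
  have j: "u < b ^ j" unfolding j_def using m by (rule LeastI)
  then have "j \<noteq> 0" using assms(2) by (intro notI) simp
  then obtain k where k: "j = Suc k" using not0_implies_Suc by blast
  have "\<not> u < b ^ k" using not_less_Least[of k "\<lambda>m. u < b ^ m"] k by (simp add: j_def)
  then show ?thesis using j k by (intro exI[of _ k]) simp
qed

lemma ln_ln_mono:
  fixes s t :: real
  assumes "3 \<le> s" "s \<le> t"
  shows "ln (ln s) \<le> ln (ln t)" "ln s \<ge> 1"
proof -
  have "exp 1 \<le> s" using assms exp_le by linarith
  then show *: "ln s \<ge> 1" using assms by (subst ln_ge_iff) auto
  have "ln s \<le> ln t" using assms by simp
  then show "ln (ln s) \<le> ln (ln t)" using * by simp
qed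

text \<open>Telescoping in place of the integral test: each term is at most \<open>1 / s\<close>
  times the decrease of \<open>powr (- s)\<close> from \<open>k - 1\<close> to \<open>k\<close>, by
  \<open>1 + z \<le> exp z\<close> and \<open>ln (1 - z) \<le> - z\<close>.\<close>

lemma sum_powr_tail:
  fixes s :: real
  assumes "s > 0" "K \<ge> 2" "K \<le> K'"
  shows "(\<Sum>k=K..<K'. real k powr (- (1 + s))) \<le> 1 / s * ((real K - 1) powr (- s) - (real K' - 1) powr (-s))"
  using assms(3)
proof (induction K' rule: dec_induct)
  case (step k)
  have k: "real k \<ge> 2" using assms(2) step by simp
  have "real k powr (- (1 + s)) = real k powr (- s) * (1 / real k)"
  proof -
    have "- (1 + s) = - s - 1" by simp
    then have "real k powr (- (1 + s)) = real k powr (- s - 1)" by (simp only:)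
    also have "\<dots> = real k powr (- s) / real k powr 1" by (rule powr_diff)
    finally show ?thesis using k by simp
  qed
  also have "\<dots> = 1 / s * (real k powr (- s) * (s / real k))" using assms(1) by simp
  also have "\<dots> \<le> 1 / s * (real k powr (- s) * ((1 - 1 / real k) powr (- s) - 1))"
  proof -
    have "s / real k \<le> exp (s / real k) - 1" using exp_ge_add_one_self[of "s / real k"] by linarith
    moreover have "exp (s / real k) \<le> (1 - 1 / real k) powr (- s)"
    proof -
      have "ln (1 - 1 / real k) \<le> - (1 / real k)" using k ln_add_one_self_le_self2[of "- (1 / real k)"] by simp
      then have "s * ln (1 - 1 / real k) \<le> s * (- (1 / real k))" using assms(1) by (intro mult_left_mono) auto
      then have "s / real k \<le> - s * ln (1 - 1 / real k)" by simp
      then show ?thesis using k by (simp add: powr_def)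
    qed
    ultimately show ?thesis using assms(1) by (intro mult_left_mono) auto
  qed
  also have "real k powr (- s) * ((1 - 1 / real k) powr (- s) - 1) = (real k - 1) powr (- s) - real k powr (- s)"
  proof -
    have "real k powr (- s) * (1 - 1 / real k) powr (- s) = (real k * (1 - 1 / real k)) powr (- s)"
      using k by (subst powr_mult) auto
    also have "real k * (1 - 1 / real k) = real k - 1" using k by (simp add: field_simps)
    finally show ?thesis by (simp add: algebra_simps)
  qed
  finally show ?case using step by (simp add: algebra_simps add_divide_distrib diff_divide_distrib)
qed auto

text \<open>For a block where \<open>ln (ln t)\<close> lies between \<open>n\<close> and
  \<open>(1 + \<epsilon>) * n\<close>: \<open>y\<close> is the deviation from the model mean and
  \<open>v\<close> an upper bound for that mean, each allowing the Mertens error 12, and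
  \<open>y / v\<close> is the optimal exponent. The square \<open>y ^ 2\<close> carries two factors
  \<open>1 + \<epsilon>\<close>; one is spent on the length of the block, the other is left to make
  the exponent exceed \<open>ln (ln n)\<close>. The constant \<open>c\<close> allows for passing
  from \<open>ln (ln n)\<close> to \<open>ln k\<close> when \<open>n\<close> is a
  \<open>k\<close>-th power.\<close>

lemma upper_asymptotics:
  fixes \<epsilon> c :: real
  assumes "\<epsilon> > 0"
  shows "eventually (\<lambda>n. let y = (1 + \<epsilon>) * phi n - 12; v = (1 + \<epsilon>) * n + 12 in
    n > 1 \<and> ln (ln n) \<ge> 0 \<and> y > 0 \<and> y / v \<le> 1 / 2 \<and> y ^ 2 / (2 * v) - y ^ 3 / v ^ 2 \<ge> (1 + \<epsilon> / 2) * (ln (ln n) - c)) at_top"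
proof -
  have e0: "((1 + \<epsilon>) * 2 powr (1 / 2))\<^sup>2 * inverse (2 + 2 * \<epsilon>) = 1 + \<epsilon>"
    using assms by (simp add: power_mult_distrib powr_half_sqrt power2_eq_square field_simps)
  have "((\<lambda>n. (((1 + \<epsilon>) * phi n - 12) ^ 2 / (2 * ((1 + \<epsilon>) * n + 12)) - ((1 + \<epsilon>) * phi n - 12) ^ 3 / ((1 + \<epsilon>) * n + 12) ^ 2) / ln (ln n))
      \<longlongrightarrow> ((1 + \<epsilon>) * 2 powr (1 / 2))\<^sup>2 * inverse (2 + 2 * \<epsilon>)) at_top"
    unfolding phi_def using assms by real_asymp
  then have "((\<lambda>n. (((1 + \<epsilon>) * phi n - 12) ^ 2 / (2 * ((1 + \<epsilon>) * n + 12)) - ((1 + \<epsilon>) * phi n - 12) ^ 3 / ((1 + \<epsilon>) * n + 12) ^ 2) / ln (ln n))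
      \<longlongrightarrow> 1 + \<epsilon>) at_top" unfolding e0 .
  then have "eventually (\<lambda>n. (((1 + \<epsilon>) * phi n - 12) ^ 2 / (2 * ((1 + \<epsilon>) * n + 12)) - ((1 + \<epsilon>) * phi n - 12) ^ 3 / ((1 + \<epsilon>) * n + 12) ^ 2) / ln (ln n) > 1 + 3 / 4 * \<epsilon>) at_top"
    using assms by (intro order_tendstoD(1)) auto
  moreover have "((\<lambda>n. ((1 + \<epsilon>) * phi n - 12) / ((1 + \<epsilon>) * n + 12)) \<longlongrightarrow> 0) at_top"
    unfolding phi_def using assms by real_asymp
  then have "eventually (\<lambda>n. ((1 + \<epsilon>) * phi n - 12) / ((1 + \<epsilon>) * n + 12) < 1 / 2) at_top"
    by (rule order_tendstoD) auto
  moreover have "filterlim (\<lambda>n. (1 + \<epsilon>) * phi n - 12) at_top at_top"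
    unfolding phi_def using assms by real_asymp
  then have "eventually (\<lambda>n. (1 + \<epsilon>) * phi n - 12 > 0) at_top" by (simp only: filterlim_at_top_dense)
  moreover have "filterlim (\<lambda>n::real. \<epsilon> / 4 * ln (ln n)) at_top at_top" using assms by real_asymp
  then have "eventually (\<lambda>n. \<epsilon> / 4 * ln (ln n) \<ge> max 1 (- (1 + \<epsilon> / 2) * c)) at_top" by (simp only: filterlim_at_top)
  moreover have "eventually (\<lambda>n::real. n > 1) at_top" by (rule eventually_gt_at_top)
  ultimately show ?thesis
  proof eventually_elim
    case (elim n)
    have "\<epsilon> / 4 * ln (ln n) > 0" using elim(4) by linarith
    then have l: "ln (ln n) > 0" using assms by (simp add: zero_less_mult_iff)
    have "(1 + 3 / 4 * \<epsilon>) * ln (ln n) \<le> ((1 + \<epsilon>) * phi n - 12) ^ 2 / (2 * ((1 + \<epsilon>) * n + 12)) - ((1 + \<epsilon>) * phi n - 12) ^ 3 / ((1 + \<epsilon>) * n + 12) ^ 2"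
      using elim(1) l by (simp add: pos_less_divide_eq)
    moreover have "(1 + 3 / 4 * \<epsilon>) * ln (ln n) = (1 + \<epsilon> / 2) * ln (ln n) + \<epsilon> / 4 * ln (ln n)" by (simp add: algebra_simps)
    moreover have "\<epsilon> / 4 * ln (ln n) \<ge> - (1 + \<epsilon> / 2) * c" using elim(4) by simp
    moreover have "(1 + \<epsilon> / 2) * (ln (ln n) - c) = (1 + \<epsilon> / 2) * ln (ln n) + (- (1 + \<epsilon> / 2) * c)" by (simp only: right_diff_distrib mult_minus_left)
    ultimately have "((1 + \<epsilon>) * phi n - 12) ^ 2 / (2 * ((1 + \<epsilon>) * n + 12)) - ((1 + \<epsilon>) * phi n - 12) ^ 3 / ((1 + \<epsilon>) * n + 12) ^ 2 \<ge> (1 + \<epsilon> / 2) * (ln (ln n) - c)"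
      by linarith
    then show ?case using elim l by (simp add: Let_def)
  qed
qed

definition deviates :: "real \<Rightarrow> real \<Rightarrow> real \<Rightarrow> nat set \<Rightarrow> bool" where
  "deviates \<epsilon> \<xi> T S \<longleftrightarrow> (\<exists>t. \<xi> < t \<and> t \<le> T \<and> \<bar>cnt S t - ln (ln t)\<bar> > (1 + \<epsilon>) * phi (ln (ln t)))"

text \<open>On the block of index \<open>k\<close> one fixed exponent for each sign is used in the
  maximal inequality, which fails with probability at most
  \<open>k powr (- (1 + \<epsilon> / 2))\<close>. This is summable, so the blocks beyond
  \<open>\<xi>\<close> contribute little, uniformly in \<open>T\<close>.\<close>

lemma model_upper:
  fixes \<epsilon> \<delta> :: real
  assumes \<epsilon>: "\<epsilon> > 0" and \<delta>: "\<delta> > 0"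
  shows "\<exists>\<Lambda>0. \<forall>\<xi> T. \<xi> \<ge> 3 \<and> ln (ln \<xi>) \<ge> \<Lambda>0 \<longrightarrow> bprob mp (primes_upto T) (deviates \<epsilon> \<xi> T) \<le> \<delta>"
proof -
  define \<theta> where "\<theta> = 1 + \<epsilon>"
  have \<theta>: "\<theta> > 1" using \<epsilon> by (simp add: \<theta>_def)
  define c where "c = ln (ln \<theta>)"
  obtain N0 where N0: "\<And>n. n \<ge> N0 \<Longrightarrow> let y = (1 + \<epsilon>) * phi n - 12; v = (1 + \<epsilon>) * n + 12 in
    n > 1 \<and> ln (ln n) \<ge> 0 \<and> y > 0 \<and> y / v \<le> 1 / 2 \<and> y ^ 2 / (2 * v) - y ^ 3 / v ^ 2 \<ge> (1 + \<epsilon> / 2) * (ln (ln n) - c)"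
    using upper_asymptotics[OF \<epsilon>, of c] unfolding eventually_at_top_linorder by blast
  obtain K0 where K0: "N0 < \<theta> ^ K0" using real_arch_pow[OF \<theta>] by blast
  have "((\<lambda>k::nat. 2 * (1 / (\<epsilon> / 2) * (real k - 1) powr (- (\<epsilon> / 2)))) \<longlongrightarrow> 0) sequentially"
    using \<epsilon> by real_asymp
  then have "eventually (\<lambda>k::nat. 2 * (1 / (\<epsilon> / 2) * (real k - 1) powr (- (\<epsilon> / 2))) < \<delta>) sequentially"
    using \<delta> by (rule order_tendstoD(2))
  then obtain K1 where K1: "\<And>k. k \<ge> K1 \<Longrightarrow> 2 * (1 / (\<epsilon> / 2) * (real k - 1) powr (- (\<epsilon> / 2))) < \<delta>"
    unfolding eventually_sequentially by blast
  define K where "K = max 2 (max K0 K1)"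
  define y where "y = (\<lambda>k. (1 + \<epsilon>) * phi (\<theta> ^ k) - 12)"
  define v where "v = (\<lambda>k::nat. (1 + \<epsilon>) * \<theta> ^ k + 12)"
  define l where "l = (\<lambda>k. y k / v k)"
  define b where "b = (\<lambda>k. y k ^ 2 / (2 * v k) - y k ^ 3 / v k ^ 2)"
  have kK: "\<theta> ^ k > 1" "ln (ln (\<theta> ^ k)) \<ge> 0" "y k > 0" "l k \<le> 1 / 2" "l k > 0" "v k > 0"
      "exp (- b k) \<le> real k powr (- (1 + \<epsilon> / 2))" if k: "k \<ge> K" for k
  proof -
    have "\<theta> ^ K0 \<le> \<theta> ^ k" using \<theta> k by (intro power_increasing) (auto simp: K_def)
    then have "\<theta> ^ k \<ge> N0" using K0 by linarith
    from N0[OF this] have *: "\<theta> ^ k > 1" "ln (ln (\<theta> ^ k)) \<ge> 0" "y k > 0" "l k \<le> 1 / 2" "b k \<ge> (1 + \<epsilon> / 2) * (ln (ln (\<theta> ^ k)) - c)"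
      by (simp_all add: Let_def y_def v_def l_def b_def)
    then show "\<theta> ^ k > 1" "ln (ln (\<theta> ^ k)) \<ge> 0" "y k > 0" "l k \<le> 1 / 2" by auto
    show v: "v k > 0" using \<theta> by (simp add: v_def \<theta>_def[symmetric] add_pos_pos)
    then show "l k > 0" using *(3) by (simp add: l_def)
    have k2: "real k \<ge> 2" using k by (simp add: K_def)
    have "ln (ln (\<theta> ^ k)) = ln (real k * ln \<theta>)" using \<theta> by (simp add: ln_realpow)
    also have "\<dots> = ln (real k) + c" unfolding c_def using k2 \<theta> by (intro ln_mult_pos) auto
    finally have "b k \<ge> (1 + \<epsilon> / 2) * ln (real k)" using *(5) by simp
    then have "- b k \<le> - (1 + \<epsilon> / 2) * ln (real k)" by linarith
    then have "exp (- b k) \<le> exp (- (1 + \<epsilon> / 2) * ln (real k))" by (simp only: exp_le_cancel_iff)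
    also have "\<dots> = real k powr (- (1 + \<epsilon> / 2))" using k2 by (simp add: powr_def)
    finally show "exp (- b k) \<le> real k powr (- (1 + \<epsilon> / 2))" .
  qed
  show ?thesis
  proof (intro exI[of _ "\<theta> ^ K"] allI impI)
    fix \<xi> T :: real assume \<xi>: "\<xi> \<ge> 3 \<and> ln (ln \<xi>) \<ge> \<theta> ^ K"
    define A where "A = primes_upto T"
    have A: "finite A" "\<And>q. q \<in> A \<Longrightarrow> 0 \<le> mp q \<and> mp q \<le> 1" by (auto simp: A_def mp_prime)
    define X where "X = (\<lambda>l b S. \<exists>t. l * cnt S t - (exp l - 1) * mass mp A t \<ge> b)"
    \<comment> \<open>\<open>K'\<close> only makes the union over blocks finite; the final bound
      does not depend on it.\<close>
    obtain K' where K': "max (ln (ln T)) (\<theta> ^ K) < \<theta> ^ K'" using real_arch_pow[OF \<theta>] by blast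
    then have KK': "K \<le> K'" using \<theta> by (simp add: power_strict_increasing_iff less_imp_le)
    have incl: "\<exists>k\<in>{K..<K'}. X (l k) (b k) S \<or> X (- l k) (b k) S" if dev: "deviates \<epsilon> \<xi> T S" for S
    proof -
      obtain t where t: "\<xi> < t" "t \<le> T" "\<bar>cnt S t - ln (ln t)\<bar> > (1 + \<epsilon>) * phi (ln (ln t))"
        using dev by (auto simp: deviates_def)
      have t3: "t \<ge> 3" using t \<xi> by linarith
      have Lt: "ln (ln t) \<ge> \<theta> ^ K" using ln_ln_mono(1)[of \<xi> t] t \<xi> by linarith
      have LT: "ln (ln t) \<le> ln (ln T)" using ln_ln_mono(1)[OF t3 t(2)] .
      have "1 \<le> \<theta> ^ K" using \<theta> by simp
      then obtain k where k: "\<theta> ^ k \<le> ln (ln t)" "ln (ln t) < \<theta> ^ (k + 1)"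
        using exists_power_bracket[OF \<theta>, of "ln (ln t)"] Lt by auto
      have "\<theta> ^ K < \<theta> ^ (k + 1)" using Lt k by linarith
      then have kK1: "K \<le> k" using \<theta> by (simp only: power_strict_increasing_iff)
      have "\<theta> ^ k < \<theta> ^ K'" using k LT K' by linarith
      then have kK2: "k < K'" using \<theta> by (simp only: power_strict_increasing_iff)
      note kk = kK[OF kK1]
      define M where "M = mass mp A t"
      have M: "\<bar>M - ln (ln t)\<bar> \<le> 12" unfolding M_def A_def using t t3 by (intro mass_mp_approx) auto
      have M0: "M \<ge> 0" unfolding M_def mass_def using A by (intro sum_nonneg) auto
      have Mv: "M \<le> v k" using M k(2) unfolding v_def by (simp add: \<theta>_def)
      have "phi (\<theta> ^ k) \<le> phi (ln (ln t))" using kk k by (intro phi_mono) auto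
      then have "(1 + \<epsilon>) * phi (\<theta> ^ k) \<le> (1 + \<epsilon>) * phi (ln (ln t))" using \<epsilon> by (intro mult_left_mono) auto
      then have dev: "\<bar>cnt S t - M\<bar> \<ge> y k" unfolding y_def using t(3) M by linarith
      \<comment> \<open>Both signs of the exponent at once. The linear part is at least
        \<open>l k * y k\<close>, and \<open>exp g - 1 - g\<close> has an upper bound that depends
        only on \<open>\<bar>g\<bar>\<close>.\<close>
      have key: "g * cnt S t - (exp g - 1) * M \<ge> b k" if g: "\<bar>g\<bar> = l k" "g * (cnt S t - M) = l k * \<bar>cnt S t - M\<bar>" for g
      proof -
        have "\<bar>exp g - 1 - g - g\<^sup>2 / 2\<bar> \<le> \<bar>g\<bar> ^ 3" using kk g by (intro exp_cubic_approx) auto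
        moreover have "g\<^sup>2 = (l k)\<^sup>2" unfolding g(1)[symmetric] by simp
        ultimately have e: "exp g - 1 - g \<le> (l k)\<^sup>2 / 2 + l k ^ 3" unfolding g(1) by linarith
        have e0: "exp g - 1 - g \<ge> 0" using exp_ge_add_one_self[of g] by linarith
        have "(exp g - 1 - g) * M \<le> ((l k)\<^sup>2 / 2 + l k ^ 3) * v k" using e e0 M0 Mv kk by (intro mult_mono) auto
        also have "\<dots> = y k ^ 2 / (2 * v k) + y k ^ 3 / v k ^ 2"
          using kk by (simp add: l_def power_divide field_simps power2_eq_square power3_eq_cube)
        finally have 1: "(exp g - 1 - g) * M \<le> y k ^ 2 / (2 * v k) + y k ^ 3 / v k ^ 2" .
        have "l k * y k \<le> l k * \<bar>cnt S t - M\<bar>" using dev kk by (intro mult_left_mono) auto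
        moreover have "l k * y k = 2 * (y k ^ 2 / (2 * v k))" by (simp add: l_def power2_eq_square)
        moreover have "g * cnt S t - (exp g - 1) * M = g * (cnt S t - M) - (exp g - 1 - g) * M" by (simp add: algebra_simps)
        ultimately show ?thesis using 1 g(2) unfolding b_def by linarith
      qed
      have "X (l k) (b k) S \<or> X (- l k) (b k) S"
      proof (cases "cnt S t \<ge> M")
        case True
        then have "X (l k) (b k) S" unfolding X_def M_def[symmetric]
          using key[of "l k"] kk by (intro exI[of _ t]) (auto simp: M_def)
        then show ?thesis ..
      next
        case False
        then have "X (- l k) (b k) S" unfolding X_def
          using key[of "- l k"] kk by (intro exI[of _ t]) (auto simp: M_def algebra_simps)
        then show ?thesis ..
      qed
      then show ?thesis using kK1 kK2 by auto
    qed
    have "bprob mp A (deviates \<epsilon> \<xi> T) \<le> bprob mp A (\<lambda>S. \<exists>k\<in>{K..<K'}. X (l k) (b k) S \<or> X (- l k) (b k) S)"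
      using A(2) incl by (intro bprob_mono) auto
    also have "\<dots> \<le> (\<Sum>k\<in>{K..<K'}. bprob mp A (\<lambda>S. X (l k) (b k) S \<or> X (- l k) (b k) S))"
      using A(2) by (intro bprob_bex) auto
    also have "\<dots> \<le> (\<Sum>k\<in>{K..<K'}. 2 * real k powr (- (1 + \<epsilon> / 2)))"
    proof (intro sum_mono)
      fix k assume k: "k \<in> {K..<K'}"
      have "bprob mp A (\<lambda>S. X (l k) (b k) S \<or> X (- l k) (b k) S) \<le> bprob mp A (X (l k) (b k)) + bprob mp A (X (- l k) (b k))"
        by (rule bprob_disj[OF A(2)])
      also have "\<dots> \<le> exp (- b k) + exp (- b k)"
        unfolding X_def by (intro add_mono bernoulli_maximal A)
      also have "\<dots> \<le> 2 * real k powr (- (1 + \<epsilon> / 2))" using kK(7)[of k] k by simp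
      finally show "bprob mp A (\<lambda>S. X (l k) (b k) S \<or> X (- l k) (b k) S) \<le> 2 * real k powr (- (1 + \<epsilon> / 2))" .
    qed
    also have "\<dots> = 2 * (\<Sum>k=K..<K'. real k powr (- (1 + \<epsilon> / 2)))" by (simp add: sum_distrib_left)
    also have "\<dots> \<le> 2 * (1 / (\<epsilon> / 2) * ((real K - 1) powr (- (\<epsilon> / 2)) - (real K' - 1) powr (- (\<epsilon> / 2))))"
      using \<epsilon> KK' by (intro mult_left_mono sum_powr_tail) (auto simp: K_def)
    also have "\<dots> \<le> 2 * (1 / (\<epsilon> / 2) * (real K - 1) powr (- (\<epsilon> / 2)))"
      using \<epsilon> by (intro mult_left_mono) auto
    also have "\<dots> \<le> \<delta>" using K1[of K] unfolding K_def by (intro less_imp_le) simp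
    finally show "bprob mp (primes_upto T) (deviates \<epsilon> \<xi> T) \<le> \<delta>" by (simp add: A_def)
  qed
qed


section \<open>The lower half by independent blocks\<close>

lemma lower_asymptotics:
  fixes \<epsilon> :: real
  assumes "0 < \<epsilon>" "\<epsilon> < 1"
  shows "eventually (\<lambda>n. let ll = ln (ln n); m = (1 - \<epsilon>\<^sup>2 / 64) * n - 24 in
    n > 1 \<and> ll > 0 \<and> m \<ge> 12 \<and> n * (\<epsilon>\<^sup>2 / 64) \<ge> 24 \<and> 2 * ll / m \<le> 1 / 4 \<and>
    sqrt (2 * (1 - \<epsilon> / 4) * ll * m) - 2 * ll - 30 - 4 * sqrt n \<ge> (1 - \<epsilon> / 2) * phi n \<and>
    \<epsilon> / 8 * ll \<ge> 2 * (2 * ll * sqrt (2 * ll / m)) + 13 + 4 * sqrt (2 * ll)) at_top"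
proof -
  \<comment> \<open>The numbers in the claim are those of \<open>block_probability\<close>. The
    quantity \<open>m\<close> is the least mean of a block of ratio
    \<open>64 / \<epsilon>\<^sup>2\<close>, with Mertens error 12 at each end. 30 is the margin 24
    in the event plus 6 from \<open>12 * u\<close> with \<open>u \<le> 1 / 2\<close>. 13 is 12 from
    \<open>48 * u\<^sup>2\<close> with \<open>u\<^sup>2 \<le> 1 / 4\<close>, plus 1 to absorb the
    factor 3/4 of the lower tail.\<close>
  define c1 where "c1 = 1 - \<epsilon> / 4"
  define c2 where "c2 = 1 - \<epsilon>\<^sup>2 / 64"
  have e2: "\<epsilon>\<^sup>2 < \<epsilon>" using assms by (simp add: power2_eq_square)
  have c: "c1 > 0" "c1 \<le> 1" "c2 > 0" "c2 \<le> 1" using assms e2 by (auto simp: c1_def c2_def)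
  have lim: "1 - \<epsilon> / 2 < (2 * c1 * c2) powr (1 / 2) * inverse (2 powr (1 / 2))"
  proof -
    have "c1 * c2 = 1 - \<epsilon> / 4 - (1 - \<epsilon> / 4) * (\<epsilon>\<^sup>2 / 64)" by (simp add: c1_def c2_def algebra_simps)
    moreover have "(1 - \<epsilon> / 4) * (\<epsilon>\<^sup>2 / 64) \<le> 1 * (\<epsilon>\<^sup>2 / 64)" using assms by (intro mult_right_mono) auto
    ultimately have "1 - \<epsilon> / 2 < c1 * c2" using e2 assms by linarith
    also have "c1 * c2 = sqrt (c1 * c2) * sqrt (c1 * c2)" using c by simp
    also have "\<dots> \<le> sqrt (c1 * c2) * 1" using c mult_mono[of c1 1 c2 1] by (intro mult_left_mono) auto
    also have "\<dots> = (2 * c1 * c2) powr (1 / 2) * inverse (2 powr (1 / 2))"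
      using c by (simp add: powr_half_sqrt real_sqrt_mult)
    finally show ?thesis .
  qed
  have "((\<lambda>n. (sqrt (2 * c1 * ln (ln n) * (c2 * n - 24)) - 2 * ln (ln n) - 30 - 4 * sqrt n) / phi n)
      \<longlongrightarrow> (2 * c1 * c2) powr (1 / 2) * inverse (2 powr (1 / 2))) at_top"
    unfolding phi_def using c by real_asymp
  then have "eventually (\<lambda>n. (sqrt (2 * c1 * ln (ln n) * (c2 * n - 24)) - 2 * ln (ln n) - 30 - 4 * sqrt n) / phi n > 1 - \<epsilon> / 2) at_top"
    using lim by (rule order_tendstoD(1))
  moreover have "((\<lambda>n. 2 * ln (ln n) / (c2 * n - 24)) \<longlongrightarrow> 0) at_top" using c by real_asymp
  then have "eventually (\<lambda>n. 2 * ln (ln n) / (c2 * n - 24) < 1 / 4) at_top" by (rule order_tendstoD) auto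
  moreover have "((\<lambda>n. (2 * (2 * ln (ln n) * sqrt (2 * ln (ln n) / (c2 * n - 24))) + 13 + 4 * sqrt (2 * ln (ln n))) / ln (ln n)) \<longlongrightarrow> 0) at_top"
    using c by real_asymp
  then have "eventually (\<lambda>n. (2 * (2 * ln (ln n) * sqrt (2 * ln (ln n) / (c2 * n - 24))) + 13 + 4 * sqrt (2 * ln (ln n))) / ln (ln n) < \<epsilon> / 8) at_top"
    by (rule order_tendstoD) (use assms in auto)
  moreover have "filterlim (\<lambda>n. c2 * n - 24) at_top at_top" using c by real_asymp
  then have "eventually (\<lambda>n. c2 * n - 24 \<ge> 12) at_top" by (simp only: filterlim_at_top)
  moreover have "filterlim (\<lambda>n. n * (\<epsilon>\<^sup>2 / 64)) at_top at_top" using assms by real_asymp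
  then have "eventually (\<lambda>n. n * (\<epsilon>\<^sup>2 / 64) \<ge> 24) at_top" by (simp only: filterlim_at_top)
  moreover have "filterlim (\<lambda>n::real. ln (ln n)) at_top at_top" by real_asymp
  then have "eventually (\<lambda>n::real. ln (ln n) > 0) at_top" by (simp only: filterlim_at_top_dense)
  moreover have "eventually (\<lambda>n::real. n > 1) at_top" by (rule eventually_gt_at_top)
  ultimately show ?thesis
  proof eventually_elim
    case (elim n)
    have ph: "phi n > 0" using elim(6,7) by (simp add: phi_def)
    have "(1 - \<epsilon> / 2) * phi n \<le> sqrt (2 * c1 * ln (ln n) * (c2 * n - 24)) - 2 * ln (ln n) - 30 - 4 * sqrt n"
      using elim(1) ph by (simp only: pos_less_divide_eq less_imp_le)
    moreover have "2 * (2 * ln (ln n) * sqrt (2 * ln (ln n) / (c2 * n - 24))) + 13 + 4 * sqrt (2 * ln (ln n)) \<le> \<epsilon> / 8 * ln (ln n)"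
      using elim(3,6) by (simp only: pos_divide_less_eq less_imp_le)
    ultimately show ?case
      unfolding Let_def c1_def[symmetric] c2_def[symmetric] using elim(2,4,5,6,7) by (intro conjI) (assumption | linarith)+
  qed
qed

text \<open>The tilt \<open>u\<close> satisfies \<open>u\<^sup>2 * \<mu> = 2 * c1 * ll\<close>. It
  moves the mean by about \<open>u * \<mu> = sqrt (2 * c1 * ll * \<mu>)\<close>, which is almost
  \<open>phi n\<close>, at the cost \<open>u\<^sup>2 * \<mu> / 2 = c1 * ll\<close> in the exponent.
  As \<open>c1 < 1\<close>, the probability stays above \<open>ln n\<close> to a power greater than
  -1, which is not summable when \<open>n\<close> runs through the powers of a fixed ratio.\<close>

lemma block_probability:
  fixes \<epsilon> n s :: real
  assumes \<epsilon>: "0 < \<epsilon>" "\<epsilon> < 1" and s: "s = 1 \<or> s = - 1"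
    and n: "let ll = ln (ln n); m = (1 - \<epsilon>\<^sup>2 / 64) * n - 24 in
      n > 1 \<and> ll > 0 \<and> m \<ge> 12 \<and> n * (\<epsilon>\<^sup>2 / 64) \<ge> 24 \<and> 2 * ll / m \<le> 1 / 4 \<and>
      sqrt (2 * (1 - \<epsilon> / 4) * ll * m) - 2 * ll - 30 - 4 * sqrt n \<ge> (1 - \<epsilon> / 2) * phi n \<and>
      \<epsilon> / 8 * ll \<ge> 2 * (2 * ll * sqrt (2 * ll / m)) + 13 + 4 * sqrt (2 * ll)"
    and B: "finite B" "\<And>q. q \<in> B \<Longrightarrow> prime q"
  defines "\<mu> \<equiv> (\<Sum>q\<in>B. mp q)"
  assumes \<mu>: "(1 - \<epsilon>\<^sup>2 / 64) * n - 24 \<le> \<mu>" "\<mu> \<le> n"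
  shows "bprob mp B (\<lambda>S. s * (real (card S) - \<mu>) \<ge> (1 - \<epsilon> / 2) * phi n + 24) \<ge> exp (- (1 - \<epsilon> / 8) * ln (ln n))"
proof -
  define ll where "ll = ln (ln n)"
  define m where "m = (1 - \<epsilon>\<^sup>2 / 64) * n - 24"
  define c1 where "c1 = 1 - \<epsilon> / 4"
  have c1: "0 < c1" "c1 \<le> 1" using \<epsilon> by (auto simp: c1_def)
  have n1: "n > 1" and ll: "ll > 0" and m: "m \<ge> 12" and m4: "2 * ll / m \<le> 1 / 4"
    and thr: "sqrt (2 * c1 * ll * m) - 2 * ll - 30 - 4 * sqrt n \<ge> (1 - \<epsilon> / 2) * phi n"
    and ex: "\<epsilon> / 8 * ll \<ge> 2 * (2 * ll * sqrt (2 * ll / m)) + 13 + 4 * sqrt (2 * ll)"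
    using n unfolding Let_def ll_def m_def c1_def by auto
  have m\<mu>: "m \<le> \<mu>" using \<mu> by (simp add: m_def)
  define u where "u = sqrt (2 * c1 * ll / \<mu>)"
  define l where "l = s * u"
  have \<mu>0: "\<mu> > 0" using m m\<mu> by linarith
  have u2: "u\<^sup>2 = 2 * c1 * ll / \<mu>" unfolding u_def using c1 ll \<mu>0 by simp
  have u0: "u > 0" unfolding u_def using c1 ll \<mu>0 by simp
  have "2 * c1 * ll / \<mu> \<le> 2 * ll / m"
    using c1 ll m m\<mu> by (intro frac_le) (auto simp: mult_left_le_one_le)
  then have um: "u \<le> sqrt (2 * ll / m)" and u4: "u\<^sup>2 \<le> 1 / 4" using u2 m4 by (auto simp: u_def)
  have uhalf: "u \<le> 1 / 2" using u4 power2_le_imp_le[of u "1 / 2"] by (simp add: power_divide)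
  have labs: "\<bar>l\<bar> = u" "l\<^sup>2 = u\<^sup>2" "sgn l = s" "l \<noteq> 0" using s u0 by (auto simp: l_def)
  \<comment> \<open>A bound on the squares that is the same for all blocks; it is the 3 in the terms
    \<open>4 * 3\<close> and \<open>16 * u\<^sup>2 * 3\<close> below.\<close>
  have V: "(\<Sum>q\<in>B. (mp q)\<^sup>2) \<le> 3"
  proof -
    have "(\<Sum>q\<in>B. (mp q)\<^sup>2) \<le> (\<Sum>q\<in>B. 3 * (1 / (real q)\<^sup>2))"
      using mp_bounds(4) B(2) by (intro sum_mono) (simp add: prime_ge_2_nat)
    also have "\<dots> \<le> 3 * 1" unfolding sum_distrib_left[symmetric]
      using B by (intro mult_left_mono sum_inverse_squares_le) (auto simp: prime_ge_2_nat)
    finally show ?thesis by simp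
  qed
  have tail: "bprob mp B (\<lambda>S. s * (real (card S) - \<mu>) \<ge> (u - u\<^sup>2) * (\<mu> - 4 * 3) - 4 * sqrt \<mu>)
       \<ge> 3 / 4 * exp (- \<mu> * (u\<^sup>2 / 2 + 2 * u ^ 3) - 16 * u\<^sup>2 * 3 - 4 * u * sqrt \<mu>)"
    using bernoulli_lower_tail[of B mp 3 l] B mp_prime V labs uhalf m m\<mu> \<mu>0 unfolding \<mu>_def by simp
  have u\<mu>: "u * \<mu> = sqrt (2 * c1 * ll * \<mu>)"
  proof -
    have "(u * \<mu>)\<^sup>2 = 2 * c1 * ll * \<mu>" using \<mu>0 by (simp add: power_mult_distrib u2) (simp add: power2_eq_square)
    then show ?thesis using u0 \<mu>0 by (metis abs_of_pos mult_pos_pos real_sqrt_abs)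
  qed
  have u2\<mu>: "u\<^sup>2 * \<mu> = 2 * c1 * ll" using \<mu>0 by (simp add: u2)
  have c1ll: "c1 * ll \<le> ll" using c1 ll by (simp add: mult_left_le_one_le)
  have T: "(u - u\<^sup>2) * (\<mu> - 4 * 3) - 4 * sqrt \<mu> \<ge> (1 - \<epsilon> / 2) * phi n + 24"
  proof -
    have "(u - u\<^sup>2) * (\<mu> - 4 * 3) = u * \<mu> - u\<^sup>2 * \<mu> - 12 * u + 12 * u\<^sup>2" by (simp add: algebra_simps)
    moreover have "u * \<mu> \<ge> sqrt (2 * c1 * ll * m)" unfolding u\<mu> using m\<mu> c1 ll by (intro real_sqrt_le_mono mult_left_mono) auto
    moreover have "u\<^sup>2 * \<mu> \<le> 2 * ll" using u2\<mu> c1ll by simp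
    moreover have "sqrt \<mu> \<le> sqrt n" using \<mu>(2) by simp
    moreover have "u\<^sup>2 \<ge> 0" by simp
    ultimately show ?thesis using thr uhalf by linarith
  qed
  have E: "- \<mu> * (u\<^sup>2 / 2 + 2 * u ^ 3) - 16 * u\<^sup>2 * 3 - 4 * u * sqrt \<mu> \<ge> - (1 - \<epsilon> / 8) * ll + 1"
  proof -
    have "- \<mu> * (u\<^sup>2 / 2 + 2 * u ^ 3) = - (u\<^sup>2 * \<mu>) / 2 - 2 * (u\<^sup>2 * \<mu> * u)" by (simp add: algebra_simps power3_eq_cube power2_eq_square)
    also have "\<dots> = - c1 * ll - 2 * (2 * c1 * ll * u)" by (simp add: u2\<mu>)
    finally have 1: "- \<mu> * (u\<^sup>2 / 2 + 2 * u ^ 3) = - c1 * ll - 2 * (2 * c1 * ll * u)" .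
    have "2 * c1 * ll * u \<le> 2 * ll * sqrt (2 * ll / m)" using c1ll um u0 ll by (intro mult_mono) auto
    moreover have "u * sqrt \<mu> \<le> sqrt (2 * ll)"
    proof -
      have "u * sqrt \<mu> = sqrt (2 * c1 * ll)" unfolding u_def using \<mu>0 by (simp flip: real_sqrt_mult)
      then show ?thesis using c1ll by simp
    qed
    moreover have "c1 * ll = ll - \<epsilon> / 4 * ll" by (simp add: c1_def algebra_simps)
    moreover have "(1 - \<epsilon> / 8) * ll = ll - \<epsilon> / 8 * ll" by (simp add: algebra_simps)
    moreover have "\<epsilon> / 4 * ll = \<epsilon> / 8 * ll + \<epsilon> / 8 * ll" by (simp add: algebra_simps)
    ultimately show ?thesis using 1 u4 ex by linarith
  qed
  have "exp (- (1 - \<epsilon> / 8) * ll) \<le> 3 / 4 * exp (- (1 - \<epsilon> / 8) * ll + 1)"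
  proof -
    have "exp (1::real) \<ge> 1 + 1" by (rule exp_ge_add_one_self)
    then have "exp (- (1 - \<epsilon> / 8) * ll) * 1 \<le> exp (- (1 - \<epsilon> / 8) * ll) * (3 / 4 * exp 1)" by (intro mult_left_mono) auto
    then show ?thesis by (simp add: exp_add)
  qed
  also have "\<dots> \<le> 3 / 4 * exp (- \<mu> * (u\<^sup>2 / 2 + 2 * u ^ 3) - 16 * u\<^sup>2 * 3 - 4 * u * sqrt \<mu>)"
    using E by (intro mult_left_mono) (simp_all only: exp_le_cancel_iff)
  also have "\<dots> \<le> bprob mp B (\<lambda>S. s * (real (card S) - \<mu>) \<ge> (u - u\<^sup>2) * (\<mu> - 4 * 3) - 4 * sqrt \<mu>)" by (rule tail)
  also have "\<dots> \<le> bprob mp B (\<lambda>S. s * (real (card S) - \<mu>) \<ge> (1 - \<epsilon> / 2) * phi n + 24)"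
    using T B mp_prime by (intro bprob_mono) auto
  finally show ?thesis by (simp add: ll_def)
qed


definition attains :: "real \<Rightarrow> real \<Rightarrow> real \<Rightarrow> real \<Rightarrow> nat set \<Rightarrow> bool" where
  "attains s \<epsilon> \<xi> T S \<longleftrightarrow> (\<exists>t. \<xi> < t \<and> t \<le> T \<and> s * (cnt S t - ln (ln t)) \<ge> (1 - \<epsilon>) * phi (ln (ln t)))"

lemma exp_exp_ge_3:
  assumes "u \<ge> (1::real)"
  shows "exp (exp u) \<ge> 3"
proof -
  have "exp u \<ge> 1 + u" by (rule exp_ge_add_one_self)
  moreover have "exp (exp u) \<ge> 1 + exp u" by (rule exp_ge_add_one_self)
  ultimately show ?thesis using assms by linarith
qed

lemma le_exp_exp_iff:
  fixes t u :: real
  assumes "t \<ge> 3"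
  shows "t < exp (exp u) \<longleftrightarrow> ln (ln t) < u" "exp (exp u) \<le> t \<longleftrightarrow> u \<le> ln (ln t)"
proof -
  have "ln t > 0" using assms by simp
  then have t: "t = exp (exp (ln (ln t)))" using assms by simp
  show "t < exp (exp u) \<longleftrightarrow> ln (ln t) < u" by (subst t) simp
  show "exp (exp u) \<le> t \<longleftrightarrow> u \<le> ln (ln t)" by (subst (1) t) simp
qed

text \<open>A large ratio \<open>\<theta>\<close> lets one block dominate everything before it: by
  the upper half, the deviation inherited at its left end is at most \<open>\<epsilon> / 4\<close>
  times \<open>phi\<close> at its right end. A large deviation within a single block therefore
  becomes one of the whole count, and it is unlikely that all the independent blocks fail.\<close>

lemma model_lower:
  fixes \<epsilon> \<delta> s :: real
  assumes \<epsilon>: "0 < \<epsilon>" "\<epsilon> < 1" and \<delta>: "\<delta> > 0" and s: "s = 1 \<or> s = - 1"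
  shows "\<exists>\<Lambda>0. \<forall>\<xi> T. \<xi> \<ge> 3 \<and> T \<ge> 3 \<and> ln (ln \<xi>) \<ge> \<Lambda>0 \<and> ln (ln T) \<ge> ln (ln \<xi>) ^ 4 \<longrightarrow>
    bprob mp (primes_upto T) (\<lambda>S. \<not> attains s \<epsilon> \<xi> T S) \<le> \<delta>"
proof -
  obtain \<Lambda>1 where \<Lambda>1: "\<And>\<xi> T. \<xi> \<ge> 3 \<Longrightarrow> ln (ln \<xi>) \<ge> \<Lambda>1 \<Longrightarrow> bprob mp (primes_upto T) (deviates 1 \<xi> T) \<le> \<delta> / 2"
    using model_upper[of 1 "\<delta> / 2"] \<delta> by auto
  \<comment> \<open>\<open>phi\<close> grows at least like a square root, so this ratio ensures
    \<open>phi (\<theta> ^ k) \<le> \<epsilon> / 8 * phi (\<theta> ^ (k + 1))\<close>.\<close>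
  define \<theta> where "\<theta> = 64 / \<epsilon>\<^sup>2"
  have e1: "\<epsilon>\<^sup>2 < 1" using \<epsilon> by (simp add: power_less_one_iff)
  have \<theta>64: "\<theta> > 64" using \<epsilon> e1 by (simp add: \<theta>_def field_simps)
  then have \<theta>: "\<theta> > 1" by simp
  define c where "c = ln \<theta>"
  have c: "c > 0" using \<theta> by (simp add: c_def)
  let ?num = "\<lambda>n. let ll = ln (ln n); m = (1 - \<epsilon>\<^sup>2 / 64) * n - 24 in
    n > 1 \<and> ll > 0 \<and> m \<ge> 12 \<and> n * (\<epsilon>\<^sup>2 / 64) \<ge> 24 \<and> 2 * ll / m \<le> 1 / 4 \<and>
    sqrt (2 * (1 - \<epsilon> / 4) * ll * m) - 2 * ll - 30 - 4 * sqrt n \<ge> (1 - \<epsilon> / 2) * phi n \<and>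
    \<epsilon> / 8 * ll \<ge> 2 * (2 * ll * sqrt (2 * ll / m)) + 13 + 4 * sqrt (2 * ll)"
  obtain N0 where N0: "\<And>n. n \<ge> N0 \<Longrightarrow> ?num n"
    using lower_asymptotics[OF \<epsilon>] unfolding eventually_at_top_linorder by blast
  obtain K0 where K0: "N0 < \<theta> ^ K0" using real_arch_pow[OF \<theta>] by blast
  \<comment> \<open>At least \<open>k / 2\<close> blocks succeed with probability at least
    \<open>(k * c) powr (- (1 - \<epsilon> / 8))\<close> each: this lower bound for the expected
    number of successes grows like \<open>k powr (\<epsilon> / 8)\<close>.\<close>
  have "filterlim (\<lambda>k::nat. real k / 2 * (real k * c) powr (- (1 - \<epsilon> / 8))) at_top sequentially"
    using c \<epsilon> by real_asymp
  then have "eventually (\<lambda>k::nat. real k / 2 * (real k * c) powr (- (1 - \<epsilon> / 8)) \<ge> ln (2 / \<delta>)) sequentially"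
    by (simp only: filterlim_at_top)
  then obtain K1 where K1: "\<And>k. k \<ge> K1 \<Longrightarrow> real k / 2 * (real k * c) powr (- (1 - \<epsilon> / 8)) \<ge> ln (2 / \<delta>)"
    unfolding eventually_sequentially by blast
  define K where "K = max 1 (max K0 K1)"
  show ?thesis
  proof (intro exI[of _ "max \<Lambda>1 (\<theta> ^ K)"] allI impI)
    fix \<xi> T :: real
    assume as: "\<xi> \<ge> 3 \<and> T \<ge> 3 \<and> ln (ln \<xi>) \<ge> max \<Lambda>1 (\<theta> ^ K) \<and> ln (ln T) \<ge> ln (ln \<xi>) ^ 4"
    then have \<xi>3: "\<xi> \<ge> 3" and T3: "T \<ge> 3" and L\<xi>: "ln (ln \<xi>) \<ge> \<theta> ^ K" by auto
    have "\<theta> ^ K \<ge> 1" using \<theta> by simp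
    then have L\<xi>1: "ln (ln \<xi>) \<ge> 1" using L\<xi> by linarith
    obtain j where j: "\<theta> ^ j \<le> ln (ln \<xi>)" "ln (ln \<xi>) < \<theta> ^ (j + 1)"
      using exists_power_bracket[OF \<theta> L\<xi>1] by blast
    have "\<theta> ^ K < \<theta> ^ (j + 1)" using j L\<xi> by linarith
    then have "K < j + 1" using \<theta> by (simp only: power_strict_increasing_iff)
    then have Kj: "K \<le> j" by simp
    have LT1: "ln (ln T) \<ge> 1" using as L\<xi>1 one_le_power[OF L\<xi>1, of 4] by linarith
    obtain K2 where K2: "\<theta> ^ K2 \<le> ln (ln T)" "ln (ln T) < \<theta> ^ (K2 + 1)"
      using exists_power_bracket[OF \<theta> LT1] by blast
    have "\<theta> ^ (4 * j) = (\<theta> ^ j) ^ 4" by (simp add: power_mult mult.commute flip: power_mult)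
    also have "\<dots> \<le> ln (ln \<xi>) ^ 4" using j \<theta> by (intro power_mono) auto
    also have "\<dots> < \<theta> ^ (K2 + 1)" using as K2 by linarith
    finally have "4 * j < K2 + 1" using \<theta> by (simp only: power_strict_increasing_iff)
    moreover have "j \<ge> 1" using Kj by (simp add: K_def)
    \<comment> \<open>From \<open>4 * j \<le> K2\<close> and \<open>j \<ge> 1\<close>: the fourth
      power in the hypothesis leaves at least half of the indices below \<open>K2\<close> for
      use.\<close>
    ultimately have jK2: "2 * (j + 1) \<le> K2" "K \<le> K2" using Kj by auto
    \<comment> \<open>\<open>k > j\<close> puts the left end \<open>\<tau> k\<close> beyond
      \<open>\<xi>\<close>, and \<open>k < K2\<close> puts the right end
      \<open>\<tau> (k + 1)\<close> at or below \<open>T\<close>.\<close>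
    define I where "I = {j+1..<K2}"
    define \<tau> where "\<tau> = (\<lambda>k. exp (exp (\<theta> ^ k)))"
    define A where "A = primes_upto T"
    define B where "B = (\<lambda>k. primes_upto (\<tau> (k + 1)) - primes_upto (\<tau> k))"
    define \<mu> where "\<mu> = (\<lambda>k. \<Sum>q\<in>B k. mp q)"
    \<comment> \<open>The extra 24 pays for replacing \<open>\<mu> k\<close> by
      \<open>\<theta> ^ (k + 1) - \<theta> ^ k\<close>.\<close>
    define E where "E = (\<lambda>k (R :: nat set). s * (real (card R) - \<mu> k) \<ge> (1 - \<epsilon> / 2) * phi (\<theta> ^ (k + 1)) + 24)"
    have A: "finite A" "\<And>q. q \<in> A \<Longrightarrow> 0 \<le> mp q \<and> mp q \<le> 1" by (auto simp: A_def mp_prime)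
    have \<tau>3: "\<tau> k \<ge> 3" for k unfolding \<tau>_def using \<theta> by (intro exp_exp_ge_3) simp
    have \<tau>L: "ln (ln (\<tau> k)) = \<theta> ^ k" for k by (simp add: \<tau>_def)
    have \<tau>mono: "\<tau> i \<le> \<tau> k" if "i \<le> k" for i k unfolding \<tau>_def using that \<theta> by (simp add: power_increasing)
    have \<tau>T: "\<tau> k \<le> T" if "k \<le> K2" for k
    proof -
      have "\<tau> K2 \<le> T" unfolding \<tau>_def using le_exp_exp_iff(2)[OF T3] K2 by blast
      then show ?thesis using \<tau>mono[OF that] by linarith
    qed
    have finB: "finite (B k)" for k by (simp add: B_def)
    have BA: "B k \<subseteq> A" if "k \<in> I" for k
      using \<tau>T[of "k + 1"] that by (auto simp: B_def A_def I_def)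
    have disj: "disjoint_family_on B I"
    proof -
      have "B i \<inter> B k = {}" if "i < k" for i k
        using \<tau>mono[of "i + 1" k] that by (auto simp: B_def)
      then show ?thesis unfolding disjoint_family_on_def by (metis Int_commute linorder_neqE_nat)
    qed
    have \<mu>eq: "\<mu> k = mass mp A (\<tau> (k + 1)) - mass mp A (\<tau> k)" if "k \<in> I" for k
    proof -
      have eq: "{q. q \<in> A \<and> real q \<le> \<tau> i} = primes_upto (\<tau> i)" if "i \<le> K2" for i
        using \<tau>T[OF that] by (auto simp: A_def)
      have "primes_upto (\<tau> k) \<subseteq> primes_upto (\<tau> (k + 1))" using \<tau>mono[of k "k + 1"] by auto
      then have "(\<Sum>q\<in>B k. mp q) = (\<Sum>q\<in>primes_upto (\<tau> (k + 1)). mp q) - (\<Sum>q\<in>primes_upto (\<tau> k). mp q)"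
        unfolding B_def by (intro sum_diff) auto
      then show ?thesis unfolding \<mu>_def mass_def using eq[of k] eq[of "k + 1"] that by (simp add: I_def)
    qed
    have \<mu>approx: "\<bar>\<mu> k - (\<theta> ^ (k + 1) - \<theta> ^ k)\<bar> \<le> 24" if k: "k \<in> I" for k
    proof -
      have "\<bar>mass mp A (\<tau> i) - \<theta> ^ i\<bar> \<le> 12" if "i \<le> K2" for i
        using mass_mp_approx[of "\<tau> i" T] \<tau>3[of i] \<tau>T[OF that] unfolding A_def[symmetric] \<tau>L by linarith
      from this[of k] this[of "k + 1"] show ?thesis using k unfolding \<mu>eq[OF k] by (simp add: I_def)
    qed
    have num: "?num (\<theta> ^ (k + 1))" if "k \<in> I" for k
    proof (rule N0)
      have "\<theta> ^ K0 \<le> \<theta> ^ (k + 1)" using \<theta> Kj that by (intro power_increasing) (auto simp: K_def I_def)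
      then show "N0 \<le> \<theta> ^ (k + 1)" using K0 by linarith
    qed
    have quot: "\<theta> ^ (k + 1) * (\<epsilon>\<^sup>2 / 64) = \<theta> ^ k" for k using \<epsilon> by (simp add: \<theta>_def)
    have PE: "bprob mp (B k) (E k) \<ge> exp (- (1 - \<epsilon> / 8) * ln (ln (\<theta> ^ (k + 1))))" if k: "k \<in> I" for k
      unfolding E_def \<mu>_def
    proof (rule block_probability[OF \<epsilon> s num[OF k] finB])
      show "prime q" if "q \<in> B k" for q using that by (simp add: B_def)
      have "(1 - \<epsilon>\<^sup>2 / 64) * \<theta> ^ (k + 1) = \<theta> ^ (k + 1) - \<theta> ^ k" using quot[of k] by (simp add: algebra_simps)
      then show "(1 - \<epsilon>\<^sup>2 / 64) * \<theta> ^ (k + 1) - 24 \<le> (\<Sum>q\<in>B k. mp q)"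
        using \<mu>approx[OF k] unfolding \<mu>_def by linarith
      have "\<theta> ^ k \<ge> 24" using num[OF k] quot[of k] unfolding Let_def by linarith
      then show "(\<Sum>q\<in>B k. mp q) \<le> \<theta> ^ (k + 1)" using \<mu>approx[OF k] unfolding \<mu>_def by linarith
    qed
    have incl: "deviates 1 \<xi> T S \<or> (\<forall>k\<in>I. \<not> E k (S \<inter> B k))" if SA: "S \<subseteq> A" and na: "\<not> attains s \<epsilon> \<xi> T S" for S
    proof (rule ccontr)
      assume "\<not> (deviates 1 \<xi> T S \<or> (\<forall>k\<in>I. \<not> E k (S \<inter> B k)))"
      then obtain k where nd: "\<not> deviates 1 \<xi> T S" and k: "k \<in> I" and Ek: "E k (S \<inter> B k)" by auto
      define n where "n = \<theta> ^ (k + 1)"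
      have nk: "?num n" using num[OF k] by (simp only: n_def)
      have n1: "n > 1" and lln: "ln (ln n) > 0" using nk unfolding Let_def by auto
      have ph0: "phi n \<ge> 0" using n1 lln by (simp add: phi_def)
      have "\<theta> ^ (j + 1) \<le> \<theta> ^ k" using \<theta> k by (intro power_increasing) (auto simp: I_def)
      then have "ln (ln \<xi>) < \<theta> ^ k" using j by linarith
      then have \<xi>k: "\<xi> < \<tau> k" unfolding \<tau>_def using le_exp_exp_iff(1)[OF \<xi>3] by blast
      have kk: "\<tau> k \<le> T" "\<tau> (k + 1) \<le> T" using \<tau>T k by (auto simp: I_def)
      have "\<bar>cnt S (\<tau> k) - ln (ln (\<tau> k))\<bar> \<le> (1 + 1) * phi (ln (ln (\<tau> k)))"
        using nd \<xi>k kk unfolding deviates_def by (meson linorder_not_less)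
      then have d1: "\<bar>cnt S (\<tau> k) - \<theta> ^ k\<bar> \<le> 2 * phi (\<theta> ^ k)" by (simp add: \<tau>L)
      have "phi (\<theta> ^ k) \<le> \<epsilon> / 8 * phi n"
      proof -
        have "k \<ge> 1" using k by (simp add: I_def)
        then have tk: "\<theta> ^ k > 1" using \<theta> by (intro one_less_power) auto
        have "\<theta> ^ k \<le> n" unfolding n_def using \<theta> by (intro power_increasing) auto
        then have "ln (ln (\<theta> ^ k)) \<le> ln (ln n)" using tk by simp
        then have "2 * \<theta> ^ k * ln (ln (\<theta> ^ k)) \<le> 2 * \<theta> ^ k * ln (ln n)" using tk by (intro mult_left_mono) auto
        also have "\<dots> = (\<epsilon> / 8)\<^sup>2 * (2 * n * ln (ln n))" 
        proof -
          have tkn: "\<theta> ^ k = n * (\<epsilon>\<^sup>2 / 64)" unfolding n_def by (rule quot[symmetric])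
          show ?thesis unfolding tkn by (simp add: power_divide)
        qed
        finally have "phi (\<theta> ^ k) \<le> sqrt ((\<epsilon> / 8)\<^sup>2 * (2 * n * ln (ln n)))" unfolding phi_def by (rule real_sqrt_le_mono)
        also have "\<dots> = \<epsilon> / 8 * phi n" using \<epsilon> by (simp add: phi_def real_sqrt_mult)
        finally show ?thesis .
      qed
      then have d2: "\<bar>cnt S (\<tau> k) - \<theta> ^ k\<bar> \<le> \<epsilon> / 4 * phi n" using d1 by linarith
      have cn: "cnt S (\<tau> (k + 1)) = cnt S (\<tau> k) + real (card (S \<inter> B k))"
      proof -
        have fS: "finite S" using SA A(1) by (rule finite_subset)
        have "{q\<in>S. real q \<le> \<tau> (k + 1)} = {q\<in>S. real q \<le> \<tau> k} \<union> (S \<inter> B k)"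
          using SA \<tau>mono[of k "k + 1"] by (auto simp: B_def A_def)
        moreover have "card ({q\<in>S. real q \<le> \<tau> k} \<union> (S \<inter> B k)) = card {q\<in>S. real q \<le> \<tau> k} + card (S \<inter> B k)"
          using fS SA by (intro card_Un_disjoint) (auto simp: B_def A_def)
        ultimately show ?thesis by (simp add: cnt_def)
      qed
      have sabs: "\<bar>s * z\<bar> = \<bar>z\<bar>" for z using s by auto
      \<comment> \<open>The gain of the block, the deviation inherited from before it, and the
        Mertens error. The second is at most half of the room between
        \<open>1 - \<epsilon> / 2\<close> and \<open>1 - \<epsilon>\<close>.\<close>
      have "s * (cnt S (\<tau> (k + 1)) - n) = s * (real (card (S \<inter> B k)) - \<mu> k) + s * (cnt S (\<tau> k) - \<theta> ^ k) + s * (\<mu> k - (n - \<theta> ^ k))"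
        unfolding cn by (simp add: algebra_simps)
      moreover have "s * (real (card (S \<inter> B k)) - \<mu> k) \<ge> (1 - \<epsilon> / 2) * phi n + 24" using Ek by (simp add: E_def n_def)
      moreover have "\<bar>s * (cnt S (\<tau> k) - \<theta> ^ k)\<bar> \<le> \<epsilon> / 4 * phi n" unfolding sabs by (rule d2)
      moreover have "\<bar>s * (\<mu> k - (n - \<theta> ^ k))\<bar> \<le> 24" unfolding sabs n_def by (rule \<mu>approx[OF k])
      moreover have "(1 - \<epsilon> / 2) * phi n = (1 - \<epsilon>) * phi n + 2 * (\<epsilon> / 4 * phi n)" by (simp add: algebra_simps)
      moreover have "\<epsilon> / 4 * phi n \<ge> 0" using ph0 \<epsilon> by simp
      ultimately have "s * (cnt S (\<tau> (k + 1)) - n) \<ge> (1 - \<epsilon>) * phi n" unfolding abs_le_iff by linarith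
      moreover have "\<xi> < \<tau> (k + 1)" using \<xi>k \<tau>mono[of k "k + 1"] by simp
      ultimately have "attains s \<epsilon> \<xi> T S"
        unfolding attains_def using kk(2) by (intro exI[of _ "\<tau> (k + 1)"]) (simp only: \<tau>L n_def simp_thms)
      then show False using na by contradiction
    qed
    have "bprob mp A (\<lambda>S. \<not> attains s \<epsilon> \<xi> T S) \<le> bprob mp A (\<lambda>S. deviates 1 \<xi> T S \<or> (\<forall>k\<in>I. \<not> E k (S \<inter> B k)))"
      using A(2) incl by (intro bprob_mono) auto
    also have "\<dots> \<le> bprob mp A (deviates 1 \<xi> T) + bprob mp A (\<lambda>S. \<forall>k\<in>I. \<not> E k (S \<inter> B k))"
      by (rule bprob_disj[OF A(2)])
    also have "bprob mp A (deviates 1 \<xi> T) \<le> \<delta> / 2" unfolding A_def using as by (intro \<Lambda>1) auto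
    also have "bprob mp A (\<lambda>S. \<forall>k\<in>I. \<not> E k (S \<inter> B k)) \<le> \<delta> / 2"
    proof -
      define U where "U = (\<Union>k\<in>I. B k)"
      have UA: "U \<subseteq> A" using BA by (auto simp: U_def)
      have "(S \<inter> U) \<inter> B k = S \<inter> B k" if "k \<in> I" for S k using that by (auto simp: U_def)
      then have "bprob mp A (\<lambda>S. \<forall>k\<in>I. \<not> E k (S \<inter> B k)) = bprob mp A (\<lambda>S. \<forall>k\<in>I. \<not> E k ((S \<inter> U) \<inter> B k))" by simp
      also have "\<dots> = bprob mp U (\<lambda>S. \<forall>k\<in>I. \<not> E k (S \<inter> B k))"
        by (rule bprob_restrict[OF A(1) UA, of mp "\<lambda>S. \<forall>k\<in>I. \<not> E k (S \<inter> B k)"])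
      also have "\<dots> = (\<Prod>k\<in>I. bprob mp (B k) (\<lambda>R. \<not> E k R))"
        unfolding U_def by (intro bprob_indep_family finB disj) (auto simp: I_def)
      also have "\<dots> \<le> (\<Prod>k\<in>I. exp (- ((real K2 * c) powr (- (1 - \<epsilon> / 8)))))"
      proof (intro prod_mono conjI)
        fix k assume k: "k \<in> I"
        show "0 \<le> bprob mp (B k) (\<lambda>R. \<not> E k R)" using BA[OF k] A(2) by (intro bprob_nonneg) auto
        have kpos: "real (k + 1) * c > 0" using c by simp
        have "(real K2 * c) powr (- (1 - \<epsilon> / 8)) \<le> (real (k + 1) * c) powr (- (1 - \<epsilon> / 8))"
        proof (rule powr_mono2')
          have "real (k + 1) \<le> real K2" using k by (simp add: I_def)
          then show "real (k + 1) * c \<le> real K2 * c" using c by (intro mult_right_mono) auto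
        qed (use \<epsilon> kpos in auto)
        also have "\<dots> = exp (- (1 - \<epsilon> / 8) * ln (ln (\<theta> ^ (k + 1))))"
        proof -
          have "ln (\<theta> ^ (k + 1)) = real (k + 1) * c" unfolding c_def by (rule ln_realpow)
          then show ?thesis using kpos unfolding powr_def by (simp only: less_irrefl if_False split: if_split) auto
        qed
        also have "\<dots> \<le> bprob mp (B k) (E k)" by (rule PE[OF k])
        finally have "bprob mp (B k) (\<lambda>R. \<not> E k R) \<le> 1 + - ((real K2 * c) powr (- (1 - \<epsilon> / 8)))"
          unfolding bprob_not[OF finB] by linarith
        also have "\<dots> \<le> exp (- ((real K2 * c) powr (- (1 - \<epsilon> / 8))))" by (rule exp_ge_add_one_self)
        finally show "bprob mp (B k) (\<lambda>R. \<not> E k R) \<le> exp (- ((real K2 * c) powr (- (1 - \<epsilon> / 8))))" .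
      qed
      also have "\<dots> = exp (- (real (card I) * (real K2 * c) powr (- (1 - \<epsilon> / 8))))"
        by (simp add: exp_of_nat_mult[symmetric])
      also have "\<dots> \<le> exp (- ln (2 / \<delta>))"
      proof -
        have "real K2 / 2 \<le> real (card I)" using jK2 by (simp add: I_def)
        then have "real K2 / 2 * (real K2 * c) powr (- (1 - \<epsilon> / 8)) \<le> real (card I) * (real K2 * c) powr (- (1 - \<epsilon> / 8))"
          by (intro mult_right_mono) auto
        then show ?thesis using K1[of K2] jK2(2) by (simp add: K_def)
      qed
      also have "\<dots> = \<delta> / 2" using \<delta> by (simp add: exp_minus)
      finally show ?thesis .
    qed
    finally show "bprob mp (primes_upto T) (\<lambda>S. \<not> attains s \<epsilon> \<xi> T S) \<le> \<delta>" by (simp add: A_def)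
  qed
qed

section \<open>Transfer to shifted primes\<close>

definition wt :: "nat \<Rightarrow> real" where
  "wt q = real q / (real q - 1)\<^sup>2"

lemma wt_bounds:
  assumes "prime q"
  shows "wt q \<ge> 0" "wt q \<le> 1 / real q + 8 * (1 / (real q)\<^sup>2)" "wt q \<le> 4 * (1 / real q)"
    "mp q = wt q / (1 + wt q)" "1 - mp q = 1 / (1 + wt q)"
proof -
  have q: "real q \<ge> 2" using prime_ge_2_nat[OF assms] by simp
  show 0: "wt q \<ge> 0" by (simp add: wt_def)
  have sq: "(real q - 1)\<^sup>2 \<ge> (real q / 2)\<^sup>2" using q by (intro power_mono) auto
  then have sq': "4 * (real q - 1)\<^sup>2 \<ge> (real q)\<^sup>2" by (simp add: power_divide)
  have d: "(real q - 1)\<^sup>2 > 0" using q by simp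
  have "wt q \<le> real q / (real q / 2)\<^sup>2" unfolding wt_def using sq q d by (intro divide_left_mono) auto
  also have "\<dots> = 4 * (1 / real q)" using q by (simp add: power_divide power2_eq_square)
  finally show "wt q \<le> 4 * (1 / real q)" .
  have "wt q - 1 / real q = ((real q)\<^sup>2 - (real q - 1)\<^sup>2) / (real q * (real q - 1)\<^sup>2)"
    unfolding wt_def using q d by (simp add: diff_frac_eq power2_eq_square)
  also have "(real q)\<^sup>2 - (real q - 1)\<^sup>2 = 2 * real q - 1" by (simp add: power2_eq_square algebra_simps)
  also have "(2 * real q - 1) / (real q * (real q - 1)\<^sup>2) \<le> (2 * real q) / (real q * (real q / 2)\<^sup>2)"
    using sq q d by (intro frac_le mult_left_mono) auto
  also have "\<dots> = 8 * (1 / (real q)\<^sup>2)" using q by (simp add: power_divide)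
  finally show "wt q \<le> 1 / real q + 8 * (1 / (real q)\<^sup>2)" by simp
  have e: "1 + wt q = ((real q)\<^sup>2 - real q + 1) / (real q - 1)\<^sup>2"
    unfolding wt_def using d by (simp add: field_simps) (simp add: power2_eq_square algebra_simps)
  show m: "mp q = wt q / (1 + wt q)" unfolding e unfolding wt_def mp_def using d by simp
  show "1 - mp q = 1 / (1 + wt q)" unfolding m using 0 by (simp add: field_simps)
qed

text \<open>19 is the 11 of \<open>mertens\<close> plus 8, since \<open>wt q\<close> exceeds
  \<open>1 / q\<close> by at most \<open>8 / q\<^sup>2\<close>.\<close>

lemma sum_wt_le:
  assumes "T \<ge> 2"
  shows "(\<Sum>q\<in>primes_upto T. wt q) \<le> ln (ln T) + 19"
proof -
  have "(\<Sum>q\<in>primes_upto T. wt q) \<le> (\<Sum>q\<in>primes_upto T. 1 / real q + 8 * (1 / (real q)\<^sup>2))"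
    by (intro sum_mono wt_bounds) auto
  also have "\<dots> = (\<Sum>q\<in>primes_upto T. 1 / real q) + 8 * (\<Sum>q\<in>primes_upto T. 1 / (real q)\<^sup>2)"
    by (simp add: sum.distrib sum_distrib_left)
  also have "\<dots> \<le> (ln (ln T) + 11) + 8 * 1"
    using mertens[OF assms] by (intro add_mono mult_left_mono sum_inverse_squares_le) (auto simp: prime_ge_2_nat)
  finally show ?thesis by simp
qed

lemma prod_one_plus_le_exp_sum:
  fixes f :: "'a \<Rightarrow> real"
  assumes "finite A" "\<And>x. x \<in> A \<Longrightarrow> 0 \<le> f x"
  shows "(\<Prod>x\<in>A. 1 + f x) \<le> exp (\<Sum>x\<in>A. f x)"
proof -
  have "(\<Prod>x\<in>A. 1 + f x) \<le> (\<Prod>x\<in>A. exp (f x))"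
    using assms by (intro prod_mono) (auto simp: exp_ge_add_one_self)
  then show ?thesis using assms by (simp add: exp_sum)
qed

text \<open>Because \<open>wt q\<close> is the odds of \<open>mp q\<close>, the factor
  \<open>1 + wt q\<close> turns \<open>mp q\<close> into \<open>wt q\<close> on \<open>S\<close> and
  \<open>1 - mp q\<close> into 1 off \<open>S\<close>.\<close>

lemma sum_wt_eq_bprob:
  shows "(\<Sum>S | S \<subseteq> primes_upto T \<and> X S. \<Prod>q\<in>S. wt q) = (\<Prod>q\<in>primes_upto T. 1 + wt q) * bprob mp (primes_upto T) X"
proof -
  let ?A = "primes_upto T"
  have "(\<Prod>q\<in>S. wt q) = (\<Prod>q\<in>?A. 1 + wt q) * ((\<Prod>q\<in>S. mp q) * (\<Prod>q\<in>?A - S. 1 - mp q))" if "S \<subseteq> ?A" for S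
  proof -
    have pos: "1 + wt q > 0" if "q \<in> ?A" for q using that wt_bounds(1)[of q] by auto
    have "(\<Prod>q\<in>?A. 1 + wt q) = (\<Prod>q\<in>S. 1 + wt q) * (\<Prod>q\<in>?A - S. 1 + wt q)"
      using that by (simp add: prod.subset_diff mult.commute)
    then have "(\<Prod>q\<in>?A. 1 + wt q) * ((\<Prod>q\<in>S. mp q) * (\<Prod>q\<in>?A - S. 1 - mp q)) =
      (\<Prod>q\<in>S. (1 + wt q) * mp q) * (\<Prod>q\<in>?A - S. (1 + wt q) * (1 - mp q))"
      by (simp add: prod.distrib mult_ac)
    also have "(\<Prod>q\<in>S. (1 + wt q) * mp q) = (\<Prod>q\<in>S. wt q)"
    proof (intro prod.cong refl)
      fix q assume "q \<in> S"
      then have "q \<in> ?A" using that by auto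
      then show "(1 + wt q) * mp q = wt q" using pos[of q] wt_bounds(4)[of q] by simp
    qed
    also have "(\<Prod>q\<in>?A - S. (1 + wt q) * (1 - mp q)) = 1"
    proof (intro prod.neutral ballI)
      fix q assume "q \<in> ?A - S"
      then have "q \<in> ?A" by auto
      then show "(1 + wt q) * (1 - mp q) = 1" using pos[of q] wt_bounds(5)[of q] by simp
    qed
    finally show ?thesis by simp
  qed
  then have "(\<Sum>S | S \<subseteq> ?A \<and> X S. \<Prod>q\<in>S. wt q) = (\<Sum>S | S \<subseteq> ?A \<and> X S. (\<Prod>q\<in>?A. 1 + wt q) * ((\<Prod>q\<in>S. mp q) * (\<Prod>q\<in>?A - S. 1 - mp q)))"
    by (intro sum.cong) auto
  also have "\<dots> = (\<Prod>q\<in>?A. 1 + wt q) * (\<Sum>S | S \<subseteq> ?A \<and> X S. (\<Prod>q\<in>S. mp q) * (\<Prod>q\<in>?A - S. 1 - mp q))"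
    by (simp add: sum_distrib_left)
  also have "(\<Sum>S | S \<subseteq> ?A \<and> X S. (\<Prod>q\<in>S. mp q) * (\<Prod>q\<in>?A - S. 1 - mp q)) = bprob mp ?A X"
    unfolding bprob_def bexp_def by (intro sum.mono_neutral_cong_left) auto
  finally show ?thesis .
qed

section \<open>Counting shifted primes by their prime factors\<close>

definition sprimes :: "int \<Rightarrow> real \<Rightarrow> nat set" where
  "sprimes a x = {p. prime p \<and> \<bar>a\<bar> + 1 < int p \<and> real p \<le> x}"

definition shift :: "int \<Rightarrow> nat \<Rightarrow> nat" where
  "shift a p = nat (int p + a)"

lemma finite_sprimes [simp]: "finite (sprimes a x)"
  by (rule finite_subset[of _ "primes_upto x"]) (auto simp: sprimes_def)

lemma sifted_eq: "sifted a x T S = {p\<in>sprimes a x. \<Prod>S dvd shift a p \<and> (\<forall>q. prime q \<and> q dvd shift a p \<and> real q \<le> T \<longrightarrow> q \<in> S)}"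
  by (auto simp: sifted_def sprimes_def shift_def)

lemma shift_bounds:
  assumes "p \<in> sprimes a x"
  shows "shift a p \<ge> 2" "real (shift a p) \<le> x + real_of_int \<bar>a\<bar>"
proof -
  have p: "\<bar>a\<bar> + 1 < int p" "real p \<le> x" using assms by (auto simp: sprimes_def)
  show "shift a p \<ge> 2" using p by (simp add: shift_def le_nat_iff)
  have "real (shift a p) = real_of_int (int p + a)" using p by (simp add: shift_def)
  also have "\<dots> \<le> x + real_of_int \<bar>a\<bar>" using p by simp
  finally show "real (shift a p) \<le> x + real_of_int \<bar>a\<bar>" .
qed

text \<open>With \<open>T = 2\<close> the sieve prescribes at most the parity of
  \<open>p + a\<close>, so \<open>S\<close> and \<open>insert 2 S\<close> together cover all cases.
  The second set may double the product, hence the factor 2 in the size condition;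
  \<open>wt 2 = 2\<close> gives \<open>3 = 1 + 2\<close>.\<close>

lemma card_dvd_shift_le:
  fixes a :: int
  assumes a: "a \<noteq> 0"
  obtains C X0 where "C > 0"
    "\<And>x S. X0 \<le> x \<Longrightarrow> finite S \<Longrightarrow> \<forall>q\<in>S. prime q \<Longrightarrow> 2 * real (\<Prod>S) \<le> sqrt x \<Longrightarrow>
    real (card {p\<in>sprimes a x. \<Prod>S dvd shift a p}) \<le> C * (x / ln x) * (\<Prod>q\<in>S. wt q)"
proof -
  obtain C X0 where C: "C > 0" and X0: "\<And>x T S. x \<ge> X0 \<Longrightarrow> 2 \<le> T \<Longrightarrow> T \<le> x powr (1/40) \<Longrightarrow> finite S \<Longrightarrow> (\<forall>q\<in>S. prime q) \<Longrightarrow>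
    real (\<Prod>S) \<le> sqrt x \<Longrightarrow> real (card (sifted a x T S)) \<le> C * (x / (ln x * ln T)) * (\<Prod>q\<in>S. real q / (real q - 1)\<^sup>2)"
    using card_sifted_le[OF a] by blast
  have "eventually (\<lambda>x::real. 2 \<le> x powr (1/40) \<and> x \<ge> 3) at_top"
    by (intro eventually_conj eventually_ge_at_top) real_asymp
  then obtain X1 :: real where X1: "\<And>x. x \<ge> X1 \<Longrightarrow> 2 \<le> x powr (1/40) \<and> x \<ge> 3"
    unfolding eventually_at_top_linorder by blast
  have Cpos: "3 * C / ln 2 > 0" using C by simp
  show ?thesis
  proof (rule that[OF Cpos, of "max X0 X1"])
    fix x :: real and S
    assume x: "max X0 X1 \<le> x" and S: "finite S" "\<forall>q\<in>S. prime q" and m: "2 * real (\<Prod>S) \<le> sqrt x"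
    have x3: "x \<ge> 3" and x40: "2 \<le> x powr (1/40)" using X1 x by auto
    define W where "W = (\<Prod>q\<in>S. wt q)"
    have W0: "W \<ge> 0" unfolding W_def using S wt_bounds(1) by (intro prod_nonneg) auto
    define Y where "Y = C * (x / (ln x * ln 2))"
    have Y0: "Y \<ge> 0" unfolding Y_def using C x3 by simp
    have m0: "real (\<Prod>S) \<ge> 0" by (rule of_nat_0_le_iff)
    have bd: "real (card (sifted a x 2 R)) \<le> Y * (\<Prod>q\<in>R. wt q)" if "finite R" "\<forall>q\<in>R. prime q" "real (\<Prod>R) \<le> sqrt x" for R
      unfolding wt_def Y_def using X0[of x 2 R] x x40 that by auto
    have 1: "real (card (sifted a x 2 S)) \<le> Y * W"
      unfolding W_def using S m m0 by (intro bd) (assumption | linarith)+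
    have 2: "real (card (sifted a x 2 (insert 2 S))) \<le> 2 * (Y * W)"
    proof (cases "2 \<in> S")
      case True
      then have "insert 2 S = S" by auto
      moreover have "Y * W \<ge> 0" using Y0 W0 by simp
      ultimately show ?thesis using 1 by simp
    next
      case False
      then have "\<Prod>(insert 2 S) = 2 * \<Prod>S" using S by simp
      then have "real (\<Prod>(insert 2 S)) \<le> sqrt x" using m by (simp only: of_nat_mult of_nat_numeral)
      then have "real (card (sifted a x 2 (insert 2 S))) \<le> Y * (\<Prod>q\<in>insert 2 S. wt q)" using S by (intro bd) auto
      also have "(\<Prod>q\<in>insert 2 S. wt q) = 2 * W" using False S by (simp add: W_def wt_def)
      finally show ?thesis by simp
    qed
    have "{p\<in>sprimes a x. \<Prod>S dvd shift a p} \<subseteq> sifted a x 2 S \<union> sifted a x 2 (insert 2 S)"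
    proof
      fix p assume p: "p \<in> {p\<in>sprimes a x. \<Prod>S dvd shift a p}"
      have q2: "q = 2" if "prime q" "real q \<le> 2" for q :: nat
        using that prime_ge_2_nat[of q] by simp
      show "p \<in> sifted a x 2 S \<union> sifted a x 2 (insert 2 S)"
      proof (cases "2 dvd shift a p \<and> 2 \<notin> S")
        case True
        have "\<Prod>(insert 2 S) dvd shift a p"
        proof (rule prod_primes_dvd)
          fix q assume q: "q \<in> insert 2 S"
          show "q dvd shift a p"
          proof (cases "q = 2")
            case False
            then have "q dvd \<Prod>S" using q S by (intro dvd_prodI) auto
            then show ?thesis using p dvd_trans by blast
          qed (use True in simp)
        qed (use S in auto)
        then show ?thesis using p q2 by (auto simp: sifted_eq)
      next
        case False
        then show ?thesis using p q2 by (auto simp: sifted_eq)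
      qed
    qed
    then have "card {p\<in>sprimes a x. \<Prod>S dvd shift a p} \<le> card (sifted a x 2 S \<union> sifted a x 2 (insert 2 S))"
      by (intro card_mono) (auto simp: sifted_eq)
    also have "\<dots> \<le> card (sifted a x 2 S) + card (sifted a x 2 (insert 2 S))" by (rule card_Un_le)
    finally have "real (card {p\<in>sprimes a x. \<Prod>S dvd shift a p}) \<le> 3 * (Y * W)" using 1 2 by linarith
    also have "\<dots> = 3 * C / ln 2 * (x / ln x) * W" by (simp add: Y_def mult.commute)
    finally show "real (card {p\<in>sprimes a x. \<Prod>S dvd shift a p}) \<le> 3 * C / ln 2 * (x / ln x) * (\<Prod>q\<in>S. wt q)"
      by (simp add: W_def)
  qed
qed


definition pdiv :: "real \<Rightarrow> nat \<Rightarrow> nat set" where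
  "pdiv T n = {q\<in>primes_upto T. q dvd n}"

lemma pdiv_subset: "pdiv T n \<subseteq> primes_upto T"
  by (auto simp: pdiv_def)

lemma prod_pdiv_dvd: "\<Prod>(pdiv T n) dvd n"
  by (rule prod_primes_dvd[OF finite_subset[OF pdiv_subset finite_primes_upto]]) (auto simp: pdiv_def)

text \<open>
  The distribution of the set of small prime factors of \<open>p + a\<close> is dominated, up to a constant,
  by independent choices. Since only exceptional sets are to be bounded, no lower bound is needed.
\<close>
lemma card_pdiv_le_bprob:
  fixes a :: int
  assumes a: "a \<noteq> 0"
  obtains C X0 where "C > 0"
    "\<And>x T X. X0 \<le> x \<Longrightarrow> 2 \<le> T \<Longrightarrow> T \<le> x powr (1/40) \<Longrightarrow>
    real (card {p\<in>sprimes a x. real (\<Prod>(pdiv T (shift a p))) \<le> sqrt x \<and> X (pdiv T (shift a p))})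
      \<le> C * (x / ln x) * bprob mp (primes_upto T) X"
proof -
  obtain C X0 where C: "C > 0" and X0: "\<And>x T S. x \<ge> X0 \<Longrightarrow> 2 \<le> T \<Longrightarrow> T \<le> x powr (1/40) \<Longrightarrow> finite S \<Longrightarrow> (\<forall>q\<in>S. prime q) \<Longrightarrow>
    real (\<Prod>S) \<le> sqrt x \<Longrightarrow> real (card (sifted a x T S)) \<le> C * (x / (ln x * ln T)) * (\<Prod>q\<in>S. wt q)"
    using card_sifted_le[OF a] unfolding wt_def by blast
  have Cpos: "C * exp 19 > 0" using C by simp
  show ?thesis
  proof (rule that[OF Cpos, of "max X0 3"])
    fix x T :: real and X
    assume x: "max X0 3 \<le> x" and T: "2 \<le> T" "T \<le> x powr (1/40)"
    define A where "A = primes_upto T"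
    define \<S> where "\<S> = {S. S \<subseteq> A \<and> real (\<Prod>S) \<le> sqrt x \<and> X S}"
    define Y where "Y = C * (x / (ln x * ln T))"
    have lnT: "ln T > 0" and lnx: "ln x > 0" using T x by auto
    have Y0: "Y \<ge> 0" unfolding Y_def using C lnT lnx x by simp
    have fin: "finite \<S>" unfolding \<S>_def by (rule finite_subset[of _ "Pow A"]) (auto simp: A_def)
    have fA: "finite S" if "S \<subseteq> A" for S using that by (rule finite_subset) (simp add: A_def)
    have wtA: "wt q \<ge> 0" if "q \<in> A" for q using that wt_bounds(1) by (simp add: A_def)
    have "{p\<in>sprimes a x. real (\<Prod>(pdiv T (shift a p))) \<le> sqrt x \<and> X (pdiv T (shift a p))} \<subseteq> (\<Union>S\<in>\<S>. sifted a x T S)"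
    proof
      fix p assume p: "p \<in> {p\<in>sprimes a x. real (\<Prod>(pdiv T (shift a p))) \<le> sqrt x \<and> X (pdiv T (shift a p))}"
      then have "pdiv T (shift a p) \<in> \<S>" unfolding \<S>_def A_def using pdiv_subset by blast
      moreover have "p \<in> sifted a x T (pdiv T (shift a p))"
        unfolding sifted_eq using p prod_pdiv_dvd by (simp add: pdiv_def)
      ultimately show "p \<in> (\<Union>S\<in>\<S>. sifted a x T S)" by blast
    qed
    then have "card {p\<in>sprimes a x. real (\<Prod>(pdiv T (shift a p))) \<le> sqrt x \<and> X (pdiv T (shift a p))} \<le> card (\<Union>S\<in>\<S>. sifted a x T S)"
      using fin by (intro card_mono) (auto simp: sifted_eq)
    also have "\<dots> \<le> (\<Sum>S\<in>\<S>. card (sifted a x T S))" using fin by (rule card_UN_le)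
    finally have "real (card {p\<in>sprimes a x. real (\<Prod>(pdiv T (shift a p))) \<le> sqrt x \<and> X (pdiv T (shift a p))}) \<le> (\<Sum>S\<in>\<S>. real (card (sifted a x T S)))"
      by (simp only: of_nat_sum[symmetric] of_nat_le_iff)
    also have "\<dots> \<le> (\<Sum>S\<in>\<S>. Y * (\<Prod>q\<in>S. wt q))"
    proof (rule sum_mono)
      fix S assume S: "S \<in> \<S>"
      then have "S \<subseteq> A" "real (\<Prod>S) \<le> sqrt x" by (auto simp: \<S>_def)
      then show "real (card (sifted a x T S)) \<le> Y * (\<Prod>q\<in>S. wt q)"
        unfolding Y_def using X0[of x T S] x T fA[of S] by (auto simp: A_def)
    qed
    also have "\<dots> \<le> (\<Sum>S | S \<subseteq> A \<and> X S. Y * (\<Prod>q\<in>S. wt q))"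
    proof (rule sum_mono2)
      show "finite {S. S \<subseteq> A \<and> X S}" by (rule finite_subset[of _ "Pow A"]) (auto simp: A_def)
      show "\<S> \<subseteq> {S. S \<subseteq> A \<and> X S}" by (auto simp: \<S>_def)
      show "0 \<le> Y * (\<Prod>q\<in>S. wt q)" if "S \<in> {S. S \<subseteq> A \<and> X S} - \<S>" for S
        using that Y0 wtA by (intro mult_nonneg_nonneg prod_nonneg) auto
    qed
    also have "\<dots> = Y * ((\<Prod>q\<in>A. 1 + wt q) * bprob mp A X)"
      unfolding sum_distrib_left[symmetric] A_def sum_wt_eq_bprob ..
    \<comment> \<open>The normalising product is at most a constant times \<open>ln T\<close>, which
      cancels the \<open>1 / ln T\<close> of the sieve bound.\<close>
    also have "\<dots> \<le> Y * ((exp 19 * ln T) * bprob mp A X)"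
    proof (intro mult_left_mono mult_right_mono Y0)
      have "(\<Prod>q\<in>A. 1 + wt q) \<le> exp (\<Sum>q\<in>A. wt q)" using wtA by (intro prod_one_plus_le_exp_sum) (auto simp: A_def)
      also have "\<dots> \<le> exp (ln (ln T) + 19)" unfolding A_def using sum_wt_le[OF T(1)] by simp
      also have "\<dots> = exp 19 * ln T" using lnT by (simp add: exp_add)
      finally show "(\<Prod>q\<in>A. 1 + wt q) \<le> exp 19 * ln T" .
      show "0 \<le> bprob mp A X" using mp_prime by (intro bprob_nonneg) (auto simp: A_def)
    qed
    also have "\<dots> = C * exp 19 * (x / ln x) * bprob mp A X" using lnT by (simp add: Y_def)
    finally show "real (card {p\<in>sprimes a x. real (\<Prod>(pdiv T (shift a p))) \<le> sqrt x \<and> X (pdiv T (shift a p))})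
      \<le> C * exp 19 * (x / ln x) * bprob mp (primes_upto T) X" by (simp add: A_def)
  qed
qed

text \<open>This disposes of those \<open>p\<close> for which the small prime factors of
  \<open>p + a\<close> have too large a product for the sieve. It is a union bound over sets of size
  \<open>K\<close> with Rankin's trick: inserting \<open>(1/2) ^ K * 2 ^ K\<close> makes it
  affordable to sum over all subsets, and that sum is a product of order at most
  \<open>(ln T)\<^sup>2\<close>.\<close>

lemma card_many_divisors_le:
  fixes a :: int
  assumes a: "a \<noteq> 0"
  obtains C X0 where "C > 0"
    "\<And>x T K. X0 \<le> x \<Longrightarrow> 2 \<le> T \<Longrightarrow> 2 * T ^ K \<le> sqrt x \<Longrightarrow>
    real (card {p\<in>sprimes a x. K \<le> card (pdiv T (shift a p))}) \<le> C * (x / ln x) * ((1/2) ^ K * (ln T)\<^sup>2)"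
proof -
  obtain C X0 where C: "C > 0" and X0: "\<And>x S. x \<ge> X0 \<Longrightarrow> finite S \<Longrightarrow> (\<forall>q\<in>S. prime q) \<Longrightarrow> 2 * real (\<Prod>S) \<le> sqrt x \<Longrightarrow>
    real (card {p\<in>sprimes a x. \<Prod>S dvd shift a p}) \<le> C * (x / ln x) * (\<Prod>q\<in>S. wt q)"
    by (rule card_dvd_shift_le[OF a], rule that, assumption, blast)
  have Cpos: "C * exp 38 > 0" using C by simp
  show ?thesis
  proof (rule that[OF Cpos, of "max X0 3"])
    fix x T :: real and K
    assume x: "max X0 3 \<le> x" and T: "2 \<le> T" and TK: "2 * T ^ K \<le> sqrt x"
    define A where "A = primes_upto T"
    define \<S> where "\<S> = {S. S \<subseteq> A \<and> card S = K}"
    define Y where "Y = C * (x / ln x)"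
    have lnT: "ln T > 0" and lnx: "ln x > 0" using T x by auto
    have Y0: "Y \<ge> 0" unfolding Y_def using C lnx x by simp
    have fin: "finite \<S>" unfolding \<S>_def by (rule finite_subset[of _ "Pow A"]) (auto simp: A_def)
    have fA: "finite S" if "S \<subseteq> A" for S using that by (rule finite_subset) (simp add: A_def)
    have wtA: "wt q \<ge> 0" if "q \<in> A" for q using that wt_bounds(1) by (simp add: A_def)
    have "{p\<in>sprimes a x. K \<le> card (pdiv T (shift a p))} \<subseteq> (\<Union>S\<in>\<S>. {p\<in>sprimes a x. \<Prod>S dvd shift a p})"
    proof
      fix p assume p: "p \<in> {p\<in>sprimes a x. K \<le> card (pdiv T (shift a p))}"
      then obtain S where S: "S \<subseteq> pdiv T (shift a p)" "card S = K"
        using obtain_subset_with_card_n[of K "pdiv T (shift a p)"] by blast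
      then have "S \<in> \<S>" using pdiv_subset[of T "shift a p"] by (auto simp: \<S>_def A_def)
      moreover have "\<Prod>S dvd \<Prod>(pdiv T (shift a p))"
        using S(1) by (intro prod_dvd_prod_subset finite_subset[OF pdiv_subset finite_primes_upto])
      ultimately show "p \<in> (\<Union>S\<in>\<S>. {p\<in>sprimes a x. \<Prod>S dvd shift a p})"
        using p prod_pdiv_dvd[of T "shift a p"] dvd_trans by blast
    qed
    then have "card {p\<in>sprimes a x. K \<le> card (pdiv T (shift a p))} \<le> card (\<Union>S\<in>\<S>. {p\<in>sprimes a x. \<Prod>S dvd shift a p})"
      using fin by (intro card_mono) auto
    also have "\<dots> \<le> (\<Sum>S\<in>\<S>. card {p\<in>sprimes a x. \<Prod>S dvd shift a p})" using fin by (rule card_UN_le)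
    finally have "real (card {p\<in>sprimes a x. K \<le> card (pdiv T (shift a p))}) \<le> (\<Sum>S\<in>\<S>. real (card {p\<in>sprimes a x. \<Prod>S dvd shift a p}))"
      by (simp only: of_nat_sum[symmetric] of_nat_le_iff)
    also have "\<dots> \<le> (\<Sum>S\<in>\<S>. Y * ((1/2) ^ K * (\<Prod>q\<in>S. 2 * wt q)))"
    proof (rule sum_mono)
      fix S assume S: "S \<in> \<S>"
      then have SA: "S \<subseteq> A" and cS: "card S = K" by (auto simp: \<S>_def)
      have "real (\<Prod>S) \<le> (\<Prod>q\<in>S. T)" unfolding of_nat_prod using SA by (intro prod_mono) (auto simp: A_def)
      also have "\<dots> = T ^ K" using cS by simp
      finally have "2 * real (\<Prod>S) \<le> sqrt x" using TK by linarith
      then have "real (card {p\<in>sprimes a x. \<Prod>S dvd shift a p}) \<le> Y * (\<Prod>q\<in>S. wt q)"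
        unfolding Y_def using X0[of x S] x fA[OF SA] SA by (auto simp: A_def)
      also have "(\<Prod>q\<in>S. wt q) = (1/2) ^ K * (\<Prod>q\<in>S. 2 * wt q)"
        by (simp add: prod.distrib cS power_one_over)
      finally show "real (card {p\<in>sprimes a x. \<Prod>S dvd shift a p}) \<le> Y * ((1/2) ^ K * (\<Prod>q\<in>S. 2 * wt q))" .
    qed
    also have "\<dots> \<le> (\<Sum>S\<in>Pow A. Y * ((1/2) ^ K * (\<Prod>q\<in>S. 2 * wt q)))"
      using Y0 wtA by (intro sum_mono2 mult_nonneg_nonneg prod_nonneg) (auto simp: \<S>_def A_def)
    also have "\<dots> = Y * ((1/2) ^ K * (\<Prod>q\<in>A. 1 + 2 * wt q))"
    proof -
      have "(\<Prod>q\<in>A. 2 * wt q + 1) = (\<Sum>S\<in>Pow A. (\<Prod>q\<in>S. 2 * wt q) * (\<Prod>q\<in>A - S. 1))"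
        by (rule prod_add) (simp add: A_def)
      then show ?thesis by (simp add: sum_distrib_left add.commute)
    qed
    also have "\<dots> \<le> Y * ((1/2) ^ K * (exp 38 * (ln T)\<^sup>2))"
    proof (intro mult_left_mono Y0)
      have "(\<Prod>q\<in>A. 1 + 2 * wt q) \<le> exp (\<Sum>q\<in>A. 2 * wt q)" using wtA by (intro prod_one_plus_le_exp_sum) (auto simp: A_def)
      also have "\<dots> \<le> exp (2 * (ln (ln T) + 19))" unfolding sum_distrib_left[symmetric] A_def using sum_wt_le[OF T(1)] by simp
      also have "\<dots> = exp 38 * exp (2 * ln (ln T))" by (simp flip: exp_add)
      also have "exp (2 * ln (ln T)) = (ln T)\<^sup>2" using lnT exp_double[of "ln (ln T)"] by simp
      finally show "(\<Prod>q\<in>A. 1 + 2 * wt q) \<le> exp 38 * (ln T)\<^sup>2" .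
    qed auto
    finally show "real (card {p\<in>sprimes a x. K \<le> card (pdiv T (shift a p))}) \<le> C * exp 38 * (x / ln x) * ((1/2) ^ K * (ln T)\<^sup>2)"
      by (simp add: Y_def mult_ac)
  qed
qed

text \<open>Markov's inequality for the number of prime factors in the range. The mean is governed
  by a difference of two Mertens sums, whence \<open>22 = 2 * 11\<close>, and the upper end
  \<open>sqrt x / 2\<close> is the limit of \<open>card_dvd_shift_le\<close> for a single
  prime.\<close>

lemma card_medium_divisors_le:
  fixes a :: int
  assumes a: "a \<noteq> 0"
  obtains C X0 where "C > 0"
    "\<And>x T r. X0 \<le> x \<Longrightarrow> 2 \<le> T \<Longrightarrow> T \<le> sqrt x / 2 \<Longrightarrow> 0 < r \<Longrightarrow>
    real (card {p\<in>sprimes a x. r \<le> real (card {q. prime q \<and> T < real q \<and> real q \<le> sqrt x / 2 \<and> q dvd shift a p})})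
      \<le> C * (x / ln x) * ((ln (ln x) - ln (ln T) + 22) / r)"
proof -
  obtain C X0 where C: "C > 0" and X0: "\<And>x S. x \<ge> X0 \<Longrightarrow> finite S \<Longrightarrow> (\<forall>q\<in>S. prime q) \<Longrightarrow> 2 * real (\<Prod>S) \<le> sqrt x \<Longrightarrow>
    real (card {p\<in>sprimes a x. \<Prod>S dvd shift a p}) \<le> C * (x / ln x) * (\<Prod>q\<in>S. wt q)"
    by (rule card_dvd_shift_le[OF a], rule that, assumption, blast)
  have Cpos: "C * 4 > 0" using C by simp
  show ?thesis
  proof (rule that[OF Cpos, of "max X0 3"])
    fix x T r :: real
    assume x: "max X0 3 \<le> x" and T: "2 \<le> T" "T \<le> sqrt x / 2" and r: "0 < r"
    define y where "y = sqrt x / 2"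
    define M where "M = {q. prime q \<and> T < real q \<and> real q \<le> y}"
    define Y where "Y = C * (x / ln x)"
    define \<P> where "\<P> = sprimes a x"
    let ?d = "\<lambda>p. {q\<in>M. q dvd shift a p}"
    have lnx: "ln x > 0" using x by auto
    have Y0: "Y \<ge> 0" unfolding Y_def using C lnx x by simp
    have Meq: "M = primes_upto y - primes_upto T" using T by (auto simp: M_def y_def)
    have finM: "finite M" by (simp add: Meq)
    have "r * real (card {p\<in>\<P>. r \<le> real (card (?d p))}) = (\<Sum>p | p \<in> \<P> \<and> r \<le> real (card (?d p)). r)" by simp
    also have "\<dots> \<le> (\<Sum>p | p \<in> \<P> \<and> r \<le> real (card (?d p)). real (card (?d p)))" by (intro sum_mono) auto
    also have "\<dots> \<le> (\<Sum>p\<in>\<P>. real (card (?d p)))" by (intro sum_mono2) (auto simp: \<P>_def)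
    also have "\<dots> = (\<Sum>p\<in>\<P>. \<Sum>q\<in>M. of_bool (q dvd shift a p))"
      using finM by (intro sum.cong refl) (simp add: of_bool_def sum.If_cases Int_def)
    also have "\<dots> = (\<Sum>q\<in>M. \<Sum>p\<in>\<P>. of_bool (q dvd shift a p))" by (rule sum.swap)
    also have "\<dots> = (\<Sum>q\<in>M. real (card {p\<in>\<P>. q dvd shift a p}))"
      by (intro sum.cong refl) (simp add: of_bool_def sum.If_cases Int_def \<P>_def)
    also have "\<dots> \<le> (\<Sum>q\<in>M. Y * (4 * (1 / real q)))"
    proof (rule sum_mono)
      fix q assume q: "q \<in> M"
      then have pq: "prime q" "2 * real q \<le> sqrt x" by (auto simp: M_def y_def)
      have "real (card {p\<in>\<P>. q dvd shift a p}) \<le> Y * wt q"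
        using X0[of x "{q}"] x pq unfolding Y_def \<P>_def by simp
      also have "\<dots> \<le> Y * (4 * (1 / real q))" using Y0 wt_bounds(3)[OF pq(1)] by (intro mult_left_mono)
      finally show "real (card {p\<in>\<P>. q dvd shift a p}) \<le> Y * (4 * (1 / real q))" .
    qed
    also have "\<dots> = Y * (4 * (\<Sum>q\<in>M. 1 / real q))" by (simp add: sum_distrib_left)
    also have "\<dots> \<le> Y * (4 * (ln (ln x) - ln (ln T) + 22))"
    proof (intro mult_left_mono Y0)
      have "(\<Sum>q\<in>M. 1 / real q) = (\<Sum>q\<in>primes_upto y. 1 / real q) - (\<Sum>q\<in>primes_upto T. 1 / real q)"
        unfolding Meq using T(2)[folded y_def] by (intro sum_diff finite_primes_upto) auto
      also have "\<dots> \<le> ln (ln y) - ln (ln T) + 22" using mertens[of y] mertens[of T] T unfolding y_def by linarith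
      also have "ln (ln y) \<le> ln (ln x)"
      proof -
        have "sqrt x * 1 \<le> sqrt x * sqrt x" using x by (intro mult_left_mono) auto
        then have "y \<le> x" using x unfolding y_def by simp
        moreover have "y \<ge> 2" using T by (simp add: y_def)
        ultimately have "ln y \<le> ln x" "0 < ln y" by auto
        then show ?thesis by simp
      qed
      finally show "(\<Sum>q\<in>M. 1 / real q) \<le> ln (ln x) - ln (ln T) + 22" by simp
    qed auto
    finally have "real (card {p\<in>\<P>. r \<le> real (card (?d p))}) \<le> Y * (4 * (ln (ln x) - ln (ln T) + 22)) / r"
      using r by (simp add: pos_le_divide_eq mult.commute)
    moreover have YZ: "Y * (4 * Z) / r = C * 4 * (x / ln x) * (Z / r)" for Z by (simp add: Y_def)
    moreover have "?d p = {q. prime q \<and> T < real q \<and> real q \<le> sqrt x / 2 \<and> q dvd shift a p}" for p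
      by (auto simp: M_def y_def)
    ultimately show "real (card {p\<in>sprimes a x. r \<le> real (card {q. prime q \<and> T < real q \<and> real q \<le> sqrt x / 2 \<and> q dvd shift a p})})
      \<le> C * 4 * (x / ln x) * ((ln (ln x) - ln (ln T) + 22) / r)"
      unfolding \<P>_def by (simp only: YZ)
  qed
qed

text \<open>Three such primes would have a product exceeding
  \<open>(sqrt x / 2) ^ 3 = x * (sqrt x / 8)\<close>, which is at least \<open>2 * x\<close> once
  \<open>sqrt x \<ge> 16\<close>.\<close>

lemma card_large_divisors_le:
  fixes n :: nat and x :: real
  assumes "n > 0" "real n \<le> 2 * x" "x \<ge> 256"
  shows "card {q. prime q \<and> sqrt x / 2 < real q \<and> q dvd n} \<le> 2"
proof (rule ccontr)
  let ?D = "{q. prime q \<and> sqrt x / 2 < real q \<and> q dvd n}"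
  assume "\<not> card ?D \<le> 2"
  then have "3 \<le> card ?D" by simp
  then obtain S where S: "S \<subseteq> ?D" "card S = 3" "finite S" using obtain_subset_with_card_n[of 3 ?D] by blast
  have "\<Prod>S dvd n" using S by (intro prod_primes_dvd) auto
  then have "\<Prod>S \<le> n" using assms(1) by (intro dvd_imp_le)
  then have "real (\<Prod>S) \<le> real n" by (simp only: of_nat_le_iff)
  then have le: "real (\<Prod>S) \<le> 2 * x" using assms(2) by linarith
  have s16: "sqrt x \<ge> 16" using real_sqrt_le_mono[OF assms(3)] by simp
  obtain q0 where q0: "q0 \<in> S" using S by fastforce
  have "(\<Prod>q\<in>S. sqrt x / 2) < (\<Prod>q\<in>S. real q)"
  proof (rule prod_mono_strict[OF q0])
    show "sqrt x / 2 < real q0" using S(1) q0 by auto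
    show "0 < real i" if "i \<in> S" for i using S(1) that by (auto simp: prime_gt_0_nat)
    show "0 \<le> sqrt x / 2 \<and> sqrt x / 2 \<le> real i" if "i \<in> S" for i using S(1) that assms(3) by auto
  qed (use S in auto)
  then have "(sqrt x / 2) ^ 3 < real (\<Prod>S)" using S by simp
  moreover have "(sqrt x / 2) ^ 3 = x * (sqrt x / 8)"
  proof -
    have "(sqrt x / 2) ^ 3 = (sqrt x * sqrt x) * (sqrt x / 8)" by (simp add: power3_eq_cube)
    then show ?thesis using assms(3) by simp
  qed
  moreover have "x * (sqrt x / 8) \<ge> x * 2" using s16 assms(3) by (intro mult_left_mono) auto
  ultimately show False using le by linarith
qed

section \<open>From counts of prime factors to the extrema of Lambda\<close>

lemma iter_ln_simps: "iter_ln 2 t = ln (ln t)" "iter_ln 4 t = ln (ln (ln (ln t)))"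
  by (simp_all add: iter_ln_def numeral_eq_Suc)

lemma Lambda_eq: "Lambda n t = (real (omega_on n {2..t}) - ln (ln t)) / phi (ln (ln t))"
  by (simp add: Lambda_def iter_ln_simps phi_def)

lemma omega_on_eq_cnt:
  assumes "n > 0" "t \<le> T"
  shows "real (omega_on n {2..t}) = cnt (pdiv T n) t"
proof -
  have "{q \<in> prime_factors n. real q \<in> {2..t}} = {q \<in> pdiv T n. real q \<le> t}"
    using assms by (auto simp: pdiv_def in_prime_factors_iff prime_ge_2_nat)
  then show ?thesis by (simp add: omega_on_def cnt_def)
qed

lemma omega_on_le_cnt_add:
  assumes "n > 0" "T \<le> t"
  shows "cnt (pdiv T n) T \<le> real (omega_on n {2..t})"
    "real (omega_on n {2..t}) \<le> cnt (pdiv T n) T + real (card {q. prime q \<and> T < real q \<and> q dvd n})"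
proof -
  let ?A = "{q \<in> prime_factors n. real q \<in> {2..t}}" and ?B = "{q \<in> pdiv T n. real q \<le> T}"
    and ?R = "{q. prime q \<and> T < real q \<and> q dvd n}"
  have finR: "finite ?R" by (rule finite_subset[of _ "prime_factors n"]) (use assms in \<open>auto simp: in_prime_factors_iff\<close>)
  have finB: "finite ?B" by (rule finite_subset[of _ "primes_upto T"]) (auto simp: pdiv_def)
  have "?B \<subseteq> ?A" using assms by (auto simp: pdiv_def in_prime_factors_iff prime_ge_2_nat)
  then show "cnt (pdiv T n) T \<le> real (omega_on n {2..t})"
    unfolding cnt_def omega_on_def of_nat_le_iff by (intro card_mono) auto
  have "?A \<subseteq> ?B \<union> ?R" by (auto simp: pdiv_def in_prime_factors_iff)
  then have "card ?A \<le> card (?B \<union> ?R)" using finB finR by (intro card_mono) auto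
  also have "\<dots> \<le> card ?B + card ?R" by (rule card_Un_le)
  finally show "real (omega_on n {2..t}) \<le> cnt (pdiv T n) T + real (card ?R)"
    by (simp add: cnt_def omega_on_def)
qed

text \<open>The deterministic part. Up to \<open>T\<close> the count of prime factors is that of
  \<open>S\<close>. Beyond \<open>T\<close>, count and centring differ from their values at
  \<open>T\<close> by at most the two quantities in the bound by
  \<open>\<epsilon> / 2 * phi (ln (ln T))\<close>, which together with the deviation
  \<open>1 + \<epsilon> / 2\<close> gives \<open>1 + \<epsilon>\<close>, as \<open>phi\<close>
  increases. The values near the extremes are already reached at or before \<open>T\<close>.\<close>

lemma Lambda_extrema:
  fixes \<epsilon> \<xi> T x :: real and n :: nat
  defines "S \<equiv> pdiv T n"
  assumes \<epsilon>: "0 < \<epsilon>" and n: "n > 0" and \<xi>: "\<xi> \<ge> 3" "ln (ln \<xi>) > 1" "ln (ln (ln (ln \<xi>))) > 0" and T: "\<xi> < T" "T \<le> x"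
    and R: "real (card {q. prime q \<and> T < real q \<and> q dvd n}) + (ln (ln x) - ln (ln T)) \<le> \<epsilon> / 2 * phi (ln (ln T))"
    and dev: "\<not> deviates (\<epsilon> / 2) \<xi> T S"
    and up: "attains 1 \<epsilon> \<xi> T S" and down: "attains (- 1) \<epsilon> \<xi> T S"
  shows "(INF t\<in>{\<xi><..x}. Lambda n t) \<in> {-1 - \<epsilon>..-1 + \<epsilon>} \<and> (SUP t\<in>{\<xi><..x}. Lambda n t) \<in> {1 - \<epsilon>..1 + \<epsilon>}"
proof -
  have phipos: "phi (ln (ln t)) > 0" "phi (ln (ln \<xi>)) \<le> phi (ln (ln t))" if "\<xi> < t" for t
  proof -
    have L: "ln (ln \<xi>) \<le> ln (ln t)" using ln_ln_mono(1)[OF \<xi>(1)] that by simp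
    have "2 * ln (ln \<xi>) * ln (ln (ln (ln \<xi>))) > 0" using \<xi> by (intro mult_pos_pos) linarith+
    then have "phi (ln (ln \<xi>)) > 0" by (simp only: phi_def real_sqrt_gt_0_iff)
    moreover show "phi (ln (ln \<xi>)) \<le> phi (ln (ln t))" using \<xi> L by (intro phi_mono) auto
    ultimately show "phi (ln (ln t)) > 0" by linarith
  qed
  have bnd: "\<bar>Lambda n t\<bar> \<le> 1 + \<epsilon>" if t: "t \<in> {\<xi><..x}" for t
  proof -
    have "\<bar>real (omega_on n {2..t}) - ln (ln t)\<bar> \<le> (1 + \<epsilon>) * phi (ln (ln t))"
    proof (cases "t \<le> T")
      case True
      then have "\<bar>cnt S t - ln (ln t)\<bar> \<le> (1 + \<epsilon> / 2) * phi (ln (ln t))"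
        using dev t unfolding deviates_def by (meson greaterThanAtMost_iff linorder_not_less)
      also have "\<dots> \<le> (1 + \<epsilon>) * phi (ln (ln t))" using \<epsilon> phipos(1)[of t] t by (intro mult_right_mono) auto
      finally show ?thesis using omega_on_eq_cnt[OF n True] by (simp add: S_def)
    next
      case False
      then have Tt: "T \<le> t" by simp
      have T3: "T \<ge> 3" using T \<xi> by linarith
      have LTt: "ln (ln T) \<le> ln (ln t)" using ln_ln_mono(1)[OF T3 Tt] .
      have Ltx: "ln (ln t) \<le> ln (ln x)" using ln_ln_mono(1)[of t x] T3 Tt t by simp
      have LT\<xi>: "ln (ln \<xi>) \<le> ln (ln T)" using ln_ln_mono(1)[OF \<xi>(1)] T by simp
      have "\<bar>cnt S T - ln (ln T)\<bar> \<le> (1 + \<epsilon> / 2) * phi (ln (ln T))"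
        using dev T(1) unfolding deviates_def by (meson linorder_not_less order_refl)
      then have "\<bar>real (omega_on n {2..t}) - ln (ln t)\<bar> \<le> (1 + \<epsilon> / 2) * phi (ln (ln T)) + \<epsilon> / 2 * phi (ln (ln T))"
        using omega_on_le_cnt_add[OF n Tt] R LTt Ltx unfolding S_def by linarith
      also have "\<dots> = (1 + \<epsilon>) * phi (ln (ln T))" by (simp add: algebra_simps)
      also have "\<dots> \<le> (1 + \<epsilon>) * phi (ln (ln t))"
      proof (intro mult_left_mono)
        have lnl: "ln (ln (ln \<xi>)) > 0" using \<xi>(2) by simp
        have "ln (ln (ln \<xi>)) \<le> ln (ln (ln T))" using LT\<xi> \<xi>(2) by simp
        then have "ln (ln (ln (ln \<xi>))) \<le> ln (ln (ln (ln T)))" using lnl by simp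
        then show "phi (ln (ln T)) \<le> phi (ln (ln t))" using LT\<xi> \<xi> LTt by (intro phi_mono) linarith+
      qed (use \<epsilon> in auto)
      finally show ?thesis .
    qed
    then show ?thesis using phipos(1)[of t] t by (simp add: Lambda_eq abs_divide pos_divide_le_eq)
  qed
  obtain t1 where t1: "\<xi> < t1" "t1 \<le> T" "1 * (cnt S t1 - ln (ln t1)) \<ge> (1 - \<epsilon>) * phi (ln (ln t1))"
    using up unfolding attains_def by blast
  obtain t2 where t2: "\<xi> < t2" "t2 \<le> T" "- 1 * (cnt S t2 - ln (ln t2)) \<ge> (1 - \<epsilon>) * phi (ln (ln t2))"
    using down unfolding attains_def by blast
  have L1: "Lambda n t1 \<ge> 1 - \<epsilon>"
    using t1 phipos(1)[OF t1(1)] omega_on_eq_cnt[OF n t1(2)] by (simp add: Lambda_eq pos_le_divide_eq S_def)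
  have L2: "Lambda n t2 \<le> -1 + \<epsilon>"
  proof -
    have "cnt S t2 - ln (ln t2) \<le> (-1 + \<epsilon>) * phi (ln (ln t2))" using t2(3) by (simp add: algebra_simps)
    then show ?thesis
      using phipos(1)[OF t2(1)] omega_on_eq_cnt[OF n t2(2)] by (simp add: Lambda_eq pos_divide_le_eq S_def)
  qed
  have mem: "t1 \<in> {\<xi><..x}" "t2 \<in> {\<xi><..x}" using t1 t2 T by auto
  have ne: "{\<xi><..x} \<noteq> {}" using mem by auto
  have lo: "Lambda n t \<ge> -1 - \<epsilon>" and hi: "Lambda n t \<le> 1 + \<epsilon>" if "t \<in> {\<xi><..x}" for t
    using bnd[OF that] by linarith+
  \<comment> \<open>Infimum and supremum over the reals can be compared with single values only for
    bounded sets.\<close>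
  have bb: "bdd_below (Lambda n ` {\<xi><..x})" using lo by (intro bdd_belowI[of _ "-1 - \<epsilon>"]) auto
  have ba: "bdd_above (Lambda n ` {\<xi><..x})" using hi by (intro bdd_aboveI[of _ "1 + \<epsilon>"]) auto
  have "(INF t\<in>{\<xi><..x}. Lambda n t) \<ge> -1 - \<epsilon>" using ne lo by (intro cINF_greatest)
  moreover have "(INF t\<in>{\<xi><..x}. Lambda n t) \<le> -1 + \<epsilon>" using cINF_lower2[OF bb mem(2) L2] .
  moreover have "(SUP t\<in>{\<xi><..x}. Lambda n t) \<le> 1 + \<epsilon>" using ne hi by (intro cSUP_least)
  moreover have "(SUP t\<in>{\<xi><..x}. Lambda n t) \<ge> 1 - \<epsilon>" using cSUP_upper2[OF ba mem(1) L1] .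
  ultimately show ?thesis by simp
qed

text \<open>\<open>sqrt LL\<close> is the allowance for prime factors above \<open>T\<close>: large
  against the Mertens bound \<open>2 * ln LL + 22\<close>, so that Markov's inequality gives o(1),
  yet small against \<open>phi\<close>. The 2 subtracted from it is for the factors above
  \<open>sqrt x / 2\<close>. The power \<open>(1/2) powr (LL\<^sup>2 / 4)\<close> beats
  \<open>(ln x)\<^sup>2 = exp (2 * LL)\<close>.\<close>

lemma final_asymptotics:
  fixes \<epsilon> C2 C3 c :: real
  assumes "0 < \<epsilon>" "0 < C2" "0 < C3" "0 < c"
  shows "eventually (\<lambda>x. let LL = ln (ln x); T = exp (ln x / LL\<^sup>2) in
    LL > 1 \<and> 3 \<le> T \<and> T \<le> x powr (1/40) \<and> ln x < T \<and> T \<le> x \<and> T \<le> sqrt x / 2 \<and>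
    LL - 2 * ln LL \<ge> (ln LL) ^ 4 \<and> sqrt LL + 2 * ln LL \<le> \<epsilon> / 2 * phi (LL - 2 * ln LL) \<and>
    2 * exp (ln x / 4) \<le> sqrt x \<and>
    C2 * (2 * (1/2) powr (LL\<^sup>2 / 4) * (ln x)\<^sup>2) \<le> c / 3 \<and>
    sqrt LL > 2 \<and> C3 * ((2 * ln LL + 22) / (sqrt LL - 2)) \<le> c / 3) at_top"
proof -
  have 1: "eventually (\<lambda>x::real. ln (ln x) > 1) at_top" by real_asymp
  have 2: "eventually (\<lambda>x::real. 3 \<le> exp (ln x / (ln (ln x))\<^sup>2)) at_top" by real_asymp
  have 3: "eventually (\<lambda>x::real. exp (ln x / (ln (ln x))\<^sup>2) \<le> x powr (1/40)) at_top" by real_asymp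
  have 4: "eventually (\<lambda>x::real. ln x < exp (ln x / (ln (ln x))\<^sup>2)) at_top" by real_asymp
  have 5: "eventually (\<lambda>x::real. exp (ln x / (ln (ln x))\<^sup>2) \<le> x) at_top" by real_asymp
  have 6: "eventually (\<lambda>x::real. exp (ln x / (ln (ln x))\<^sup>2) \<le> sqrt x / 2) at_top" by real_asymp
  have 7: "eventually (\<lambda>x::real. ln (ln x) - 2 * ln (ln (ln x)) \<ge> (ln (ln (ln x))) ^ 4) at_top" by real_asymp
  have "((\<lambda>x. (sqrt (ln (ln x)) + 2 * ln (ln (ln x))) / phi (ln (ln x) - 2 * ln (ln (ln x)))) \<longlongrightarrow> 0) at_top"
    unfolding phi_def by real_asymp
  then have 8: "eventually (\<lambda>x. (sqrt (ln (ln x)) + 2 * ln (ln (ln x))) / phi (ln (ln x) - 2 * ln (ln (ln x))) < \<epsilon> / 2) at_top"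
    by (rule order_tendstoD) (use assms in auto)
  have 85: "eventually (\<lambda>x. phi (ln (ln x) - 2 * ln (ln (ln x))) > 0) at_top" unfolding phi_def by real_asymp
  have 9: "eventually (\<lambda>x::real. 2 * exp (ln x / 4) \<le> sqrt x) at_top" by real_asymp
  have "((\<lambda>x::real. C2 * (2 * (1/2) powr ((ln (ln x))\<^sup>2 / 4) * (ln x)\<^sup>2)) \<longlongrightarrow> 0) at_top" using assms by real_asymp
  then have 10: "eventually (\<lambda>x::real. C2 * (2 * (1/2) powr ((ln (ln x))\<^sup>2 / 4) * (ln x)\<^sup>2) < c / 3) at_top"
    by (rule order_tendstoD) (use assms in auto)
  have 11: "eventually (\<lambda>x::real. sqrt (ln (ln x)) > 2) at_top" by real_asymp
  have "((\<lambda>x::real. C3 * ((2 * ln (ln (ln x)) + 22) / (sqrt (ln (ln x)) - 2))) \<longlongrightarrow> 0) at_top" using assms by real_asymp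
  then have 12: "eventually (\<lambda>x::real. C3 * ((2 * ln (ln (ln x)) + 22) / (sqrt (ln (ln x)) - 2)) < c / 3) at_top"
    by (rule order_tendstoD) (use assms in auto)
  show ?thesis
    using 1 2 3 4 5 6 7 8 85 9 10 11 12
  proof eventually_elim
    case (elim x)
    have "sqrt (ln (ln x)) + 2 * ln (ln (ln x)) \<le> \<epsilon> / 2 * phi (ln (ln x) - 2 * ln (ln (ln x)))"
      using elim(8,9) by (simp only: pos_divide_less_eq less_imp_le)
    then show ?case unfolding Let_def using elim by (intro conjI) (assumption | rule less_imp_le, assumption)+
  qed
qed

theorem theorem4:
  fixes a :: int and \<epsilon> x0 :: real and \<xi> :: "real \<Rightarrow> real"
  assumes "a \<noteq> 0" and "\<epsilon> > 0" and "x0 > 0"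
    and "mono_on {x0..} \<xi>"
    and "filterlim \<xi> at_top at_top"
    and "\<And>x. x \<ge> x0 \<Longrightarrow> \<xi> x \<le> ln x"
  shows "(\<lambda>x. real (card {p :: nat. prime p \<and> \<bar>a\<bar> + 1 < int p \<and> real p \<le> x \<and>
            \<not> ((INF t\<in>{\<xi> x<..x}. Lambda (nat (int p + a)) t) \<in> {-1 - \<epsilon>..-1 + \<epsilon>} \<and>
               (SUP t\<in>{\<xi> x<..x}. Lambda (nat (int p + a)) t) \<in> {1 - \<epsilon>..1 + \<epsilon>})}))
         \<in> o[at_top](\<lambda>x. x / ln x)"
proof (rule landau_o.smallI)
  fix c :: real assume c: "c > 0"
  \<comment> \<open>\<open>model_lower\<close> asks for a value below 1; a smaller value only
    narrows the target intervals.\<close>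
  define e where "e = min \<epsilon> (1/2)"
  have e: "0 < e" "e < 1" "e \<le> \<epsilon>" using assms(2) by (auto simp: e_def)
  obtain C1 X1 where C1: "C1 > 0" and X1: "\<And>x T X. x \<ge> X1 \<Longrightarrow> 2 \<le> T \<Longrightarrow> T \<le> x powr (1/40) \<Longrightarrow>
    real (card {p\<in>sprimes a x. real (\<Prod>(pdiv T (shift a p))) \<le> sqrt x \<and> X (pdiv T (shift a p))})
      \<le> C1 * (x / ln x) * bprob mp (primes_upto T) X"
    by (rule card_pdiv_le_bprob[OF assms(1)], rule that, assumption, blast)
  obtain C2 X2 where C2: "C2 > 0" and X2: "\<And>x T K. x \<ge> X2 \<Longrightarrow> 2 \<le> T \<Longrightarrow> 2 * T ^ K \<le> sqrt x \<Longrightarrow>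
    real (card {p\<in>sprimes a x. K \<le> card (pdiv T (shift a p))}) \<le> C2 * (x / ln x) * ((1/2) ^ K * (ln T)\<^sup>2)"
    by (rule card_many_divisors_le[OF assms(1)], rule that, assumption, blast)
  obtain C3 X3 where C3: "C3 > 0" and X3: "\<And>x T r. x \<ge> X3 \<Longrightarrow> 2 \<le> T \<Longrightarrow> T \<le> sqrt x / 2 \<Longrightarrow> 0 < r \<Longrightarrow>
    real (card {p\<in>sprimes a x. r \<le> real (card {q. prime q \<and> T < real q \<and> real q \<le> sqrt x / 2 \<and> q dvd shift a p})})
      \<le> C3 * (x / ln x) * ((ln (ln x) - ln (ln T) + 22) / r)"
    by (rule card_medium_divisors_le[OF assms(1)], rule that, assumption, blast)
  \<comment> \<open>Three exceptional sets receive \<open>c / 3\<close> each, and the one that comes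
    from the model consists of three events of probability at most \<open>\<delta>\<close>; hence
    9.\<close>
  define \<delta> where "\<delta> = c / (9 * C1)"
  have \<delta>: "\<delta> > 0" "C1 * (3 * \<delta>) = c / 3" using c C1 by (auto simp: \<delta>_def)
  obtain \<Lambda>0 where \<Lambda>0: "\<And>u T. u \<ge> 3 \<Longrightarrow> ln (ln u) \<ge> \<Lambda>0 \<Longrightarrow> bprob mp (primes_upto T) (deviates (e / 2) u T) \<le> \<delta>"
    using model_upper[of "e / 2" \<delta>] e \<delta> by auto
  obtain \<Lambda>1 where \<Lambda>1: "\<And>u T. u \<ge> 3 \<Longrightarrow> T \<ge> 3 \<Longrightarrow> ln (ln u) \<ge> \<Lambda>1 \<Longrightarrow> ln (ln T) \<ge> ln (ln u) ^ 4 \<Longrightarrow>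
      bprob mp (primes_upto T) (\<lambda>S. \<not> attains 1 e u T S) \<le> \<delta>"
    using model_lower[OF e(1,2) \<delta>(1), of 1] by auto
  obtain \<Lambda>2 where \<Lambda>2: "\<And>u T. u \<ge> 3 \<Longrightarrow> T \<ge> 3 \<Longrightarrow> ln (ln u) \<ge> \<Lambda>2 \<Longrightarrow> ln (ln T) \<ge> ln (ln u) ^ 4 \<Longrightarrow>
      bprob mp (primes_upto T) (\<lambda>S. \<not> attains (- 1) e u T S) \<le> \<delta>"
    using model_lower[OF e(1,2) \<delta>(1), of "- 1"] by auto
  \<comment> \<open>\<open>exp 2\<close> makes the third logarithm of \<open>\<xi> x\<close> at
    least 2, so that the fourth is positive.\<close>
  define M where "M = max (max \<Lambda>0 (max \<Lambda>1 \<Lambda>2)) (exp 2)"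
  have "eventually (\<lambda>x. \<xi> x \<ge> exp (exp M)) at_top"
    using assms(5) by (simp only: filterlim_at_top)
  moreover have "eventually (\<lambda>x. x \<ge> max (max X1 (max X2 X3)) (max x0 (max 256 (real_of_int \<bar>a\<bar>)))) at_top"
    by (rule eventually_ge_at_top)
  ultimately show "eventually (\<lambda>x. norm (real (card {p :: nat. prime p \<and> \<bar>a\<bar> + 1 < int p \<and> real p \<le> x \<and>
            \<not> ((INF t\<in>{\<xi> x<..x}. Lambda (nat (int p + a)) t) \<in> {-1 - \<epsilon>..-1 + \<epsilon>} \<and>
               (SUP t\<in>{\<xi> x<..x}. Lambda (nat (int p + a)) t) \<in> {1 - \<epsilon>..1 + \<epsilon>})})) \<le> c * norm (x / ln x)) at_top"
    using final_asymptotics[OF e(1) C2 C3 c]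
  proof eventually_elim
    case (elim x)
    define LL where "LL = ln (ln x)"
    define T where "T = exp (ln x / LL\<^sup>2)"
    define u where "u = \<xi> x"
    have n: "LL > 1" "3 \<le> T" "T \<le> x powr (1/40)" "ln x < T" "T \<le> x" "T \<le> sqrt x / 2"
      "LL - 2 * ln LL \<ge> (ln LL) ^ 4" "sqrt LL + 2 * ln LL \<le> e / 2 * phi (LL - 2 * ln LL)"
      "2 * exp (ln x / 4) \<le> sqrt x" "C2 * (2 * (1/2) powr (LL\<^sup>2 / 4) * (ln x)\<^sup>2) \<le> c / 3"
      "sqrt LL > 2" "C3 * ((2 * ln LL + 22) / (sqrt LL - 2)) \<le> c / 3"
      using elim(3) unfolding Let_def LL_def[symmetric] T_def[symmetric] by blast+
    have x: "x \<ge> X1" "x \<ge> X2" "x \<ge> X3" "x \<ge> x0" "x \<ge> 256" "real_of_int \<bar>a\<bar> \<le> x" using elim(2) by auto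
    have lnx: "ln x > 0" using x by simp
    have xlnx: "x / ln x > 0" using x lnx by simp
    have eM: "exp (2::real) \<ge> 3" using exp_ge_add_one_self[of "2::real"] by simp
    have M: "M \<ge> exp 2" "M \<ge> \<Lambda>0" "M \<ge> \<Lambda>1" "M \<ge> \<Lambda>2" unfolding M_def by auto
    have u3: "u \<ge> 3" using elim(1) exp_exp_ge_3[of M] M(1) eM unfolding u_def by linarith
    have uM: "ln (ln u) \<ge> M" using elim(1) le_exp_exp_iff(2)[OF u3] unfolding u_def by blast
    have ux: "u \<le> ln x" unfolding u_def using assms(6) x by simp
    have uT: "u < T" using ux n(4) by linarith
    have u1: "ln (ln u) > 1" using uM M(1) eM by linarith
    have "ln (ln (ln u)) \<ge> ln (exp 2)" using uM M(1) u1 by (subst ln_le_cancel_iff) auto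
    then have u2: "ln (ln (ln (ln u))) > 0" by simp
    have LT: "ln (ln T) = LL - 2 * ln LL"
    proof -
      have "ln (ln x / LL\<^sup>2) = ln (ln x) - ln (LL\<^sup>2)" using lnx n(1) by (intro ln_divide_pos) auto
      also have "ln (LL\<^sup>2) = 2 * ln LL" by (simp add: ln_realpow)
      finally show ?thesis by (simp add: T_def LL_def)
    qed
    \<comment> \<open>The bound \<open>\<xi> x \<le> ln x\<close> enters here: it gives
      \<open>ln (ln u) \<le> ln LL\<close>, and the fourth power of this is still below
      \<open>ln (ln T)\<close>.\<close>
    have uT4: "ln (ln T) \<ge> ln (ln u) ^ 4"
    proof -
      have "ln u \<ge> 1" using ln_ln_mono(2)[OF u3 order_refl] .
      have "ln (ln u) \<le> ln (ln (ln x))" using ln_ln_mono(1)[OF u3 ux] .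
      then have "ln (ln u) ^ 4 \<le> (ln LL) ^ 4" using u1 unfolding LL_def by (intro power_mono) auto
      then show ?thesis using n(7) LT by linarith
    qed
    define X where "X = (\<lambda>S. deviates (e / 2) u T S \<or> \<not> attains 1 e u T S \<or> \<not> attains (- 1) e u T S)"
    have PX: "bprob mp (primes_upto T) X \<le> 3 * \<delta>"
    proof -
      have p01: "\<And>q. q \<in> primes_upto T \<Longrightarrow> 0 \<le> mp q \<and> mp q \<le> 1" using mp_prime by auto
      have "bprob mp (primes_upto T) X \<le> bprob mp (primes_upto T) (deviates (e / 2) u T) +
          bprob mp (primes_upto T) (\<lambda>S. \<not> attains 1 e u T S \<or> \<not> attains (- 1) e u T S)"
        unfolding X_def by (rule bprob_disj[OF p01])
      also have "bprob mp (primes_upto T) (\<lambda>S. \<not> attains 1 e u T S \<or> \<not> attains (- 1) e u T S)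
          \<le> bprob mp (primes_upto T) (\<lambda>S. \<not> attains 1 e u T S) + bprob mp (primes_upto T) (\<lambda>S. \<not> attains (- 1) e u T S)"
        by (rule bprob_disj[OF p01])
      also have "bprob mp (primes_upto T) (deviates (e / 2) u T) \<le> \<delta>" using u3 uM M by (intro \<Lambda>0) linarith+
      also have "bprob mp (primes_upto T) (\<lambda>S. \<not> attains 1 e u T S) \<le> \<delta>"
        using u3 uM M uT4 n(2) by (intro \<Lambda>1) linarith+
      also have "bprob mp (primes_upto T) (\<lambda>S. \<not> attains (- 1) e u T S) \<le> \<delta>"
        using u3 uM M uT4 n(2) by (intro \<Lambda>2) linarith+
      finally show ?thesis by simp
    qed
    \<comment> \<open>A product of \<open>K\<close> primes up to \<open>T\<close> is at most
      \<open>exp (ln x / 4)\<close>, which the sieve can handle.\<close>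
    define K where "K = nat \<lfloor>LL\<^sup>2 / 4\<rfloor>"
    have K: "real K \<le> LL\<^sup>2 / 4" "LL\<^sup>2 / 4 < real K + 1"
      unfolding K_def by (auto intro: of_nat_floor) linarith
    have TK: "2 * T ^ K \<le> sqrt x"
    proof -
      have "T ^ K = exp (real K * (ln x / LL\<^sup>2))" unfolding T_def by (rule exp_of_nat_mult[symmetric])
      also have "\<dots> \<le> exp (ln x / 4)"
      proof -
        have "real K * (ln x / LL\<^sup>2) \<le> LL\<^sup>2 / 4 * (ln x / LL\<^sup>2)" using K lnx by (intro mult_right_mono) auto
        also have "\<dots> = ln x / 4" using n(1) by simp
        finally show ?thesis by simp
      qed
      finally show ?thesis using n(9) by linarith
    qed
    \<comment> \<open>The exceptional primes have too many prime factors of \<open>p + a\<close> up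
      to \<open>T\<close> for the sieve (\<open>B1\<close>), too many between \<open>T\<close> and
      \<open>sqrt x / 2\<close> (\<open>B2\<close>), or a set of small prime factors that is
      unfavourable in the model (\<open>B3\<close>).\<close>
    define B1 where "B1 = {p\<in>sprimes a x. K \<le> card (pdiv T (shift a p))}"
    define r where "r = sqrt LL - 2"
    define B2 where "B2 = {p\<in>sprimes a x. r \<le> real (card {q. prime q \<and> T < real q \<and> real q \<le> sqrt x / 2 \<and> q dvd shift a p})}"
    define B3 where "B3 = {p\<in>sprimes a x. real (\<Prod>(pdiv T (shift a p))) \<le> sqrt x \<and> X (pdiv T (shift a p))}"
    have b1: "real (card B1) \<le> c / 3 * (x / ln x)"
    proof -
      have "real (card B1) \<le> C2 * (x / ln x) * ((1/2) ^ K * (ln T)\<^sup>2)"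
        unfolding B1_def using x(2) n(2) TK by (intro X2) linarith+
      also have "\<dots> \<le> C2 * (x / ln x) * ((2 * (1/2) powr (LL\<^sup>2 / 4)) * (ln x)\<^sup>2)"
      proof (intro mult_left_mono mult_mono power_mono)
        have "(1/2 :: real) ^ K = (1/2) powr real K" by (simp add: powr_realpow)
        also have "\<dots> \<le> (1/2) powr (LL\<^sup>2 / 4 - 1)" using K by (intro powr_mono') auto
        also have "\<dots> = 2 * (1/2) powr (LL\<^sup>2 / 4)" by (simp add: powr_diff)
        finally show "(1/2 :: real) ^ K \<le> 2 * (1/2) powr (LL\<^sup>2 / 4)" .
        show "ln T \<le> ln x" using n by simp
      qed (use n xlnx C2 in auto)
      also have "\<dots> = C2 * (2 * (1/2) powr (LL\<^sup>2 / 4) * (ln x)\<^sup>2) * (x / ln x)" by (simp only: mult_ac)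
      also have "\<dots> \<le> c / 3 * (x / ln x)" using n(10) xlnx by (intro mult_right_mono) auto
      finally show ?thesis .
    qed
    have b2: "real (card B2) \<le> c / 3 * (x / ln x)"
    proof -
      have "real (card B2) \<le> C3 * (x / ln x) * ((ln (ln x) - ln (ln T) + 22) / r)"
        unfolding B2_def using x(3) n(2,6,11) by (intro X3) (auto simp: r_def)
      also have "\<dots> = C3 * ((2 * ln LL + 22) / (sqrt LL - 2)) * (x / ln x)"
        unfolding LT LL_def[symmetric] r_def by (simp add: mult_ac)
      also have "\<dots> \<le> c / 3 * (x / ln x)" using n(12) xlnx by (intro mult_right_mono) auto
      finally show ?thesis .
    qed
    have b3: "real (card B3) \<le> c / 3 * (x / ln x)"
    proof -
      have "real (card B3) \<le> C1 * (x / ln x) * bprob mp (primes_upto T) X"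
        unfolding B3_def using x(1) n(2,3) by (intro X1) linarith+
      also have "\<dots> \<le> C1 * (x / ln x) * (3 * \<delta>)" using PX mult_pos_pos[OF C1 xlnx] by (intro mult_left_mono) linarith+
      also have "\<dots> = C1 * (3 * \<delta>) * (x / ln x)" by (simp only: mult_ac)
      finally show ?thesis unfolding \<delta>(2) .
    qed
    let ?bad = "{p :: nat. prime p \<and> \<bar>a\<bar> + 1 < int p \<and> real p \<le> x \<and>
            \<not> ((INF t\<in>{\<xi> x<..x}. Lambda (nat (int p + a)) t) \<in> {-1 - \<epsilon>..-1 + \<epsilon>} \<and>
               (SUP t\<in>{\<xi> x<..x}. Lambda (nat (int p + a)) t) \<in> {1 - \<epsilon>..1 + \<epsilon>})}"
    have "?bad \<subseteq> B1 \<union> (B2 \<union> B3)"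
    proof (rule subsetI, rule ccontr)
      fix p assume p: "p \<in> ?bad" and np: "p \<notin> B1 \<union> (B2 \<union> B3)"
      have ps: "p \<in> sprimes a x" using p by (simp add: sprimes_def)
      define m where "m = shift a p"
      define S where "S = pdiv T m"
      have m: "m > 0" "real m \<le> 2 * x" using shift_bounds[OF ps] x unfolding m_def by linarith+
      have cS: "card S < K" using np ps by (simp add: B1_def S_def m_def)
      have "real (\<Prod>S) \<le> (\<Prod>q\<in>S. T)" unfolding of_nat_prod S_def using pdiv_subset by (intro prod_mono) auto
      also have "\<dots> = T ^ card S" by simp
      also have "\<dots> \<le> T ^ K" using cS n(2) by (intro power_increasing) auto
      finally have "real (\<Prod>S) \<le> T ^ K" .
      moreover have "0 \<le> T ^ K" using n(2) by simp
      ultimately have "real (\<Prod>S) \<le> sqrt x" using TK by linarith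
      then have nX: "\<not> X S" using np ps by (simp add: B3_def S_def m_def del: of_nat_prod)
      have R: "real (card {q. prime q \<and> T < real q \<and> q dvd m}) \<le> sqrt LL"
      proof -
        let ?A = "{q. prime q \<and> T < real q \<and> real q \<le> sqrt x / 2 \<and> q dvd m}" and ?B = "{q. prime q \<and> sqrt x / 2 < real q \<and> q dvd m}"
        have fin: "finite {q. prime q \<and> q dvd m}" using m(1) by (rule_tac finite_subset[of _ "{..m}"]) (auto dest: dvd_imp_le)
        have "card {q. prime q \<and> T < real q \<and> q dvd m} \<le> card (?A \<union> ?B)"
          by (intro card_mono finite_subset[OF _ fin]) auto
        also have "\<dots> \<le> card ?A + card ?B" by (rule card_Un_le)
        also have "card ?B \<le> 2" using m x(5) by (intro card_large_divisors_le)
        finally have "real (card {q. prime q \<and> T < real q \<and> q dvd m}) \<le> real (card ?A) + 2" by simp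
        moreover have "real (card ?A) < r" using np ps by (simp add: B2_def m_def)
        ultimately show ?thesis unfolding r_def by linarith
      qed
      have "(INF t\<in>{u<..x}. Lambda m t) \<in> {-1 - e..-1 + e} \<and> (SUP t\<in>{u<..x}. Lambda m t) \<in> {1 - e..1 + e}"
      proof (rule Lambda_extrema[OF e(1) m(1) u3 u1 u2 uT n(5)])
        show "real (card {q. prime q \<and> T < real q \<and> q dvd m}) + (ln (ln x) - ln (ln T)) \<le> e / 2 * phi (ln (ln T))"
          using R n(8) unfolding LT LL_def[symmetric] by linarith
        show "\<not> deviates (e / 2) u T (pdiv T m)" "attains 1 e u T (pdiv T m)" "attains (- 1) e u T (pdiv T m)"
          using nX unfolding X_def S_def by auto
      qed
      then show False using p e(3) unfolding m_def shift_def u_def by auto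
    qed
    then have "card ?bad \<le> card (B1 \<union> (B2 \<union> B3))"
      by (intro card_mono) (auto simp: B1_def B2_def B3_def)
    also have "\<dots> \<le> card B1 + (card B2 + card B3)"
      by (rule order_trans[OF card_Un_le add_left_mono[OF card_Un_le]])
    finally have "real (card ?bad) \<le> real (card B1) + (real (card B2) + real (card B3))"
      by (simp only: of_nat_add[symmetric] of_nat_le_iff)
    also have "\<dots> \<le> c / 3 * (x / ln x) + (c / 3 * (x / ln x) + c / 3 * (x / ln x))"
      by (intro add_mono b1 b2 b3)
    also have "\<dots> = c * (x / ln x)" by simp
    finally show ?case using xlnx by (simp only: real_norm_def abs_of_nat abs_of_pos)
  qed
qed

end
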